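(* Every compact Hausdorff space which is PR-scattered has the Complex Stone-Weierstrass Property (CSWP).
   Context: All spaces are Hausdorff. For compact $X$, $C(X)=C(X,\mathbb{C})$ carries the supremum norm. $\mathcal{A}\sqsubseteq C(X)$ means that $\mathcal{A}$ is a complex subalgebra of $C(X)$ which separates points and contains the constant functions; $\mathcal{A}\sqsubseteq^{c} C(X)$ means in addition that $\mathcal{A}$ is closed in $C(X)$. $X$ has the CSWP iff every $\mathcal{A}\sqsubseteq C(X)$ is dense in $C(X)$. An idempotent is an $f\in C(X)$ with $f^2=f$; the trivial idempotents are the constants $0$ and $1$. For $\mathcal{A}\sqsubseteq^{c} C(X)$, a closed $H\subseteq X$ is a boundary for $\mathcal{A}$ iff $\sup_{x\in H}|f(x)| = \|f\|$ for all $f\in\mathcal{A}$; the Šilov boundary $\mathrm{Sh}(\mathcal{A})$ is the smallest closed boundary for $\mathcal{A}$ (it exists). A compact space $H$ is removable iff for all $X,U,\mathcal{A}$: if $X$ is compact, $U\subsetneqq X$ is open, $\overline U$ is homeomorphic to a subspace of $H$, $\mathcal{A}\sqsubseteq^{c} C(X)$, and all idempotents of $\mathcal{A}$ are trivial, then $\mathrm{Sh}(\mathcal{A})\subseteq X\setminus U$. For a regular (complex) Borel measure $\mu$ on a compact space $H$, $\mathrm{supt}(\mu)$ is its closed support, i.e. the complement of the union of all open sets $V$ with $|\mu|(V)=0$. A compact space $H$ is pseudo-removable (PR) iff $\mathrm{supt}(\mu)$ is removable for every regular Borel measure $\mu$ on $H$. A compact space $X$ is PR-scattered iff for every non-empty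 closed $F\subseteq X$ there is a non-empty $U\subseteq F$, relatively open in $F$, such that $\overline U$ is PR. *)

theory Defs
  imports "HOL-Analysis.Analysis"
begin

section \<open>Function algebras\<close>

text \<open>
  For compact X this is C(X) with the supremum metric.  Its elements are extensional: they take
  the value undefined off the underlying set, so the pointwise operations below are restricted
  to that set.
\<close>

abbreviation cfun :: "'a topology \<Rightarrow> ('a \<Rightarrow> complex) metric" where
  "cfun X \<equiv> cfunspace X euclidean_metric"

definition subalgebra :: "'a topology \<Rightarrow> ('a \<Rightarrow> complex) set \<Rightarrow> bool" where
  "subalgebra X A \<longleftrightarrow>
     A \<subseteq> mspace (cfun X) \<and>
     (\<forall>f\<in>A. \<forall>g\<in>A. (\<lambda>x\<in>topspace X. f x + g x) \<in> A) \<and>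
     (\<forall>f\<in>A. \<forall>g\<in>A. (\<lambda>x\<in>topspace X. f x * g x) \<in> A) \<and>
     (\<forall>c. \<forall>f\<in>A. (\<lambda>x\<in>topspace X. c * f x) \<in> A)"

definition function_algebra :: "'a topology \<Rightarrow> ('a \<Rightarrow> complex) set \<Rightarrow> bool" where
  "function_algebra X A \<longleftrightarrow>
     subalgebra X A \<and>
     (\<forall>x\<in>topspace X. \<forall>y\<in>topspace X. x \<noteq> y \<longrightarrow> (\<exists>f\<in>A. f x \<noteq> f y)) \<and>
     (\<forall>c. (\<lambda>x\<in>topspace X. c) \<in> A)"

definition closed_function_algebra :: "'a topology \<Rightarrow> ('a \<Rightarrow> complex) set \<Rightarrow> bool" where
  "closed_function_algebra X A \<longleftrightarrow>
     function_algebra X A \<and> closedin (mtopology_of (cfun X)) A"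

definition CSWP :: "'a topology \<Rightarrow> bool" where
  "CSWP X \<longleftrightarrow>
     (\<forall>A. function_algebra X A \<longrightarrow> mtopology_of (cfun X) closure_of A = mspace (cfun X))"

definition idempotent :: "'a topology \<Rightarrow> ('a \<Rightarrow> complex) \<Rightarrow> bool" where
  "idempotent X f \<longleftrightarrow> f \<in> mspace (cfun X) \<and> (\<forall>x\<in>topspace X. (f x)\<^sup>2 = f x)"

definition trivial_idempotents :: "'a topology \<Rightarrow> ('a \<Rightarrow> complex) set \<Rightarrow> bool" where
  "trivial_idempotents X A \<longleftrightarrow>
     (\<forall>f\<in>A. idempotent X f \<longrightarrow> f = (\<lambda>x\<in>topspace X. 0) \<or> f = (\<lambda>x\<in>topspace X. 1))"

text \<open>
  The empty set is not a boundary for a function algebra on a non-empty X, whatever value the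
  real supremum of the empty set has: the constants 0 and 1 have different norms.
\<close>

definition boundary :: "'a topology \<Rightarrow> ('a \<Rightarrow> complex) set \<Rightarrow> 'a set \<Rightarrow> bool" where
  "boundary X A H \<longleftrightarrow>
     closedin X H \<and> (\<forall>f\<in>A. (SUP x\<in>H. cmod (f x)) = (SUP x\<in>topspace X. cmod (f x)))"

definition shilov :: "'a topology \<Rightarrow> ('a \<Rightarrow> complex) set \<Rightarrow> 'a set" where
  "shilov X A = (LEAST H. boundary X A H)"


section \<open>Removable spaces\<close>

text \<open>
  Removability quantifies over compact spaces X of arbitrary size, but a HOL formula can only
  quantify over topologies on one type.  For H on the type 'a, nothing is lost by letting X range
  over the topologies on the functions from pairs over 'a to the complex numbers.
  Indeed, suppose that X, U, A, on any type, violate the condition for H.  As the complement of U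
  is not a boundary, there are f in A and a real c such that |f| \<le> c off U and |f| > c somewhere
  on U.  Let e embed the closure of U into H.  For each pair (p, q) choose g(p, q) in A: if
  p = e(u) and q = e(v) with u \<noteq> v, let it separate u and v; otherwise let it be f.
  Let \<Phi> map x to the family of all g(p, q)(x), let X' = \<Phi>(X) with the product topology, let
  U' consist of the y in X' with |y(p, p)| > c for some (equivalently all) p, and let A' consist
  of the continuous h on X' with h o \<Phi> in A.  Then X' is compact Hausdorff, A' is a closed
  function algebra with only trivial idempotents, and U' is a proper open subset of X'.
  As \<Phi> is injective on the compact set K of all x with |f(x)| \<ge> c and x in the closure of U,
  and the closure of U' lies in \<Phi>(K), that closure is homeomorphic to a subspace of H.
  But the coordinate (p, p) lies in A' and exceeds c only on U', so the complement of U' is not a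
  boundary for A'.  Hence X', U', A' violate the condition as well.
\<close>

definition removable :: "'a topology \<Rightarrow> bool" where
  "removable H \<longleftrightarrow>
     compact_space H \<and> Hausdorff_space H \<and>
     (\<forall>(X :: ('a \<times> 'a \<Rightarrow> complex) topology) U A.
        compact_space X \<longrightarrow> Hausdorff_space X \<longrightarrow>
        openin X U \<longrightarrow> U \<subset> topspace X \<longrightarrow>
        (\<exists>S \<subseteq> topspace H. subtopology X (X closure_of U) homeomorphic_space subtopology H S) \<longrightarrow>
        closed_function_algebra X A \<longrightarrow> trivial_idempotents X A \<longrightarrow>
        shilov X A \<subseteq> topspace X - U)"


section \<open>Regular complex Borel measures\<close>

definition borel_sets :: "'a topology \<Rightarrow> 'a set set" where
  "borel_sets X = sigma_sets (topspace X) {U. openin X U}"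

text \<open>
  Only the values on Borel sets matter.  Taking all sets of the sequence to be empty gives
  that the empty set has measure 0.
\<close>

definition complex_borel_measure :: "'a topology \<Rightarrow> ('a set \<Rightarrow> complex) \<Rightarrow> bool" where
  "complex_borel_measure X \<mu> \<longleftrightarrow>
     (\<forall>B :: nat \<Rightarrow> 'a set. range B \<subseteq> borel_sets X \<longrightarrow> disjoint_family B \<longrightarrow>
        (\<lambda>n. \<mu> (B n)) sums \<mu> (\<Union>n. B n))"

definition total_variation :: "'a topology \<Rightarrow> ('a set \<Rightarrow> complex) \<Rightarrow> 'a set \<Rightarrow> ennreal" where
  "total_variation X \<mu> E =
     (SUP B \<in> {B :: nat \<Rightarrow> 'a set. range B \<subseteq> borel_sets X \<and> disjoint_family B \<and> (\<Union>n. B n) = E}.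
        \<Sum>n. ennreal (cmod (\<mu> (B n))))"

definition regular_borel_measure :: "'a topology \<Rightarrow> ('a set \<Rightarrow> complex) \<Rightarrow> bool" where
  "regular_borel_measure X \<mu> \<longleftrightarrow>
     complex_borel_measure X \<mu> \<and>
     (\<forall>E \<in> borel_sets X.
        total_variation X \<mu> E = (INF V \<in> {V. openin X V \<and> E \<subseteq> V}. total_variation X \<mu> V) \<and>
        total_variation X \<mu> E = (SUP K \<in> {K. compactin X K \<and> K \<subseteq> E}. total_variation X \<mu> K))"

definition supt :: "'a topology \<Rightarrow> ('a set \<Rightarrow> complex) \<Rightarrow> 'a set" where
  "supt X \<mu> = topspace X - \<Union>{V. openin X V \<and> total_variation X \<mu> V = 0}"


section \<open>Pseudo-removable and PR-scattered spaces\<close>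

definition pseudo_removable :: "'a topology \<Rightarrow> bool" where
  "pseudo_removable H \<longleftrightarrow>
     compact_space H \<and> Hausdorff_space H \<and>
     (\<forall>\<mu>. regular_borel_measure H \<mu> \<longrightarrow> removable (subtopology H (supt H \<mu>)))"

definition PR_scattered :: "'a topology \<Rightarrow> bool" where
  "PR_scattered X \<longleftrightarrow>
     (\<forall>F. closedin X F \<longrightarrow> F \<noteq> {} \<longrightarrow>
        (\<exists>U. U \<noteq> {} \<and> openin (subtopology X F) U \<and>
             pseudo_removable (subtopology X (X closure_of U))))"

end

theory Submission
  imports Defs
begin

text \<open>
  If \<open>\<phi>\<close> is not a uniform limit of members of a function algebra A, take a closed set S that is
  minimal among those on which no member of A comes closer than d to \<open>\<phi>\<close>, for a suitable d > 0.
  Minimality has two consequences.  First, gluing approximations on two proper closed subsets shows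
  that every real function in the uniform closure B of A on S is constant (the Machado--Ransford
  argument).  Second, a linear functional on C(S) that annihilates A, has norm at most 1 and
  satisfies \<open>\<Lambda>(\<phi>) \<ge> d\<close> does not vanish over any open set, so its variation is a regular measure with
  support S.  Hence S meets an open set with pseudo-removable closure in a set whose closure is
  contained in a removable space.

  Let K be a minimal closed boundary for B and U a nonempty relatively open subset of K with
  pseudo-removable closure.  By minimality some f in B and some c satisfy |f| \<open>\<le>\<close> c on K - U but not
  on K.  Every continuous \<open>\<psi>\<close> on K that vanishes where |f| \<open>\<le>\<close> c is in B restricted to K: otherwise
  \<open>\<psi>\<close> has a minimal set as above, on which \<open>\<psi>\<close> does not vanish identically, and removability bounds
  |f| on it by c.  By Urysohn's lemma there is a nonconstant real \<open>\<psi>\<close> of this kind, and its extension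
  in B is real on S because K is a boundary.  This contradicts the first consequence.
\<close>

section \<open>Function algebras and uniform closures\<close>

text \<open>Removability asks for trivial idempotents. These come from the first consequence: an
  idempotent has only the real values 0 and 1, so it is constant on a minimal set. Measures enter
  because pseudo-removability says nothing about the closure of an open set itself, only about
  supports of measures on it. As the measure mainly has to charge every nonempty relatively open
  subset of S, the variation of \<Lambda> is built directly as a positive measure from an outer
  content, and \<Lambda> is never written as an integral. Minimal sets are used twice, for \<phi> in
  X and for \<psi> in K. Passing to the boundary K in between loses nothing: restriction to K is
  isometric on B, so the restricted algebra is again uniformly closed, and a member of B that is
  real on K is real on S.\<close>

declare mspace_cfunspace [simp del]

lemma restrict_mem_cong:
  assumes "restrict f S \<in> A" "\<And>x. x \<in> S \<Longrightarrow> f x = g x"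
  shows "restrict g S \<in> A"
  using assms(1) by (simp only: restrict_ext[OF assms(2)])

lemma mspace_cfun:
  assumes "compact_space X"
  shows "mspace (cfun X) = {f. f \<in> extensional (topspace X) \<and> continuous_map X euclidean f}"
  using compactin_mspace_cfunspace[of X "euclidean_metric"] assms
  by (auto simp: compact_space_def)

lemma continuous_map_complex_bounded:
  fixes f :: "'a \<Rightarrow> complex"
  assumes "compact_space X" "continuous_map X euclidean f"
  obtains B where "0 < B" "\<And>x. x \<in> topspace X \<Longrightarrow> cmod (f x) < B"
proof -
  have "compact (f ` topspace X)"
    using assms image_compactin[of X "topspace X" euclidean f] by (auto simp: compact_space_def)
  then obtain B where "\<And>y. y \<in> f ` topspace X \<Longrightarrow> norm y \<le> B"
    using compact_imp_bounded bounded_iff by metis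
  then show thesis
    by (intro that[of "max 0 B + 1"]) force+
qed

lemma continuous_map_mult:
  fixes f g :: "'a \<Rightarrow> 'b::real_normed_algebra"
  assumes "continuous_map X euclidean f" "continuous_map X euclidean g"
  shows "continuous_map X euclidean (\<lambda>x. f x * g x)"
proof -
  have "continuous_map X (prod_topology euclidean euclidean) (\<lambda>x. (f x, g x))"
    using assms by (intro continuous_map_pairedI)
  then have 1: "continuous_map X euclidean (\<lambda>x. (f x, g x))"
    by simp
  have 2: "continuous_map euclidean euclidean (\<lambda>z::'b \<times> 'b. fst z * snd z)"
    by (auto intro!: continuous_intros)
  show ?thesis
    using continuous_map_compose[OF 1 2] by (simp add: comp_def)
qed

text \<open>The closure in the supremum metric, expressed by pointwise estimates so that the suprema
  inside \<open>mdist\<close> stay out of later arguments; \<open>closure_of_cfun\<close> is the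
  link.\<close>

definition uclosure :: "'a topology \<Rightarrow> ('a \<Rightarrow> complex) set \<Rightarrow> ('a \<Rightarrow> complex) set" where
  "uclosure X A =
     {f \<in> mspace (cfun X). \<forall>e>0. \<exists>a\<in>A. \<forall>x\<in>topspace X. cmod (f x - a x) < e}"

lemma uclosureE:
  assumes "f \<in> uclosure X A" "0 < e"
  obtains a where "a \<in> A" "\<forall>x\<in>topspace X. cmod (f x - a x) < e"
  using assms by (auto simp: uclosure_def)

lemma closure_of_cfun:
  assumes X: "compact_space X" and A: "A \<subseteq> mspace (cfun X)"
  shows "mtopology_of (cfun X) closure_of A = uclosure X A"
proof -
  interpret M: Metric_space "mspace (cfun X)" "mdist (cfun X)"
    by simp
  have "(\<forall>r>0. \<exists>a\<in>A. a \<in> M.mball f r) \<longleftrightarrow>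
        (\<forall>e>0. \<exists>a\<in>A. \<forall>x\<in>topspace X. cmod (f x - a x) < e)"
    if f: "f \<in> mspace (cfun X)" for f
  proof (intro iffI allI impI)
    fix e :: real assume "\<forall>r>0. \<exists>a\<in>A. a \<in> M.mball f r" "0 < e"
    then obtain a where a: "a \<in> A" "a \<in> M.mball f e" by blast
    have "cmod (f x - a x) < e" if "x \<in> topspace X" for x
      using cfunspace_mdist_lt[of X f "euclidean_metric" a e x] f a A X that
      by (auto simp: compact_space_def M.in_mball dist_norm)
    with a show "\<exists>a\<in>A. \<forall>x\<in>topspace X. cmod (f x - a x) < e" by blast
  next
    fix r :: real
    assume *: "\<forall>e>0. \<exists>a\<in>A. \<forall>x\<in>topspace X. cmod (f x - a x) < e" and r: "0 < r"
    \<comment> \<open>Pointwise strict bounds give only a weak bound for the supremum; r/2 leaves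
      room for the strict inequality that defines the ball.\<close>
    then obtain a where a: "a \<in> A" "\<forall>x\<in>topspace X. cmod (f x - a x) < r / 2"
      by (meson half_gt_zero)
    have "mdist (cfun X) f a \<le> r / 2"
      using a r by (intro mdist_cfunspace_le) (auto simp: dist_norm less_imp_le)
    then show "\<exists>a\<in>A. a \<in> M.mball f r"
      using a A f r by (intro bexI[of _ a]) (auto simp: M.in_mball)
  qed
  then show ?thesis
    unfolding mtopology_of_def M.metric_closure_of uclosure_def by (intro Collect_cong) blast
qed

lemma function_algebraD:
  assumes "function_algebra X A"
  shows "A \<subseteq> mspace (cfun X)"
    and "f \<in> A \<Longrightarrow> g \<in> A \<Longrightarrow> (\<lambda>x\<in>topspace X. f x + g x) \<in> A"
    and "f \<in> A \<Longrightarrow> g \<in> A \<Longrightarrow> (\<lambda>x\<in>topspace X. f x * g x) \<in> A"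
    and "f \<in> A \<Longrightarrow> (\<lambda>x\<in>topspace X. c * f x) \<in> A"
    and "(\<lambda>x\<in>topspace X. c) \<in> A"
    and "x \<in> topspace X \<Longrightarrow> y \<in> topspace X \<Longrightarrow> x \<noteq> y \<Longrightarrow> \<exists>f\<in>A. f x \<noteq> f y"
  using assms by (simp_all add: function_algebra_def subalgebra_def)

lemma function_algebra_diff:
  assumes "function_algebra X A" "f \<in> A" "g \<in> A"
  shows "(\<lambda>x\<in>topspace X. f x - g x) \<in> A"
proof -
  have "(\<lambda>x\<in>topspace X. f x + (\<lambda>x\<in>topspace X. (-1) * g x) x) \<in> A"
    using assms by (intro function_algebraD)
  then show ?thesis
    by (simp cong: restrict_cong)
qed

lemma function_algebra_power:
  assumes "function_algebra X A" "f \<in> A"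
  shows "(\<lambda>x\<in>topspace X. f x ^ n) \<in> A"
proof (induction n)
  case 0
  show ?case using function_algebraD(5)[OF assms(1), of 1] by (simp only: power_0)
next
  case (Suc n)
  have "(\<lambda>x\<in>topspace X. f x * (\<lambda>x\<in>topspace X. f x ^ n) x) \<in> A"
    using function_algebraD(3)[OF assms(1) assms(2) Suc] .
  also have "(\<lambda>x\<in>topspace X. f x * (\<lambda>x\<in>topspace X. f x ^ n) x) = (\<lambda>x\<in>topspace X. f x ^ Suc n)"
    by (intro restrict_ext) simp
  finally show ?case .
qed

lemma function_algebra_continuous:
  assumes "compact_space X" "function_algebra X A" "f \<in> A"
  shows "continuous_map X euclidean f" "f \<in> extensional (topspace X)"
  using function_algebraD(1)[OF assms(2)] assms(3) mspace_cfun[OF assms(1)] by auto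

lemma function_algebra_separating_function:
  assumes "function_algebra X A" "x \<in> topspace X" "y \<in> topspace X" "x \<noteq> y"
  obtains f where "f \<in> A" "f x = 0" "f y = 1"
proof -
  obtain g where g: "g \<in> A" "g x \<noteq> g y"
    using function_algebraD(6)[OF assms] by blast
  let ?h = "\<lambda>z\<in>topspace X. g z - (\<lambda>z\<in>topspace X. g x) z"
  have h: "?h \<in> A"
    using assms g by (intro function_algebra_diff function_algebraD)
  have "(\<lambda>z\<in>topspace X. (1 / (g y - g x)) * ?h z) \<in> A"
    using assms h by (intro function_algebraD)
  then show thesis
    by (rule that) (use assms g in auto)
qed

lemma subset_uclosure:
  assumes "A \<subseteq> mspace (cfun X)"
  shows "A \<subseteq> uclosure X A"
proof
  fix f assume "f \<in> A"
  moreover have "\<exists>a\<in>A. \<forall>x\<in>topspace X. cmod (f x - a x) < e" if "0 < e" for e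
    using that \<open>f \<in> A\<close> by (intro bexI[of _ f]) simp_all
  ultimately show "f \<in> uclosure X A"
    using assms by (auto simp only: uclosure_def)
qed

lemma closed_function_algebra_iff:
  assumes "compact_space X"
  shows "closed_function_algebra X A \<longleftrightarrow> function_algebra X A \<and> uclosure X A \<subseteq> A"
proof -
  have "closedin (mtopology_of (cfun X)) A \<longleftrightarrow> uclosure X A \<subseteq> A" if A: "A \<subseteq> mspace (cfun X)"
    using closure_of_cfun[OF assms A] closure_of_subset_eq[of A "mtopology_of (cfun X)"] A by auto
  then show ?thesis
    unfolding closed_function_algebra_def using function_algebraD(1) by blast
qed

lemma uclosure_idem:
  assumes "compact_space X" "A \<subseteq> mspace (cfun X)"
  shows "uclosure X (uclosure X A) = uclosure X A"
proof -
  have "uclosure X A \<subseteq> mspace (cfun X)"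
    by (auto simp: uclosure_def)
  then show ?thesis
    using closure_of_cfun[OF assms] closure_of_cfun[of X "uclosure X A"] assms(1)
    by (metis closure_of_closure_of)
qed

lemma function_algebra_uclosure:
  assumes X: "compact_space X" and A: "function_algebra X A"
  shows "function_algebra X (uclosure X A)"
  unfolding function_algebra_def subalgebra_def
proof (intro conjI ballI allI impI)
  show "uclosure X A \<subseteq> mspace (cfun X)"
    by (auto simp: uclosure_def)
next
  fix f g assume f: "f \<in> uclosure X A" and g: "g \<in> uclosure X A"
  have cont: "continuous_map X euclidean f" "continuous_map X euclidean g"
    using f g X by (auto simp: uclosure_def mspace_cfun)
  have *: "(\<lambda>x\<in>topspace X. h x) \<in> mspace (cfun X)" if "continuous_map X euclidean h" for h
    using continuous_map_eq[OF that] X by (auto simp: mspace_cfun)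
  show "(\<lambda>x\<in>topspace X. f x + g x) \<in> uclosure X A"
    unfolding uclosure_def
  proof (intro CollectI conjI allI impI)
    show "(\<lambda>x\<in>topspace X. f x + g x) \<in> mspace (cfun X)"
      by (intro * continuous_map_add cont)
    fix e :: real assume "0 < e"
    then have "0 < e/2" by simp
    obtain a where a: "a \<in> A" "\<forall>x\<in>topspace X. cmod (f x - a x) < e/2"
      by (rule uclosureE[OF f \<open>0 < e/2\<close>])
    obtain b where b: "b \<in> A" "\<forall>x\<in>topspace X. cmod (g x - b x) < e/2"
      by (rule uclosureE[OF g \<open>0 < e/2\<close>])
    have "cmod (f x + g x - (a x + b x)) < e" if "x \<in> topspace X" for x
      using bspec[OF a(2) that] bspec[OF b(2) that] norm_triangle_ineq[of "f x - a x" "g x - b x"]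
      by (simp add: algebra_simps)
    then show "\<exists>c\<in>A. \<forall>x\<in>topspace X. cmod ((\<lambda>x\<in>topspace X. f x + g x) x - c x) < e"
      using function_algebraD(2)[OF A a(1) b(1)] by (intro bexI) auto
  qed
  show "(\<lambda>x\<in>topspace X. f x * g x) \<in> uclosure X A"
    unfolding uclosure_def
  proof (intro CollectI conjI allI impI)
    show "(\<lambda>x\<in>topspace X. f x * g x) \<in> mspace (cfun X)"
      using cont by (intro * continuous_map_mult)
    fix e :: real assume e: "0 < e"
    obtain B where B: "0 < B" "\<And>x. x \<in> topspace X \<Longrightarrow> cmod (f x) < B"
      using continuous_map_complex_bounded[OF X cont(1)] by metis
    obtain b where b: "b \<in> A" "\<forall>x\<in>topspace X. cmod (g x - b x) < e/2/B"
      using uclosureE[OF g, of "e/2/B"] e B by auto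
    \<comment> \<open>The order matters: a is chosen after b, because its tolerance depends on a
      bound for b.\<close>
    obtain D where D: "0 < D" "\<And>x. x \<in> topspace X \<Longrightarrow> cmod (b x) < D"
      using continuous_map_complex_bounded[OF X] function_algebra_continuous[OF X A b(1)] by metis
    obtain a where a: "a \<in> A" "\<forall>x\<in>topspace X. cmod (f x - a x) < e/2/D"
      using uclosureE[OF f, of "e/2/D"] e D by auto
    have "cmod (f x * g x - a x * b x) < e" if x: "x \<in> topspace X" for x
    proof -
      have "cmod (f x) * cmod (g x - b x) \<le> B * cmod (g x - b x)"
        using B(2)[OF x] by (intro mult_right_mono) auto
      also have "B * cmod (g x - b x) < e/2"
        using b(2) x B(1) by (auto simp: field_simps)
      finally have 1: "cmod (f x * (g x - b x)) < e/2" by (simp add: norm_mult)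
      have "cmod (f x - a x) * cmod (b x) \<le> cmod (f x - a x) * D"
        using D(2)[OF x] by (intro mult_left_mono) auto
      also have "\<dots> < e/2"
        using a(2) x D(1) by (auto simp: field_simps)
      finally have "cmod ((f x - a x) * b x) < e/2" by (simp add: norm_mult)
      moreover have "f x * g x - a x * b x = f x * (g x - b x) + (f x - a x) * b x"
        by (simp add: algebra_simps)
      ultimately show ?thesis
        using 1 norm_triangle_ineq[of "f x * (g x - b x)" "(f x - a x) * b x"] by simp
    qed
    then show "\<exists>c\<in>A. \<forall>x\<in>topspace X. cmod ((\<lambda>x\<in>topspace X. f x * g x) x - c x) < e"
      using function_algebraD(3)[OF A a(1) b(1)] by (intro bexI) auto
  qed
  fix c
  show "(\<lambda>x\<in>topspace X. c * f x) \<in> uclosure X A"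
    unfolding uclosure_def
  proof (intro CollectI conjI allI impI)
    show "(\<lambda>x\<in>topspace X. c * f x) \<in> mspace (cfun X)"
      using cont by (intro * continuous_map_mult) auto
    fix e :: real assume e: "0 < e"
    \<comment> \<open>The summand 1 keeps the divisor positive when c = 0.\<close>
    define C where "C = cmod c + 1"
    have C: "0 < C" "cmod c < C" by (auto simp: C_def add_nonneg_pos)
    obtain a where a: "a \<in> A" "\<forall>x\<in>topspace X. cmod (f x - a x) < e/C"
      using uclosureE[OF f, of "e/C"] e C by auto
    have "cmod (c * f x - c * a x) < e" if x: "x \<in> topspace X" for x
    proof -
      have "cmod (c * f x - c * a x) = cmod c * cmod (f x - a x)"
        by (simp add: norm_mult[symmetric] algebra_simps)
      also have "\<dots> \<le> C * cmod (f x - a x)" using C by (intro mult_right_mono) auto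
      also have "\<dots> < e" using a(2) x C by (auto simp: field_simps)
      finally show ?thesis .
    qed
    then show "\<exists>d\<in>A. \<forall>x\<in>topspace X. cmod ((\<lambda>x\<in>topspace X. c * f x) x - d x) < e"
      by (intro bexI[OF _ function_algebraD(4)[OF A a(1), of c]]) simp
  qed
next
  fix x y assume "x \<in> topspace X" "y \<in> topspace X" "x \<noteq> y"
  then show "\<exists>f\<in>uclosure X A. f x \<noteq> f y"
    using function_algebraD(6)[OF A] subset_uclosure function_algebraD(1)[OF A] by blast
next
  fix c show "(\<lambda>x\<in>topspace X. c) \<in> uclosure X A"
    using function_algebraD(5)[OF A] subset_uclosure function_algebraD(1)[OF A] by blast
qed

lemma closed_function_algebra_uclosure:
  assumes "compact_space X" "function_algebra X A"
  shows "closed_function_algebra X (uclosure X A)"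
  unfolding closed_function_algebra_iff[OF assms(1)]
  using function_algebra_uclosure[OF assms] uclosure_idem[OF assms(1) function_algebraD(1)[OF assms(2)]]
  by simp

text \<open>The restricted algebra need not be closed in C(S), so later arguments pass to its
  \<open>uclosure\<close> before using boundaries or removability.\<close>

lemma function_algebra_restrict:
  assumes X: "compact_space X" and S: "closedin X S" and A: "function_algebra X A"
  shows "function_algebra (subtopology X S) ((\<lambda>f. restrict f S) ` A)"
proof -
  have top: "topspace (subtopology X S) = S" 
    using closedin_subset[OF S] by auto
  have cS: "compact_space (subtopology X S)"
    using X S by (simp add: closedin_compact_space compact_space_subtopology)
  have sub: "S \<subseteq> topspace X" using closedin_subset[OF S] .
  have ms: "(\<lambda>f. restrict f S) ` A \<subseteq> mspace (cfun (subtopology X S))"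
  proof (clarify, unfold mspace_cfun[OF cS] top, intro CollectI conjI)
    fix f assume f: "f \<in> A"
    show "restrict f S \<in> extensional S" by simp
    have "continuous_map (subtopology X S) euclidean f"
      using function_algebra_continuous[OF X A f] by (simp add: continuous_map_from_subtopology)
    then show "continuous_map (subtopology X S) euclidean (restrict f S)"
      by (rule continuous_map_eq) (use top in auto)
  qed
  have res: "(\<lambda>x\<in>S. h x) \<in> (\<lambda>f. restrict f S) ` A" if "(\<lambda>x\<in>topspace X. h x) \<in> A" for h
  proof -
    have "(\<lambda>x\<in>S. h x) = restrict (\<lambda>x\<in>topspace X. h x) S"
      using sub by (auto simp: fun_eq_iff)
    then show ?thesis using that by (rule image_eqI)
  qed
  show ?thesis
    unfolding function_algebra_def subalgebra_def top
  proof (intro conjI ballI allI impI ms)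
    fix f g assume "f \<in> (\<lambda>f. restrict f S) ` A" "g \<in> (\<lambda>f. restrict f S) ` A"
    then obtain a b where a: "a \<in> A" "f = restrict a S" and b: "b \<in> A" "g = restrict b S" by blast
    show "(\<lambda>x\<in>S. f x + g x) \<in> (\<lambda>f. restrict f S) ` A"
      using res[OF function_algebraD(2)[OF A a(1) b(1)]] a b by (simp cong: restrict_cong)
    show "(\<lambda>x\<in>S. f x * g x) \<in> (\<lambda>f. restrict f S) ` A"
      using res[OF function_algebraD(3)[OF A a(1) b(1)]] a b by (simp cong: restrict_cong)
    fix c show "(\<lambda>x\<in>S. c * f x) \<in> (\<lambda>f. restrict f S) ` A"
      using res[OF function_algebraD(4)[OF A a(1)]] a b by (simp cong: restrict_cong)
  next
    fix x y assume "x \<in> S" "y \<in> S" "x \<noteq> y"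
    then show "\<exists>f\<in>(\<lambda>f. restrict f S) ` A. f x \<noteq> f y"
      using function_algebraD(6)[OF A, of x y] sub by auto
  next
    fix c show "(\<lambda>x\<in>S. c) \<in> (\<lambda>f. restrict f S) ` A"
      using res[OF function_algebraD(5)[OF A]] .
  qed
qed

text \<open>Real polynomials in h stay in A, and by the Weierstrass theorem \<kappa> is their
  uniform limit on a compact interval that contains the range of h.\<close>

lemma closed_function_algebra_compose:
  assumes X: "compact_space X" and A: "closed_function_algebra X A"
    and h: "h \<in> A" "\<And>x. x \<in> topspace X \<Longrightarrow> Im (h x) = 0"
    and \<kappa>: "continuous_on UNIV \<kappa>"
  shows "(\<lambda>x\<in>topspace X. complex_of_real (\<kappa> (Re (h x)))) \<in> A"
proof -
  have fa: "function_algebra X A" and cl: "uclosure X A \<subseteq> A"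
    using A closed_function_algebra_iff[OF X] by auto
  have hc: "continuous_map X euclidean h"
    using function_algebra_continuous[OF X fa h(1)] by simp
  have poly: "(\<lambda>x\<in>topspace X. complex_of_real (p (Re (h x)))) \<in> A" 
    if "real_polynomial_function p" for p
    using that
  proof (induction rule: real_polynomial_function.induct)
    case (linear f)
    then obtain c where c: "f = (\<lambda>x. x * c)"
      using real_bounded_linear by auto
    have "(\<lambda>x\<in>topspace X. complex_of_real (f (Re (h x)))) = (\<lambda>x\<in>topspace X. of_real c * h x)"
      using h(2) by (intro restrict_ext) (auto simp: c complex_eq_iff)
    then show ?case using function_algebraD(4)[OF fa h(1)] by (simp only:)
  next
    case (const c)
    then show ?case using function_algebraD(5)[OF fa] by blast
  next
    case (add f g)
    show ?case by (rule restrict_mem_cong[OF function_algebraD(2)[OF fa add.IH]]) simp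
  next
    case (mult f g)
    show ?case by (rule restrict_mem_cong[OF function_algebraD(3)[OF fa mult.IH]]) simp
  qed
  obtain B where B: "0 < B" "\<And>x. x \<in> topspace X \<Longrightarrow> cmod (h x) < B"
    using continuous_map_complex_bounded[OF X hc] by metis
  have "(\<lambda>x\<in>topspace X. complex_of_real (\<kappa> (Re (h x)))) \<in> uclosure X A"
    unfolding uclosure_def
  proof (intro CollectI conjI allI impI)
    have 1: "continuous_map euclidean euclidean (\<lambda>z. complex_of_real (\<kappa> (Re z)))"
      using \<kappa> by (auto intro!: continuous_intros continuous_on_compose2[OF \<kappa>])
    have "continuous_map X euclidean (\<lambda>x. complex_of_real (\<kappa> (Re (h x))))"
      using continuous_map_compose[OF hc 1] by (simp add: comp_def)
    then show "(\<lambda>x\<in>topspace X. complex_of_real (\<kappa> (Re (h x)))) \<in> mspace (cfun X)"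
      unfolding mspace_cfun[OF X] by (auto intro: continuous_map_eq)
    fix e :: real assume e: "0 < e"
    obtain p where p: "real_polynomial_function p" "\<And>t. t \<in> {-B..B} \<Longrightarrow> \<bar>\<kappa> t - p t\<bar> < e"
      by (rule Stone_Weierstrass_real_polynomial_function[of "{-B..B}" \<kappa> e])
        (use e continuous_on_subset[OF \<kappa>] in auto)
    have "cmod (complex_of_real (\<kappa> (Re (h x))) - complex_of_real (p (Re (h x)))) < e"
      if "x \<in> topspace X" for x
    proof -
      have "Re (h x) \<in> {-B..B}"
        using B(2)[OF that] abs_Re_le_cmod[of "h x"] by auto
      from p(2)[OF this] show ?thesis
        by (metis norm_of_real of_real_diff)
    qed
    then show "\<exists>a\<in>A. \<forall>x\<in>topspace X. cmod ((\<lambda>x\<in>topspace X. complex_of_real (\<kappa> (Re (h x)))) x - a x) < e"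
      using poly[OF p(1)] by (intro bexI) auto
  qed
  with cl show ?thesis by blast
qed

section \<open>Minimal closed sets in compact spaces\<close>

text \<open>W and the complements of the members of the chain cover X. A finite subcover involves
  only finitely many members, and some member below all of them must lie in W.\<close>

lemma chain_Inter_subset_open:
  assumes X: "compact_space X" and C: "\<C> \<noteq> {}" "\<And>C. C \<in> \<C> \<Longrightarrow> closedin X C"
    and chain: "\<And>C D. C \<in> \<C> \<Longrightarrow> D \<in> \<C> \<Longrightarrow> C \<subseteq> D \<or> D \<subseteq> C"
    and W: "openin X W" "\<Inter>\<C> \<subseteq> W"
  shows "\<exists>C\<in>\<C>. C \<subseteq> W"
proof -
  have lower: "\<exists>C\<in>\<C>. \<forall>D\<in>\<F>. C \<subseteq> D" if "finite \<F>" "\<F> \<subseteq> \<C>" for \<F>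
    using that
  proof (induction rule: finite_induct)
    case empty
    obtain C where "C \<in> \<C>" using C(1) by blast
    then show ?case by (intro bexI[of _ C]) simp_all
  next
    case (insert D \<F>)
    from insert.prems have D: "D \<in> \<C>" "\<F> \<subseteq> \<C>" by simp_all
    from insert.IH[OF D(2)] obtain C where C: "C \<in> \<C>" "\<forall>D\<in>\<F>. C \<subseteq> D" by (elim bexE)
    show ?case
    proof (cases "C \<subseteq> D")
      case True
      then show ?thesis using C by (intro bexI[of _ C]) simp_all
    next
      case False
      then have "D \<subseteq> C" using chain[OF C(1) D(1)] by simp
      then show ?thesis using C(2) D(1) by (intro bexI[of _ D]) (simp_all add: subset_trans)
    qed
  qed
  let ?\<U> = "insert W ((\<lambda>C. topspace X - C) ` \<C>)"
  have "topspace X \<subseteq> \<Union>?\<U>"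
  proof
    fix x assume x: "x \<in> topspace X"
    show "x \<in> \<Union>?\<U>"
    proof (cases "x \<in> W")
      case False
      then obtain C where "C \<in> \<C>" "x \<notin> C" using W(2) by blast
      with x show ?thesis by (intro UnionI[of "topspace X - C"]) simp_all
    qed simp
  qed
  moreover have "\<forall>U\<in>?\<U>. openin X U"
    using C(2) W(1) by (simp add: openin_diff)
  ultimately obtain \<G> where \<G>: "finite \<G>" "\<G> \<subseteq> ?\<U>" "topspace X \<subseteq> \<Union>\<G>"
    using X unfolding compact_space_alt by metis
  have "finite (\<G> - {W})" "\<G> - {W} \<subseteq> (\<lambda>C. topspace X - C) ` \<C>"
    using \<G> by auto
  then obtain \<F> where \<F>: "\<F> \<subseteq> \<C>" "finite \<F>" "\<G> - {W} = (\<lambda>C. topspace X - C) ` \<F>"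
    using finite_subset_image by meson
  obtain C0 where C0: "C0 \<in> \<C>" "\<forall>D\<in>\<F>. C0 \<subseteq> D" using lower \<F> by meson
  have "C0 \<subseteq> W"
  proof
    fix x assume x: "x \<in> C0"
    then have "x \<in> topspace X" using C(2) C0(1) closedin_subset by blast
    then obtain G where G: "G \<in> \<G>" "x \<in> G" using \<G>(3) by blast
    show "x \<in> W"
    proof (cases "G = W")
      case False
      then have "G \<in> (\<lambda>C. topspace X - C) ` \<F>" using G \<F>(3) by blast
      then show ?thesis using G(2) x C0(2) by auto
    qed (use G in simp)
  qed
  with C0 show ?thesis by blast
qed

text \<open>Zorn's lemma is applied to complements, where decreasing chains of closed sets become
  increasing unions of open sets. The clause about W in the chain condition hands over the
  compactness of X, so each use has to check only that a failure of P at the intersection is visible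
  on an open set.\<close>

lemma minimal_closed_set:
  assumes X: "compact_space X" and P: "P (topspace X)"
    and chain: "\<And>\<C>. \<C> \<noteq> {} \<Longrightarrow> (\<And>C. C \<in> \<C> \<Longrightarrow> closedin X C \<and> P C) \<Longrightarrow>
       (\<And>W. openin X W \<Longrightarrow> \<Inter>\<C> \<subseteq> W \<Longrightarrow> \<exists>C\<in>\<C>. C \<subseteq> W) \<Longrightarrow> P (\<Inter>\<C>)"
  obtains M where "closedin X M" "P M" "\<And>N. closedin X N \<Longrightarrow> N \<subset> M \<Longrightarrow> \<not> P N"
proof -
  let ?A = "{U. openin X U \<and> P (topspace X - U)}"
  have "\<exists>M\<in>?A. \<forall>U\<in>?A. M \<subseteq> U \<longrightarrow> U = M"
  proof (rule subset_Zorn_nonempty)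
    show "?A \<noteq> {}" using P by auto
    fix \<C> assume \<C>: "\<C> \<noteq> {}" "subset.chain ?A \<C>"
    let ?\<D> = "(\<lambda>U. topspace X - U) ` \<C>"
    have sub: "\<C> \<subseteq> ?A" and ch: "\<And>C D. C \<in> \<C> \<Longrightarrow> D \<in> \<C> \<Longrightarrow> C \<subseteq> D \<or> D \<subseteq> C"
      using \<C> by (auto simp: subset.chain_def)
    have "P (\<Inter>?\<D>)"
    proof (rule chain)
      show "?\<D> \<noteq> {}" using \<C> by auto
      show cl: "\<And>C. C \<in> ?\<D> \<Longrightarrow> closedin X C \<and> P C" using sub by auto
      show "\<exists>C\<in>?\<D>. C \<subseteq> W" if "openin X W" "\<Inter>?\<D> \<subseteq> W" for W
      proof (rule chain_Inter_subset_open[OF X])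
        show "C \<subseteq> D \<or> D \<subseteq> C" if "C \<in> ?\<D>" "D \<in> ?\<D>" for C D
          using that ch by blast
      qed (use cl \<C> that in auto)
    qed
    moreover have "\<Inter>?\<D> = topspace X - \<Union>\<C>" using \<C> by auto
    ultimately show "\<Union>\<C> \<in> ?A" using sub by auto
  qed
  then obtain M where M: "openin X M" "P (topspace X - M)"
    "\<And>U. openin X U \<Longrightarrow> P (topspace X - U) \<Longrightarrow> M \<subseteq> U \<Longrightarrow> U = M" by auto
  show thesis
  proof
    show "closedin X (topspace X - M)" "P (topspace X - M)" using M by auto
    fix N assume N: "closedin X N" "N \<subset> topspace X - M"
    show "\<not> P N"
    proof
      assume "P N"
      then have "topspace X - N = M"
        using N M openin_subset[OF M(1)] by (intro M(3)) (auto simp: closedin_def double_diff)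
      with N M(1) closedin_subset[OF N(1)] show False by auto
    qed
  qed
qed


section \<open>Boundaries\<close>

lemma openin_norm_less:
  fixes f :: "'a \<Rightarrow> complex"
  assumes "continuous_map X euclidean f"
  shows "openin X {x \<in> topspace X. cmod (f x) < c}"
proof -
  have "openin X {x \<in> topspace X. f x \<in> ball 0 c}"
    using assms by (intro openin_continuous_map_preimage) auto
  then show ?thesis by simp
qed

lemma openin_norm_greater:
  fixes f :: "'a \<Rightarrow> complex"
  assumes "continuous_map X euclidean f"
  shows "openin X {x \<in> topspace X. c < cmod (f x)}"
proof -
  have "openin X {x \<in> topspace X. f x \<in> - cball 0 c}"
    using assms by (intro openin_continuous_map_preimage) auto
  then show ?thesis by (simp add: not_le)
qed

lemma norm_attains_max:
  fixes f :: "'a \<Rightarrow> complex"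
  assumes "compact_space X" "closedin X S" "S \<noteq> {}" "continuous_map X euclidean f"
  obtains y where "y \<in> S" "\<And>z. z \<in> S \<Longrightarrow> cmod (f z) \<le> cmod (f y)"
proof -
  have "compactin X S"
    using assms closedin_compact_space by blast
  then have "compact (f ` S)"
    using image_compactin[OF _ assms(4)] by simp
  then have "compact (cmod ` f ` S)"
    by (intro compact_continuous_image continuous_intros)
  then obtain m where "m \<in> cmod ` f ` S" "\<And>t. t \<in> cmod ` f ` S \<Longrightarrow> t \<le> m"
    using compact_attains_sup[of "cmod ` f ` S"] assms(3) by auto
  then show thesis using that by auto
qed

text \<open>The boundary condition with attained values in place of suprema, which are maxima by
  compactness. This form needs no convention for an empty supremum and carries over directly to
  subspaces and homeomorphic copies.\<close>

definition norming :: "'a topology \<Rightarrow> ('a \<Rightarrow> complex) set \<Rightarrow> 'a set \<Rightarrow> bool" where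
  "norming X A H \<longleftrightarrow>
     closedin X H \<and> (\<forall>f\<in>A. \<forall>x\<in>topspace X. \<exists>y\<in>H. cmod (f x) \<le> cmod (f y))"

lemma boundary_iff_norming:
  assumes X: "compact_space X" and ne: "topspace X \<noteq> {}" and A: "function_algebra X A"
  shows "boundary X A H \<longleftrightarrow> norming X A H"
proof
  assume b: "boundary X A H"
  then have H: "closedin X H" and 
    sup: "\<And>f. f \<in> A \<Longrightarrow> (SUP x\<in>H. cmod (f x)) = (SUP x\<in>topspace X. cmod (f x))"
    by (simp_all add: boundary_def)
  have "H \<noteq> {}"
  proof
    assume "H = {}"
    then have "(SUP x\<in>topspace X. cmod ((\<lambda>x\<in>topspace X. 0) x)) = (SUP x\<in>topspace X. cmod ((\<lambda>x\<in>topspace X. 1) x))"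
      using sup[OF function_algebraD(5)[OF A, of 0]] sup[OF function_algebraD(5)[OF A, of 1]] by simp
    then show False using ne by (simp cong: image_cong_simp)
  qed
  show "norming X A H"
    unfolding norming_def
  proof (intro conjI H ballI)
    fix f x assume f: "f \<in> A" and x: "x \<in> topspace X"
    have cont: "continuous_map X euclidean f" using function_algebra_continuous[OF X A f] by simp
    obtain y where y: "y \<in> H" "\<And>z. z \<in> H \<Longrightarrow> cmod (f z) \<le> cmod (f y)"
      using norm_attains_max[OF X H \<open>H \<noteq> {}\<close> cont] by metis
    obtain B where B: "0 < B" "\<And>x. x \<in> topspace X \<Longrightarrow> cmod (f x) < B"
      using continuous_map_complex_bounded[OF X cont] by metis
    have "cmod (f x) \<le> (SUP x\<in>topspace X. cmod (f x))"
      using x B(2) by (intro cSUP_upper bdd_aboveI2[of _ _ B] less_imp_le)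
    also have "\<dots> = (SUP x\<in>H. cmod (f x))" using sup[OF f] by simp
    also have "\<dots> \<le> cmod (f y)" using y \<open>H \<noteq> {}\<close> by (intro cSUP_least) 
    finally show "\<exists>y\<in>H. cmod (f x) \<le> cmod (f y)" using y(1) by blast
  qed
next
  assume "norming X A H"
  then have H: "closedin X H" and n: "\<And>f x. f \<in> A \<Longrightarrow> x \<in> topspace X \<Longrightarrow> \<exists>y\<in>H. cmod (f x) \<le> cmod (f y)"
    by (simp_all add: norming_def)
  have Hsub: "H \<subseteq> topspace X" using closedin_subset[OF H] .
  have "H \<noteq> {}" using n function_algebraD(5)[OF A] ne by blast
  show "boundary X A H"
    unfolding boundary_def
  proof (intro conjI H ballI)
    fix f assume f: "f \<in> A"
    have cont: "continuous_map X euclidean f" using function_algebra_continuous[OF X A f] by simp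
    obtain y where y: "y \<in> H" "\<And>z. z \<in> H \<Longrightarrow> cmod (f z) \<le> cmod (f y)"
      using norm_attains_max[OF X H \<open>H \<noteq> {}\<close> cont] by metis
    have yX: "\<And>x. x \<in> topspace X \<Longrightarrow> cmod (f x) \<le> cmod (f y)"
      using n[OF f] y(2) order_trans by blast
    have "(SUP x\<in>H. cmod (f x)) = cmod (f y)"
      using y by (intro cSup_eq_maximum) auto
    moreover have "(SUP x\<in>topspace X. cmod (f x)) = cmod (f y)"
      using y(1) yX Hsub by (intro cSup_eq_maximum) auto
    ultimately show "(SUP x\<in>H. cmod (f x)) = (SUP x\<in>topspace X. cmod (f x))" by simp
  qed
qed

text \<open>If a closed set fails for some f and x, it lies in the open set where |f| < |f x|; so if
  the intersection of a chain fails, a member of the chain fails already.\<close>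

lemma minimal_norming:
  assumes X: "compact_space X" and A: "function_algebra X A"
  obtains M where "norming X A M" "\<And>N. N \<subset> M \<Longrightarrow> \<not> norming X A N"
proof -
  let ?P = "\<lambda>H. \<forall>f\<in>A. \<forall>x\<in>topspace X. \<exists>y\<in>H. cmod (f x) \<le> cmod (f y)"
  obtain M where M: "closedin X M" "?P M" "\<And>N. closedin X N \<Longrightarrow> N \<subset> M \<Longrightarrow> \<not> ?P N"
  proof (rule minimal_closed_set[OF X, of ?P])
    show "?P (topspace X)" by blast
    fix \<C> assume \<C>: "\<C> \<noteq> {}" "\<And>C. C \<in> \<C> \<Longrightarrow> closedin X C \<and> ?P C"
      "\<And>W. openin X W \<Longrightarrow> \<Inter>\<C> \<subseteq> W \<Longrightarrow> \<exists>C\<in>\<C>. C \<subseteq> W"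
    show "?P (\<Inter>\<C>)"
    proof (intro ballI, rule ccontr)
      fix f x assume f: "f \<in> A" and x: "x \<in> topspace X"
        and no: "\<not> (\<exists>y\<in>\<Inter>\<C>. cmod (f x) \<le> cmod (f y))"
      have op: "openin X {y \<in> topspace X. cmod (f y) < cmod (f x)}"
        using function_algebra_continuous[OF X A f] by (intro openin_norm_less)
      have "closedin X (\<Inter>\<C>)" using \<C>(1,2) by (intro closedin_Inter) auto
      from closedin_subset[OF this] have "\<Inter>\<C> \<subseteq> {y \<in> topspace X. cmod (f y) < cmod (f x)}"
        using no by (auto simp: not_le)
      then obtain C where "C \<in> \<C>" "C \<subseteq> {y \<in> topspace X. cmod (f y) < cmod (f x)}"
        using \<C>(3)[OF op] by blast
      moreover have "\<exists>y\<in>C. cmod (f x) \<le> cmod (f y)"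
        using \<C>(2)[OF \<open>C \<in> \<C>\<close>] f x by blast
      ultimately show False by (auto simp: subset_iff not_le)
    qed
  qed blast
  show thesis
    by (rule that[of M]) (use M in \<open>auto simp: norming_def\<close>)
qed

text \<open>The sets |f| < 1 for f in \<F> cut out a neighbourhood of x that misses H. Finitely many
  functions suffice because H is compact.\<close>

lemma function_algebra_separates_from_closed:
  assumes X: "compact_space X" and A: "function_algebra X A"
    and H: "closedin X H" and x: "x \<in> topspace X" "x \<notin> H"
  obtains \<F> where "finite \<F>" "\<F> \<subseteq> A" "\<And>f. f \<in> \<F> \<Longrightarrow> f x = 0"
    "\<And>y. y \<in> H \<Longrightarrow> \<exists>f\<in>\<F>. 1 < cmod (f y)"
proof -
  let ?Z = "{f \<in> A. f x = 0}"
  let ?\<U> = "(\<lambda>f. {y \<in> topspace X. 1 < cmod (f y)}) ` ?Z"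
  have "compactin X H" using X H closedin_compact_space by blast
  moreover have "openin X U" if "U \<in> ?\<U>" for U
    using that function_algebra_continuous(1)[OF X A] openin_norm_greater by blast
  moreover have "H \<subseteq> \<Union>?\<U>"
  proof
    fix y assume y: "y \<in> H"
    then have yX: "y \<in> topspace X" "x \<noteq> y" using closedin_subset[OF H] x by auto
    obtain f where f: "f \<in> A" "f x = 0" "f y = 1"
      by (rule function_algebra_separating_function[OF A x(1) yX])
    \<comment> \<open>Doubling turns the value 1 at y into one strictly above 1, so that y lies in
      an open set of the cover.\<close>
    let ?g = "\<lambda>z\<in>topspace X. 2 * f z"
    have "?g \<in> ?Z" using function_algebraD(4)[OF A f(1), of 2] f x by simp
    moreover have "y \<in> {y \<in> topspace X. 1 < cmod (?g y)}" using f yX by simp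
    ultimately show "y \<in> \<Union>?\<U>" by blast
  qed
  ultimately obtain \<V> where "finite \<V>" "\<V> \<subseteq> ?\<U>" "H \<subseteq> \<Union>\<V>"
    using compactinD[of X H ?\<U>] by auto
  then obtain \<F> where \<F>: "\<F> \<subseteq> ?Z" "finite \<F>" "\<V> = (\<lambda>f. {y \<in> topspace X. 1 < cmod (f y)}) ` \<F>"
    by (meson finite_subset_image)
  show thesis
  proof (rule that[of \<F>])
    show "\<exists>f\<in>\<F>. 1 < cmod (f y)" if "y \<in> H" for y
      using \<open>H \<subseteq> \<Union>\<V>\<close> that \<F>(3) by blast
  qed (use \<F> in auto)
qed

text \<open>If x is in M but not in H, some f in A of norm 1 has |f| < 1 on M off a neighbourhood of x
  cut out by finitely many members of A.  A high power of f violates that H is norming.\<close>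

lemma minimal_norming_subset:
  assumes X: "compact_space X" and A: "function_algebra X A"
    and M: "norming X A M" "\<And>N. N \<subset> M \<Longrightarrow> \<not> norming X A N"
    and H: "norming X A H"
  shows "M \<subseteq> H"
proof (rule ccontr)
  assume "\<not> M \<subseteq> H"
  then obtain x where x: "x \<in> M" "x \<notin> H" by blast
  have Mc: "closedin X M" and Hc: "closedin X H" using M H by (auto simp: norming_def)
  have Msub: "M \<subseteq> topspace X" and Hsub: "H \<subseteq> topspace X" using Mc Hc closedin_subset by auto
  have xX: "x \<in> topspace X" using x Msub by auto
  obtain \<F> where \<F>: "finite \<F>" "\<F> \<subseteq> A" "\<And>f. f \<in> \<F> \<Longrightarrow> f x = 0"
    "\<And>y. y \<in> H \<Longrightarrow> \<exists>f\<in>\<F>. 1 < cmod (f y)"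
    using function_algebra_separates_from_closed[OF X A Hc xX x(2)] by metis
  have cF: "continuous_map X euclidean f" if "f \<in> \<F>" for f
    using function_algebra_continuous[OF X A] \<F>(2) that by blast
  \<comment> \<open>\<open>topspace X\<close> is there for the case of empty \<F>, where the
    intersection is the whole type.\<close>
  define V where "V = topspace X \<inter> (\<Inter>f\<in>\<F>. {y \<in> topspace X. cmod (f y) < 1})"
  have "openin X V"
  proof (cases "\<F> = {}")
    case False
    then have "openin X (\<Inter>f\<in>\<F>. {y \<in> topspace X. cmod (f y) < 1})"
      using \<F>(1) cF openin_norm_less by (intro openin_Inter) auto
    then show ?thesis by (simp add: V_def openin_Int)
  qed (simp add: V_def)
  have "cmod (g x) < 1" if "g \<in> \<F>" for g using \<F>(3)[OF that] by simp
  then have xV: "x \<in> V" using xX by (simp add: V_def)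
  have V1: "cmod (f y) < 1" if "y \<in> V" "f \<in> \<F>" for f y using that by (auto simp: V_def)
  define N where "N = M - V"
  have Nc: "closedin X N" unfolding N_def using Mc \<open>openin X V\<close> by (rule closedin_diff)
  have "N \<subset> M" using x xV by (auto simp: N_def)
  then have "\<not> norming X A N" by (rule M(2))
  then obtain f z where f: "f \<in> A" and z: "z \<in> topspace X" "\<And>y. y \<in> N \<Longrightarrow> cmod (f y) < cmod (f z)"
    using Nc unfolding norming_def by (meson not_le)
  have fc: "continuous_map X euclidean f" using function_algebra_continuous[OF X A f] by simp
  have "M \<noteq> {}" using x by auto
  obtain m where m: "m \<in> M" "\<And>y. y \<in> M \<Longrightarrow> cmod (f y) \<le> cmod (f m)"
    using norm_attains_max[OF X Mc \<open>M \<noteq> {}\<close> fc] by metis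
  have mX: "cmod (f y) \<le> cmod (f m)" if "y \<in> topspace X" for y
  proof -
    obtain y' where "y' \<in> M" "cmod (f y) \<le> cmod (f y')"
      using M(1) f \<open>y \<in> topspace X\<close> unfolding norming_def by blast
    with m(2)[of y'] show ?thesis by simp
  qed
  have fN: "cmod (f y) < cmod (f m)" if "y \<in> N" for y
    using z(2)[OF that] mX[OF z(1)] by simp
  \<comment> \<open>If f vanished at its maximum, the strict inequality on N would force N to be
    empty. Then M would lie in V, where the members of \<F> stay below 1, although one of them
    exceeds 1 on H and M is norming.\<close>
  have fm: "f m \<noteq> 0"
  proof
    assume "f m = 0"
    show False
    proof (cases "N = {}")
      case True
      then have "M \<subseteq> V" by (auto simp: N_def)
      obtain h where "h \<in> H" 
        using H function_algebraD(5)[OF A] xX unfolding norming_def by blast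
      then obtain g where g: "g \<in> \<F>" "1 < cmod (g h)" using \<F>(4) by blast
      obtain y where "y \<in> M" "cmod (g h) \<le> cmod (g y)"
        using M(1) g \<F>(2) \<open>h \<in> H\<close> Hsub unfolding norming_def by (meson subsetD)
      then show False using V1[of y g] g \<open>M \<subseteq> V\<close> by auto
    next
      case False
      then show False using fN \<open>f m = 0\<close> by fastforce
    qed
  qed
  define r where "r y = cmod (f y) / cmod (f m)" for y
  have r0: "0 \<le> r y" for y by (simp add: r_def)
  have r1: "r y \<le> 1" if "y \<in> topspace X" for y
    using mX[OF that] fm by (simp add: r_def)
  have "\<exists>q<1. 0 \<le> q \<and> (\<forall>y\<in>N. r y \<le> q)"
  proof (cases "N = {}")
    case True then show ?thesis by (intro exI[of _ 0]) auto
  next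
    case False
    obtain n where n: "n \<in> N" "\<And>y. y \<in> N \<Longrightarrow> cmod (f y) \<le> cmod (f n)"
      using norm_attains_max[OF X Nc False fc] by metis
    have "\<forall>y\<in>N. r y \<le> r n" using n(2) by (auto simp: r_def intro!: divide_right_mono)
    moreover have "r n < 1" using fN[OF n(1)] fm by (simp add: r_def)
    ultimately show ?thesis using r0 by blast
  qed
  then obtain q where q: "q < 1" "0 \<le> q" "\<And>y. y \<in> N \<Longrightarrow> r y \<le> q" by blast
  have "\<exists>B>0. \<forall>g\<in>\<F>. \<forall>y\<in>topspace X. cmod (g y) < B"
    using \<F>(1) cF
  proof (induction rule: finite_induct)
    case empty
    show ?case by (intro exI[of _ 1]) simp
  next
    case (insert g \<F>)
    obtain B1 where B1: "0 < B1" "\<And>y. y \<in> topspace X \<Longrightarrow> cmod (g y) < B1"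
      using continuous_map_complex_bounded[OF X insert.prems[of g]] by auto
    obtain B2 where B2: "0 < B2" "\<forall>g\<in>\<F>. \<forall>y\<in>topspace X. cmod (g y) < B2"
      using insert.IH insert.prems by auto
    show ?case
      by (intro exI[of _ "max B1 B2"]) (use B1 B2 in \<open>auto simp: less_max_iff_disj\<close>)
  qed
  then obtain B where B: "0 < B" "\<And>g y. g \<in> \<F> \<Longrightarrow> y \<in> topspace X \<Longrightarrow> cmod (g y) < B" by blast
  \<comment> \<open>The power n has to beat the common bound B of \<F> on N, where r is at most q;
    on the rest of M the functions in \<F> are already below 1.\<close>
  have "(\<lambda>n. q ^ n) \<longlonglongrightarrow> 0" using q by (intro LIMSEQ_realpow_zero) auto
  then have "\<forall>\<^sub>F n in sequentially. q ^ n < 1 / B"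
    using B(1) by (intro order_tendstoD) auto
  then obtain n where n: "q ^ n < 1 / B" by (auto simp: eventually_sequentially)
  have small: "r y ^ n * cmod (g y) < 1" if y: "y \<in> M" and g: "g \<in> \<F>" for y g
  proof (cases "y \<in> V")
    case True
    have "r y ^ n \<le> 1" using r0 r1 y Msub by (intro power_le_one) auto
    then have "r y ^ n * cmod (g y) \<le> 1 * cmod (g y)" by (intro mult_right_mono) auto
    then show ?thesis using V1[OF True g] by simp
  next
    case False
    then have "r y \<le> q" using y q(3) by (auto simp: N_def)
    then have "r y ^ n \<le> q ^ n" using r0 by (intro power_mono)
    then have "r y ^ n * cmod (g y) \<le> q ^ n * B"
      using B(2)[OF g, of y] y Msub q by (intro mult_mono) (auto simp: less_imp_le)
    also have "\<dots> < 1" using n B(1) by (simp add: field_simps)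
    finally show ?thesis .
  qed
  obtain h where h: "h \<in> H" "cmod (f m) \<le> cmod (f h)"
    using H f m(1) Msub unfolding norming_def by blast
  have hX: "h \<in> topspace X" using h Hsub by auto
  have "cmod (f h) = cmod (f m)" using h mX[OF hX] by simp
  then have rh: "r h = 1" using fm by (simp add: r_def)
  obtain g where g: "g \<in> \<F>" "1 < cmod (g h)" using \<F>(4)[OF h(1)] by blast
  \<comment> \<open>Divided by |f m|^n, this product has modulus |g h| > 1 at h, but modulus below 1
    on all of M, by \<open>small\<close>.\<close>
  let ?k = "\<lambda>y\<in>topspace X. (\<lambda>y\<in>topspace X. f y ^ n) y * g y"
  have "?k \<in> A"
    using function_algebraD(3)[OF A function_algebra_power[OF A f]] g \<F>(2) by blast
  then obtain y where y: "y \<in> M" "cmod (?k h) \<le> cmod (?k y)"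
    using M(1) hX unfolding norming_def by blast
  have yX: "y \<in> topspace X" using y Msub by auto
  have "cmod (f h) ^ n * cmod (g h) \<le> cmod (f y) ^ n * cmod (g y)"
    using y(2) hX yX by (simp add: norm_mult norm_power)
  then have "r h ^ n * cmod (g h) \<le> r y ^ n * cmod (g y)"
    using fm by (simp add: r_def power_divide divide_right_mono)
  then show False using small[OF y(1) g(1)] g(2) rh by simp
qed

text \<open>A \<open>LEAST\<close> carries information only once a least element exists. A minimal
  norming set is one, since it lies in every other norming set.\<close>

lemma norming_shilov:
  assumes "compact_space X" "topspace X \<noteq> {}" "function_algebra X A"
  shows "norming X A (shilov X A)"
proof -
  obtain M where M: "norming X A M" "\<And>N. N \<subset> M \<Longrightarrow> \<not> norming X A N"
    using minimal_norming[OF assms(1,3)] by metis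
  have "shilov X A = M"
    unfolding shilov_def boundary_iff_norming[OF assms]
    using M by (intro Least_equality minimal_norming_subset[OF assms(1,3)])
  with M show ?thesis by simp
qed

section \<open>Transport of algebras along homeomorphisms, and removability on the original
  type\<close>

context
  fixes X :: "'a topology" and Y :: "'b topology" and h g
  assumes hom: "homeomorphic_maps X Y h g"
begin

lemma homeomorphic_maps_pullback_mspace:
  assumes X: "compact_space X" and f: "f \<in> mspace (cfun X)"
  shows "(\<lambda>y\<in>topspace Y. f (g y)) \<in> mspace (cfun Y)"
proof -
  have Y: "compact_space Y"
    using X hom homeomorphic_compact_space unfolding homeomorphic_space_def by blast
  have "continuous_map Y euclidean (f \<circ> g)"
    using f hom unfolding mspace_cfun[OF X] homeomorphic_maps_def
    by (intro continuous_map_compose[of _ X]) auto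
  then have "continuous_map Y euclidean (\<lambda>y\<in>topspace Y. f (g y))"
    by (rule continuous_map_eq) simp
  then show ?thesis by (simp add: mspace_cfun[OF Y])
qed

lemma function_algebra_pullback:
  assumes X: "compact_space X" and A: "function_algebra X A"
  shows "function_algebra Y ((\<lambda>f. \<lambda>y\<in>topspace Y. f (g y)) ` A)"
proof -
  let ?\<phi> = "\<lambda>f. \<lambda>y\<in>topspace Y. f (g y)"
  have gX: "g y \<in> topspace X" if "y \<in> topspace Y" for y
    using hom that by (auto simp: homeomorphic_maps_def continuous_map_def)
  have im: "(\<lambda>y\<in>topspace Y. f (g y)) \<in> ?\<phi> ` A" if "(\<lambda>x\<in>topspace X. f x) \<in> A" for f
  proof -
    have "(\<lambda>y\<in>topspace Y. f (g y)) = ?\<phi> (\<lambda>x\<in>topspace X. f x)"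
      using gX by (intro restrict_ext) simp
    then show ?thesis using that by (rule image_eqI)
  qed
  show ?thesis
    unfolding function_algebra_def subalgebra_def
  proof (intro conjI ballI allI impI)
    show "?\<phi> ` A \<subseteq> mspace (cfun Y)"
      using homeomorphic_maps_pullback_mspace[OF X] function_algebraD(1)[OF A] by blast
  next
    fix f k assume "f \<in> ?\<phi> ` A" "k \<in> ?\<phi> ` A"
    then obtain a b where a: "a \<in> A" "f = ?\<phi> a" and b: "b \<in> A" "k = ?\<phi> b" by blast
    show "(\<lambda>y\<in>topspace Y. f y + k y) \<in> ?\<phi> ` A"
      by (rule restrict_mem_cong[OF im[OF function_algebraD(2)[OF A a(1) b(1)]]]) (simp add: a b)
    show "(\<lambda>y\<in>topspace Y. f y * k y) \<in> ?\<phi> ` A"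
      by (rule restrict_mem_cong[OF im[OF function_algebraD(3)[OF A a(1) b(1)]]]) (simp add: a b)
    fix c show "(\<lambda>y\<in>topspace Y. c * f y) \<in> ?\<phi> ` A"
      by (rule restrict_mem_cong[OF im[OF function_algebraD(4)[OF A a(1), of c]]]) (simp add: a)
  next
    fix x y assume xy: "x \<in> topspace Y" "y \<in> topspace Y" "x \<noteq> y"
    then have "g x \<noteq> g y" using hom unfolding homeomorphic_maps_def by metis
    then obtain f where f: "f \<in> A" "f (g x) \<noteq> f (g y)"
      using function_algebraD(6)[OF A gX[OF xy(1)] gX[OF xy(2)]] by auto
    show "\<exists>f\<in>?\<phi> ` A. f x \<noteq> f y"
      by (rule bexI[of _ "?\<phi> f"]) (use f xy in auto)
  next
    fix c show "(\<lambda>y\<in>topspace Y. c) \<in> ?\<phi> ` A"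
      by (rule im[OF function_algebraD(5)[OF A]])
  qed
qed

end

lemma closed_function_algebra_pullback:
  assumes hom: "homeomorphic_maps X Y h g" and X: "compact_space X" and A: "closed_function_algebra X A"
  shows "closed_function_algebra Y ((\<lambda>f. \<lambda>y\<in>topspace Y. f (g y)) ` A)"
proof -
  let ?\<phi> = "\<lambda>f. \<lambda>y\<in>topspace Y. f (g y)"
  have A': "function_algebra X A" "uclosure X A \<subseteq> A"
    using A closed_function_algebra_iff[OF X] by auto
  have Y: "compact_space Y"
    using X hom homeomorphic_compact_space unfolding homeomorphic_space_def by blast
  have gX: "g y \<in> topspace X" if "y \<in> topspace Y" for y
    using hom that by (auto simp: homeomorphic_maps_def continuous_map_def)
  have hY: "h x \<in> topspace Y" "g (h x) = x" if "x \<in> topspace X" for x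
    using hom that by (auto simp: homeomorphic_maps_def continuous_map_def)
  have "uclosure Y (?\<phi> ` A) \<subseteq> ?\<phi> ` A"
  proof
    fix f assume f: "f \<in> uclosure Y (?\<phi> ` A)"
    then have fm: "f \<in> mspace (cfun Y)" by (simp add: uclosure_def)
    define k where "k = (\<lambda>x\<in>topspace X. f (h x))"
    have "k \<in> uclosure X A"
      unfolding uclosure_def
    proof (intro CollectI conjI allI impI)
      show "k \<in> mspace (cfun X)"
        unfolding k_def 
        by (rule homeomorphic_maps_pullback_mspace[OF iffD1[OF homeomorphic_maps_sym hom] Y fm])
      fix e :: real assume "0 < e"
      then obtain b where b: "b \<in> ?\<phi> ` A" "\<forall>y\<in>topspace Y. cmod (f y - b y) < e"
        using uclosureE[OF f] by blast
      then obtain a where a: "a \<in> A" "b = ?\<phi> a" by blast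
      have "cmod (k x - a x) < e" if "x \<in> topspace X" for x
        using bspec[OF b(2) hY(1)[OF that]] hY[OF that] that by (simp add: k_def a(2))
      with a(1) show "\<exists>a\<in>A. \<forall>x\<in>topspace X. cmod (k x - a x) < e" by blast
    qed
    then have "k \<in> A" using A' by blast
    moreover have "f = ?\<phi> k"
    proof -
      have "f y = k (g y)" if "y \<in> topspace Y" for y
        using hom that gX[OF that] by (simp add: k_def homeomorphic_maps_def)
      then show ?thesis using fm unfolding mspace_cfun[OF Y] by (intro extensionalityI[of _ "topspace Y"]) auto
    qed
    ultimately show "f \<in> ?\<phi> ` A" by blast
  qed
  then show ?thesis
    using closed_function_algebra_iff[OF Y] function_algebra_pullback[OF hom X A'(1)] by blast
qed

text \<open>\<open>removable\<close> quantifies over topologies on functions from pairs to complex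
  numbers, whereas X lives on the type of its points. X is copied into that type, removability is
  applied to the copy, and the result is carried back. Since the Shilov boundary is norming, so is
  every closed set that contains it.\<close>

lemma removable_norming:
  fixes H X :: "'a topology"
  assumes H: "removable H" and X: "compact_space X" "Hausdorff_space X" 
    and U: "openin X U" "U \<subset> topspace X"
    and S: "S \<subseteq> topspace H" "subtopology X (X closure_of U) homeomorphic_space subtopology H S"
    and A: "closed_function_algebra X A" "trivial_idempotents X A"
  shows "norming X A (topspace X - U)"
proof -
  \<comment> \<open>Each point is coded by the indicator function of the pairs with that first
    coordinate; only injectivity matters.\<close>
  define j :: "'a \<Rightarrow> 'a \<times> 'a \<Rightarrow> complex" where "j x = (\<lambda>p. if fst p = x then 1 else 0)" for x
  have "inj j"
  proof (rule injI)
    fix x y assume "j x = j y"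
    then have "j x (x, x) = j y (x, x)" by simp
    then show "x = y" by (simp add: j_def split: if_splits)
  qed
  \<comment> \<open>Pulling the topology back along the inverse of j makes j a homeomorphism onto
    its image.\<close>
  define Y where "Y = pullback_topology (range j) (inv j) X"
  have inv: "inv j (j x) = x" for x using \<open>inj j\<close> by simp
  have topY: "topspace Y = j ` topspace X"
    unfolding Y_def topspace_pullback_topology using inv by auto
  have "continuous_map Y X (id \<circ> inv j)"
    unfolding Y_def by (intro continuous_map_pullback) simp
  moreover have "continuous_map X Y j"
    unfolding Y_def 
  proof (rule continuous_map_pullback')
    show "continuous_map X X (inv j \<circ> j)" using \<open>inj j\<close> by simp
  qed auto
  ultimately have hom: "homeomorphic_maps X Y j (inv j)"
    unfolding homeomorphic_maps_def using inv topY by auto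
  then have homm: "homeomorphic_map X Y j" and hs: "X homeomorphic_space Y"
    by (auto simp: homeomorphic_maps_map homeomorphic_space_def)
  have Y: "compact_space Y" "Hausdorff_space Y"
    using X homeomorphic_compact_space[OF hs] homeomorphic_Hausdorff_space[OF hs] by auto
  let ?A = "(\<lambda>f. \<lambda>y\<in>topspace Y. f (inv j y)) ` A"
  have fa: "function_algebra X A" using A(1) closed_function_algebra_iff[OF X(1)] by simp
  have cA: "closed_function_algebra Y ?A"
    using closed_function_algebra_pullback[OF hom X(1) A(1)] .
  then have fY: "function_algebra Y ?A" using closed_function_algebra_iff[OF Y(1)] by simp
  have Uop: "openin Y (j ` U)" and Usub: "j ` U \<subset> topspace Y"
    using homeomorphic_map_openness_eq[OF homm] U topY \<open>inj j\<close> by (auto simp: inj_image_subset_iff psubset_eq inj_image_eq_iff)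
  have "subtopology X (X closure_of U) homeomorphic_space subtopology Y (Y closure_of (j ` U))"
  proof (rule homeomorphic_map_imp_homeomorphic_space)
    show "homeomorphic_map (subtopology X (X closure_of U)) (subtopology Y (Y closure_of (j ` U))) j"
      using homeomorphic_map_closure_of[OF homm openin_subset[OF U(1)]] \<open>inj j\<close>
      by (intro homeomorphic_map_subtopologies_alt[OF homm]) (auto simp: inj_image_mem_iff)
  qed
  then have "subtopology Y (Y closure_of (j ` U)) homeomorphic_space subtopology H S"
    using S(2) homeomorphic_space_sym homeomorphic_space_trans by blast
  moreover have "trivial_idempotents Y ?A"
    unfolding trivial_idempotents_def
  proof (intro ballI impI)
    fix f assume f: "f \<in> ?A" "idempotent Y f"
    then obtain a where a: "a \<in> A" "f = (\<lambda>y\<in>topspace Y. a (inv j y))" by blast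
    have fa: "f (j x) = a x" if "x \<in> topspace X" for x
      using that topY inv by (simp add: a)
    have "a \<in> mspace (cfun X)" using a(1) function_algebraD(1)[OF \<open>function_algebra X A\<close>] by blast
    moreover have "(a x)\<^sup>2 = a x" if "x \<in> topspace X" for x
      using f(2) fa[OF that] that topY unfolding idempotent_def by (metis imageI)
    ultimately have "idempotent X a" by (simp add: idempotent_def)
    then consider "a = (\<lambda>x\<in>topspace X. 0)" | "a = (\<lambda>x\<in>topspace X. 1)"
      using A(2) a(1) unfolding trivial_idempotents_def by blast
    then show "f = (\<lambda>y\<in>topspace Y. 0) \<or> f = (\<lambda>y\<in>topspace Y. 1)"
    proof cases
      case 1
      then have "f = (\<lambda>y\<in>topspace Y. 0)" using topY inv by (auto simp: a fun_eq_iff)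
      then show ?thesis ..
    next
      case 2
      then have "f = (\<lambda>y\<in>topspace Y. 1)" using topY inv by (auto simp: a fun_eq_iff)
      then show ?thesis ..
    qed
  qed
  ultimately have sh: "shilov Y ?A \<subseteq> topspace Y - j ` U"
    using H Y Uop Usub S(1) cA unfolding removable_def by blast
  have "topspace Y \<noteq> {}" using U topY by auto
  then have n: "norming Y ?A (shilov Y ?A)" using norming_shilov[OF Y(1) _ fY] by blast
  show ?thesis
    unfolding norming_def
  proof (intro conjI ballI)
    show "closedin X (topspace X - U)" using U by auto
    fix f x assume f: "f \<in> A" and x: "x \<in> topspace X"
    let ?f = "\<lambda>y\<in>topspace Y. f (inv j y)"
    have "?f \<in> ?A" using f by blast
    moreover have "j x \<in> topspace Y" using x topY by auto
    ultimately obtain y where y: "y \<in> shilov Y ?A" "cmod (?f (j x)) \<le> cmod (?f y)"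
      using n unfolding norming_def by blast
    then obtain z where z: "y = j z" "z \<in> topspace X" "z \<notin> U" using sh topY by blast
    then have "cmod (f x) \<le> cmod (f z)" using y(2) x topY inv by simp
    with z show "\<exists>y\<in>topspace X - U. cmod (f x) \<le> cmod (f y)" by blast
  qed
qed


section \<open>Minimal sets of non-approximability\<close>

text \<open>On compact sets these are distances: \<phi> has distance at least d from A over S, and
  less than d over every smaller closed set. The threshold d is common to all sets, so that it
  survives intersections of chains.\<close>

definition critical :: "'a topology \<Rightarrow> ('a \<Rightarrow> complex) set \<Rightarrow> ('a \<Rightarrow> complex) \<Rightarrow> real \<Rightarrow> 'a set \<Rightarrow> bool" where
  "critical X A \<phi> d S \<longleftrightarrow> closedin X S \<and> (\<forall>a\<in>A. \<exists>x\<in>S. d \<le> cmod (\<phi> x - a x)) \<and>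
     (\<forall>T. closedin X T \<longrightarrow> T \<subset> S \<longrightarrow> (\<exists>a\<in>A. \<forall>x\<in>T. cmod (\<phi> x - a x) < d))"

lemma criticalD:
  assumes "critical X A \<phi> d S"
  shows "closedin X S" "a \<in> A \<Longrightarrow> \<exists>x\<in>S. d \<le> cmod (\<phi> x - a x)"
    "closedin X T \<Longrightarrow> T \<subset> S \<Longrightarrow> \<exists>a\<in>A. \<forall>x\<in>T. cmod (\<phi> x - a x) < d"
  using assms by (simp_all add: critical_def)

text \<open>Failure of uniform approximation supplies d. For each a, the set where |\<phi> - a| < d
  is open, so an intersection of a chain that lies in it has a member of the chain lying in it
  too.\<close>

lemma critical_exists:
  assumes X: "compact_space X" and A: "function_algebra X A"
    and \<phi>: "\<phi> \<in> mspace (cfun X)" "\<phi> \<notin> uclosure X A"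
  obtains d S where "0 < d" "critical X A \<phi> d S"
proof -
  have "\<not> (\<forall>e>0. \<exists>a\<in>A. \<forall>x\<in>topspace X. cmod (\<phi> x - a x) < e)"
    using \<phi> by (simp add: uclosure_def)
  then obtain d where d: "0 < d" "\<And>a. a \<in> A \<Longrightarrow> \<exists>x\<in>topspace X. d \<le> cmod (\<phi> x - a x)"
    by (meson not_le)
  let ?P = "\<lambda>S. \<forall>a\<in>A. \<exists>x\<in>S. d \<le> cmod (\<phi> x - a x)"
  obtain S where S: "closedin X S" "?P S" "\<And>T. closedin X T \<Longrightarrow> T \<subset> S \<Longrightarrow> \<not> ?P T"
  proof (rule minimal_closed_set[OF X, of ?P])
    show "?P (topspace X)" using d(2) by blast
    fix \<C> assume \<C>: "\<C> \<noteq> {}" "\<And>C. C \<in> \<C> \<Longrightarrow> closedin X C \<and> ?P C"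
      "\<And>W. openin X W \<Longrightarrow> \<Inter>\<C> \<subseteq> W \<Longrightarrow> \<exists>C\<in>\<C>. C \<subseteq> W"
    show "?P (\<Inter>\<C>)"
    proof (intro ballI, rule ccontr)
      fix a assume a: "a \<in> A" and no: "\<not> (\<exists>x\<in>\<Inter>\<C>. d \<le> cmod (\<phi> x - a x))"
      let ?W = "{x \<in> topspace X. \<phi> x - a x \<in> ball 0 d}"
      have op: "openin X ?W"
        using function_algebra_continuous[OF X A a] \<phi>(1) 
        by (intro openin_continuous_map_preimage[of X euclidean] continuous_map_diff)
           (auto simp: mspace_cfun[OF X])
      have "closedin X (\<Inter>\<C>)" using \<C>(1,2) by (intro closedin_Inter) auto
      from closedin_subset[OF this] have "\<Inter>\<C> \<subseteq> ?W"
        using no by (auto simp: not_le)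
      then obtain C where "C \<in> \<C>" "C \<subseteq> ?W"
        using \<C>(3)[OF op] by blast
      moreover have "\<exists>x\<in>C. d \<le> cmod (\<phi> x - a x)"
        using \<C>(2)[OF \<open>C \<in> \<C>\<close>] a by blast
      ultimately show False by (auto simp: subset_iff not_le)
    qed
  qed blast
  show thesis
    by (rule that[of d S]) (use d(1) S in \<open>auto simp: critical_def not_le\<close>)
qed

text \<open>By compactness a pointwise strict bound leaves a uniform gap. The value d/2 keeps c
  positive even if T is empty or f vanishes on T.\<close>

lemma closed_subset_strict_bound:
  fixes f :: "'a \<Rightarrow> complex"
  assumes X: "compact_space X" and T: "closedin X T" and f: "continuous_map X euclidean f"
    and "0 < d" "\<And>x. x \<in> T \<Longrightarrow> cmod (f x) < d"
  obtains c where "0 < c" "c < d" "\<forall>x\<in>T. cmod (f x) \<le> c"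
proof (cases "T = {}")
  case True
  then show thesis using that[of "d/2"] assms by auto
next
  case False
  have "compactin X T" using X T closedin_compact_space by blast
  then have "compact (cmod ` f ` T)"
    using image_compactin[OF _ f, of T] by (intro compact_continuous_image continuous_intros) auto
  then obtain m where m: "m \<in> cmod ` f ` T" "\<And>t. t \<in> cmod ` f ` T \<Longrightarrow> t \<le> m"
    using compact_attains_sup[of "cmod ` f ` T"] False by auto
  have "m < d" using m(1) assms(5) by auto
  then show thesis
    using m(2) \<open>0 < d\<close> by (intro that[of "max m (d/2)"]) (auto simp: le_max_iff_disj)
qed

text \<open>A real h in the uniform closure that takes the values 0 and 1 on S gives a cutoff
  k = \<kappa>(h) which glues approximations of \<open>\<phi>\<close> on two proper closed subsets of S.\<close>

lemma critical_antisymmetric: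
  assumes X: "compact_space X" and A: "function_algebra X A"
    and \<phi>: "continuous_map X euclidean \<phi>" and d: "0 < d" and S: "critical X A \<phi> d S"
    and h: "h \<in> uclosure (subtopology X S) ((\<lambda>f. restrict f S) ` A)" 
    and real: "\<And>x. x \<in> S \<Longrightarrow> Im (h x) = 0"
    and xy: "x \<in> S" "y \<in> S"
  shows "h x = h y"
proof (rule ccontr)
  assume neq: "h x \<noteq> h y"
  let ?T = "subtopology X S"
  let ?B = "uclosure ?T ((\<lambda>f. restrict f S) ` A)"
  have Sc: "closedin X S" using criticalD(1)[OF S] .
  have Ssub: "S \<subseteq> topspace X" using closedin_subset[OF Sc] .
  have top: "topspace ?T = S" using Ssub by auto
  have T: "compact_space ?T" using X Sc by (simp add: closedin_compact_space compact_space_subtopology)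
  have fT: "function_algebra ?T ((\<lambda>f. restrict f S) ` A)" by (rule function_algebra_restrict[OF X Sc A])
  have cB: "closed_function_algebra ?T ?B" by (rule closed_function_algebra_uclosure[OF T fT])
  have fB: "function_algebra ?T ?B" by (rule function_algebra_uclosure[OF T fT])
  define s where "s z = (Re (h z) - Re (h x)) / (Re (h y) - Re (h x))" for z
  have ne: "Re (h y) - Re (h x) \<noteq> 0" using neq real xy by (auto simp: complex_eq_iff)
  have s01: "s x = 0" "s y = 1" using ne by (auto simp: s_def)
  have hc: "continuous_map ?T euclidean h" using function_algebra_continuous(1)[OF T fB h] .
  have sc: "continuous_map ?T euclideanreal s"
  proof -
    have 1: "continuous_map euclidean euclideanreal (\<lambda>z. (Re z - Re (h x)) / (Re (h y) - Re (h x)))"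
      using ne by (auto intro!: continuous_intros)
    show ?thesis using continuous_map_compose[OF hc 1] by (simp add: comp_def s_def[abs_def])
  qed
  \<comment> \<open>The two sets overlap and cover S. The first misses y, where s is 1, and the
    second misses x, where s is 0, so both are proper and \<phi> can be approximated on
    each.\<close>
  define S1 where "S1 = {z \<in> S. s z \<in> {..2/3}}"
  define S2 where "S2 = {z \<in> S. s z \<in> {1/3..}}"
  have "closedin ?T S1" "closedin ?T S2"
    unfolding S1_def S2_def
    using closedin_continuous_map_preimage[OF sc, of "{..2/3}"] closedin_continuous_map_preimage[OF sc, of "{1/3..}"]
    unfolding top by simp_all
  then have cl: "closedin X S1" "closedin X S2"
    using Sc closedin_trans_full by blast+
  have "S1 \<subseteq> S" "S2 \<subseteq> S" "y \<notin> S1" "x \<notin> S2" using s01 by (auto simp: S1_def S2_def)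
  with xy have "S1 \<subset> S" "S2 \<subset> S" by blast+
  then obtain a1 a2 where a1: "a1 \<in> A" "\<forall>z\<in>S1. cmod (\<phi> z - a1 z) < d"
    and a2: "a2 \<in> A" "\<forall>z\<in>S2. cmod (\<phi> z - a2 z) < d"
    using criticalD(3)[OF S cl(1)] criticalD(3)[OF S cl(2)] by blast
  \<comment> \<open>The cutoff is 1 where s is at most 1/3 and 0 where s is at least 2/3. In g it is
    the weight of a1, so off S1 only a2 counts and off S2 only a1; on the overlap the error is a
    convex combination.\<close>
  define \<kappa> :: "real \<Rightarrow> real" where 
    "\<kappa> t = min 1 (max 0 (2 - 3 * ((t - Re (h x)) / (Re (h y) - Re (h x)))))" for t
  have "continuous_on UNIV \<kappa>"
    unfolding \<kappa>_def using ne by (intro continuous_intros) simp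
  then have "(\<lambda>z\<in>topspace ?T. complex_of_real (\<kappa> (Re (h z)))) \<in> ?B"
    using closed_function_algebra_compose[OF T cB h] real top by blast
  then have k: "(\<lambda>z\<in>S. complex_of_real (\<kappa> (Re (h z)))) \<in> ?B" (is "?k \<in> _") by (simp only: top)
  have k01: "0 \<le> \<kappa> t" "\<kappa> t \<le> 1" for t by (auto simp: \<kappa>_def)
  have kS1: "\<kappa> (Re (h z)) = 0" if "z \<in> S" "z \<notin> S1" for z
    using that by (simp add: \<kappa>_def S1_def flip: s_def)
  have kS2: "\<kappa> (Re (h z)) = 1" if "z \<in> S" "z \<notin> S2" for z
    using that by (simp add: \<kappa>_def S2_def flip: s_def)
  have sub: "(\<lambda>f. restrict f S) ` A \<subseteq> ?B" 
    by (rule subset_uclosure) (rule function_algebraD(1)[OF fT])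
  then have r1: "restrict a1 S \<in> ?B" and r2: "restrict a2 S \<in> ?B" using a1 a2 by blast+
  define g where "g = (\<lambda>z\<in>S. (\<lambda>z\<in>S. ?k z * (\<lambda>z\<in>S. restrict a1 S z - restrict a2 S z) z) z + restrict a2 S z)"
  have "g \<in> ?B"
  proof -
    have 1: "(\<lambda>z\<in>S. restrict a1 S z - restrict a2 S z) \<in> ?B"
      using function_algebra_diff[OF fB r1 r2] by (simp only: top)
    have 2: "(\<lambda>z\<in>S. ?k z * (\<lambda>z\<in>S. restrict a1 S z - restrict a2 S z) z) \<in> ?B"
      using function_algebraD(3)[OF fB k 1] by (simp only: top)
    show ?thesis
      using function_algebraD(2)[OF fB 2 r2] by (simp only: top g_def)
  qed
  have gd: "cmod (\<phi> z - g z) < d" if z: "z \<in> S" for z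
  proof -
    define t where "t = \<kappa> (Re (h z))"
    have eq: "\<phi> z - g z = of_real t * (\<phi> z - a1 z) + of_real (1 - t) * (\<phi> z - a2 z)"
      using z by (simp add: g_def t_def algebra_simps)
    show ?thesis
    proof (cases "z \<in> S1")
      case False
      then show ?thesis
        using eq kS1[OF z False] a2(2) z by (auto simp: t_def S1_def S2_def)
    next
      case z1: True
      show ?thesis
      proof (cases "z \<in> S2")
        case False
        then show ?thesis
          using eq kS2[OF z False] a1(2) z1 by (auto simp: t_def)
      next
        case True
        have t: "0 \<le> t" "t \<le> 1" using k01 by (auto simp: t_def)
        have b: "cmod (\<phi> z - a1 z) < d" "cmod (\<phi> z - a2 z) < d" using a1(2) a2(2) z1 True by auto
        have "cmod (\<phi> z - g z) \<le> t * cmod (\<phi> z - a1 z) + (1 - t) * cmod (\<phi> z - a2 z)"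
          unfolding eq
          using t norm_triangle_ineq[of "of_real t * (\<phi> z - a1 z)" "of_real (1 - t) * (\<phi> z - a2 z)"]
          by (simp add: norm_mult del: of_real_diff)
        also have "\<dots> < d"
          using convex_bound_lt[OF b t(1), of "1 - t"] t by simp
        finally show ?thesis .
      qed
    qed
  qed
  have gc: "continuous_map ?T euclidean g" using function_algebra_continuous(1)[OF T fB \<open>g \<in> ?B\<close>] .
  have uc: "continuous_map ?T euclidean (\<lambda>z. \<phi> z - g z)"
    by (rule continuous_map_diff[OF continuous_map_from_subtopology[OF \<phi>] gc])
  have "closedin ?T S" using closedin_topspace[of ?T] top by simp
  \<comment> \<open>g is only in the closure. The gap d - c pays for replacing it by a member of A
    itself.\<close>
  then obtain c where c: "0 < c" "c < d" "\<forall>z\<in>S. cmod (\<phi> z - g z) \<le> c"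
    by (rule closed_subset_strict_bound[OF T _ uc d gd]) blast
  obtain b where b: "b \<in> (\<lambda>f. restrict f S) ` A" "\<forall>z\<in>topspace ?T. cmod (g z - b z) < d - c"
    using uclosureE[OF \<open>g \<in> ?B\<close>, of "d - c"] c(2) by auto
  obtain a where a: "a \<in> A" "b = restrict a S" using b(1) by blast
  have "cmod (\<phi> z - a z) < d" if z: "z \<in> S" for z
  proof -
    have "cmod (g z - a z) < d - c" using b(2) z top a by simp
    then show ?thesis
      using bspec[OF c(3) z] norm_triangle_ineq[of "\<phi> z - g z" "g z - a z"] by simp
  qed
  then show False using criticalD(2)[OF S a(1)] by (meson not_le)
qed

text \<open>A constant in A agrees with \<phi> at any single point, so a one-point set is never
  critical.\<close>

lemma critical_two_points:
  assumes A: "function_algebra X A" and d: "0 < d" and S: "critical X A \<phi> d S"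
  obtains x y where "x \<in> S" "y \<in> S" "x \<noteq> y"
proof -
  have Ssub: "S \<subseteq> topspace X" using closedin_subset[OF criticalD(1)[OF S]] .
  obtain x where x: "x \<in> S" using criticalD(2)[OF S function_algebraD(5)[OF A]] by blast
  obtain y where "y \<in> S" "d \<le> cmod (\<phi> y - (\<lambda>z\<in>topspace X. \<phi> x) y)"
    using criticalD(2)[OF S function_algebraD(5)[OF A, of "\<phi> x"]] by blast
  then have "x \<noteq> y" using d Ssub by auto
  then show thesis by (rule that[OF x \<open>y \<in> S\<close>])
qed


section \<open>Additive functionals and measures\<close>

definition sublinear_on :: "('a \<Rightarrow> 'b::real_vector) set \<Rightarrow> (('a \<Rightarrow> 'b) \<Rightarrow> real) \<Rightarrow> bool" where
  "sublinear_on V q \<longleftrightarrow>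
     (\<forall>f\<in>V. \<forall>g\<in>V. q (\<lambda>x. f x + g x) \<le> q f + q g) \<and>
     (\<forall>f\<in>V. \<forall>c>0. q (\<lambda>x. c *\<^sub>R f x) \<le> c * q f)"

locale function_space =
  fixes V :: "('a \<Rightarrow> 'b::real_vector) set"
  assumes zero_mem: "(\<lambda>x. 0) \<in> V"
    and add_mem: "f \<in> V \<Longrightarrow> g \<in> V \<Longrightarrow> (\<lambda>x. f x + g x) \<in> V"
    and scale_mem: "f \<in> V \<Longrightarrow> (\<lambda>x. c *\<^sub>R f x) \<in> V"
begin

lemma minus_mem: "f \<in> V \<Longrightarrow> (\<lambda>x. - f x) \<in> V"
  using scale_mem[of f "-1"] by simp

lemma sublinear_onD:
  assumes "sublinear_on V q"
  shows "f \<in> V \<Longrightarrow> g \<in> V \<Longrightarrow> q (\<lambda>x. f x + g x) \<le> q f + q g"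
    and "f \<in> V \<Longrightarrow> 0 < c \<Longrightarrow> q (\<lambda>x. c *\<^sub>R f x) \<le> c * q f"
  using assms by (simp_all add: sublinear_on_def)

lemma sublinear_on_scale:
  assumes q: "sublinear_on V q" and f: "f \<in> V" and c: "0 < c"
  shows "q (\<lambda>x. c *\<^sub>R f x) = c * q f"
proof (rule antisym)
  show "q (\<lambda>x. c *\<^sub>R f x) \<le> c * q f" using sublinear_onD(2)[OF q f c] .
  have "q (\<lambda>x. (1/c) *\<^sub>R (c *\<^sub>R f x)) \<le> (1/c) * q (\<lambda>x. c *\<^sub>R f x)"
    using c by (intro sublinear_onD(2)[OF q] scale_mem f) auto
  then show "c * q f \<le> q (\<lambda>x. c *\<^sub>R f x)" using c by (simp add: field_simps)
qed

lemma sublinear_on_zero: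
  assumes q: "sublinear_on V q"
  shows "q (\<lambda>x. 0) = 0"
  using sublinear_on_scale[OF q zero_mem, of 2] by simp

lemma sublinear_on_minus:
  assumes q: "sublinear_on V q" and f: "f \<in> V"
  shows "0 \<le> q f + q (\<lambda>x. - f x)"
  using sublinear_onD(1)[OF q f minus_mem[OF f]] sublinear_on_zero[OF q] by simp

text \<open>The infimum of q(f + t x) - t d over nonnegative t lowers q: t = 0 shows that r is at
  most q, and t = 1 at -x gives the last bound. The condition d \<le> q x keeps the infimum above
  -q(-f). This serves both to reach a prescribed value at x and to show that a minimal functional is
  odd.\<close>

lemma sublinear_on_lower:
  assumes q: "sublinear_on V q" and x: "x \<in> V" and d: "d \<le> q x"
  obtains r where "sublinear_on V r" "\<And>f. f \<in> V \<Longrightarrow> r f \<le> q f" "r (\<lambda>z. - x z) \<le> - d"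
proof -
  define F where "F f t = q (\<lambda>z. f z + t *\<^sub>R x z) - t * d" for f t
  define r where "r f = (INF t\<in>{0..}. F f t)" for f
  have lb: "- q (\<lambda>z. - f z) \<le> F f t" if f: "f \<in> V" and t: "0 \<le> t" for f t
  proof -
    have "t * q x = q (\<lambda>z. t *\<^sub>R x z)"
      using sublinear_on_scale[OF q x, of t] sublinear_on_zero[OF q] t by (cases "t = 0") auto
    also have "\<dots> = q (\<lambda>z. (f z + t *\<^sub>R x z) + - f z)" by simp
    also have "\<dots> \<le> q (\<lambda>z. f z + t *\<^sub>R x z) + q (\<lambda>z. - f z)"
      by (intro sublinear_onD(1)[OF q] add_mem scale_mem minus_mem f x)
    finally show ?thesis using mult_left_mono[OF d t] by (simp add: F_def)
  qed
  have rF: "r f \<le> F f t" if "f \<in> V" "0 \<le> t" for f t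
    unfolding r_def using that lb[OF that(1)] by (intro cINF_lower bdd_belowI2) auto
  have rI: "c \<le> r f" if "\<And>t. 0 \<le> t \<Longrightarrow> c \<le> F f t" for c f
    unfolding r_def using that by (intro cINF_greatest) auto
  show thesis
  proof
    show "sublinear_on V r"
      unfolding sublinear_on_def
    proof (intro conjI ballI allI impI)
      fix f g assume f: "f \<in> V" and g: "g \<in> V"
      have "r (\<lambda>x. f x + g x) \<le> F f s + F g t" if st: "0 \<le> s" "0 \<le> t" for s t
      proof -
        have "r (\<lambda>x. f x + g x) \<le> F (\<lambda>x. f x + g x) (s + t)"
          using f g st by (intro rF add_mem) auto
        also have "\<dots> = q (\<lambda>z. (f z + s *\<^sub>R x z) + (g z + t *\<^sub>R x z)) - (s + t) * d"
          by (simp add: F_def algebra_simps)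
        also have "\<dots> \<le> F f s + F g t"
          using sublinear_onD(1)[OF q add_mem[OF f scale_mem[OF x, of s]] add_mem[OF g scale_mem[OF x, of t]]]
          by (simp add: F_def algebra_simps)
        finally show ?thesis .
      qed
      then have "r (\<lambda>x. f x + g x) - F f s \<le> r g" if "0 \<le> s" for s
        using that by (intro rI) (simp add: algebra_simps)
      then have "r (\<lambda>x. f x + g x) - r g \<le> r f"
        by (intro rI) (simp add: algebra_simps)
      then show "r (\<lambda>x. f x + g x) \<le> r f + r g" by simp
    next
      fix f and c :: real assume f: "f \<in> V" and c: "0 < c"
      have "r (\<lambda>x. c *\<^sub>R f x) / c \<le> r f"
      proof (rule rI)
        fix t :: real assume t: "0 \<le> t"
        have "r (\<lambda>x. c *\<^sub>R f x) \<le> F (\<lambda>x. c *\<^sub>R f x) (c * t)"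
          using f t c by (intro rF scale_mem) auto
        also have "\<dots> = q (\<lambda>z. c *\<^sub>R (f z + t *\<^sub>R x z)) - c * t * d"
          by (simp add: F_def algebra_simps)
        also have "\<dots> \<le> c * F f t"
          using sublinear_onD(2)[OF q add_mem[OF f scale_mem[OF x, of t]] c]
          by (simp add: F_def algebra_simps)
        finally show "r (\<lambda>x. c *\<^sub>R f x) / c \<le> F f t" using c by (simp add: field_simps)
      qed
      then show "r (\<lambda>x. c *\<^sub>R f x) \<le> c * r f" using c by (simp add: field_simps)
    qed
    show "r f \<le> q f" if "f \<in> V" for f
      using rF[OF that, of 0] by (simp add: F_def)
    show "r (\<lambda>z. - x z) \<le> - d"
      using rF[OF minus_mem[OF x], of 1] sublinear_on_zero[OF q] by (simp add: F_def)
  qed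
qed

text \<open>The pointwise infimum works. It is finite because every q in the chain satisfies q(f)
  \<ge> -q(-f) \<ge> -p(-f), and subadditive because of any two members of the chain the smaller one
  serves for both summands.\<close>

lemma sublinear_on_chain_Inf:
  assumes p: "sublinear_on V p" and C: "C \<noteq> {}" "\<And>q. q \<in> C \<Longrightarrow> sublinear_on V q"
    "\<And>q f. q \<in> C \<Longrightarrow> f \<in> V \<Longrightarrow> q f \<le> p f"
    and chain: "\<And>q r. q \<in> C \<Longrightarrow> r \<in> C \<Longrightarrow> (\<forall>f\<in>V. q f \<le> r f) \<or> (\<forall>f\<in>V. r f \<le> q f)"
  obtains u where "sublinear_on V u" "\<And>q f. q \<in> C \<Longrightarrow> f \<in> V \<Longrightarrow> u f \<le> q f"
proof -
  define u where "u f = (INF q\<in>C. q f)" for f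
  have u: "u f \<le> q f" if q: "q \<in> C" and f: "f \<in> V" for q f
    unfolding u_def
  proof (rule cINF_lower[OF _ q], rule bdd_belowI2)
    fix q assume q: "q \<in> C"
    show "- p (\<lambda>z. - f z) \<le> q f"
      using sublinear_on_minus[OF C(2)[OF q] f] C(3)[OF q minus_mem[OF f]] by simp
  qed
  have uI: "c \<le> u f" if "\<And>q. q \<in> C \<Longrightarrow> c \<le> q f" for c f
    unfolding u_def using that C(1) by (intro cINF_greatest)
  have "sublinear_on V u"
    unfolding sublinear_on_def
  proof (intro conjI ballI allI impI)
    fix f g assume f: "f \<in> V" and g: "g \<in> V"
    have *: "u (\<lambda>x. f x + g x) \<le> q f + r g" if qr: "q \<in> C" "r \<in> C" for q r
    proof -
      obtain s where s: "s \<in> C" "s f \<le> q f" "s g \<le> r g"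
        using chain[OF qr] qr f g by (metis order_refl)
      show ?thesis
        using u[OF s(1) add_mem[OF f g]] sublinear_onD(1)[OF C(2)[OF s(1)] f g] s by simp
    qed
    have "u (\<lambda>x. f x + g x) - q f \<le> u g" if "q \<in> C" for q
      using *[OF that] by (intro uI) (simp add: algebra_simps)
    then have "u (\<lambda>x. f x + g x) - u g \<le> u f"
      by (intro uI) (simp add: algebra_simps)
    then show "u (\<lambda>x. f x + g x) \<le> u f + u g" by simp
  next
    fix f and c :: real assume f: "f \<in> V" and c: "0 < c"
    have "u (\<lambda>x. c *\<^sub>R f x) / c \<le> u f"
    proof (rule uI)
      fix q assume q: "q \<in> C"
      have "u (\<lambda>x. c *\<^sub>R f x) \<le> c * q f"
        using u[OF q scale_mem[OF f]] sublinear_onD(2)[OF C(2)[OF q] f c] by (rule order_trans)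
      then show "u (\<lambda>x. c *\<^sub>R f x) / c \<le> q f" using c by (simp add: field_simps)
    qed
    then show "u (\<lambda>x. c *\<^sub>R f x) \<le> c * u f" using c by (simp add: field_simps)
  qed
  then show thesis by (rule that) (rule u)
qed

lemma minimal_sublinear_on:
  assumes p: "sublinear_on V p"
  obtains q where "sublinear_on V q" "\<And>f. f \<in> V \<Longrightarrow> q f \<le> p f"
    "\<And>r f. sublinear_on V r \<Longrightarrow> (\<And>f. f \<in> V \<Longrightarrow> r f \<le> q f) \<Longrightarrow> f \<in> V \<Longrightarrow> r f = q f"
proof -
  \<comment> \<open>Two devices for Zorn's lemma: \<open>?P\<close> reverses the order, so that
    maximal means minimal, and values off V are fixed to 0, because comparison on V alone is not
    antisymmetric.\<close>
  let ?A = "{q. sublinear_on V q \<and> (\<forall>f\<in>V. q f \<le> p f) \<and> (\<forall>f. f \<notin> V \<longrightarrow> q f = 0)}"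
  let ?P = "\<lambda>q r. \<forall>f\<in>V. r f \<le> (q f :: real)"
  define cut where "cut q f = (if f \<in> V then q f else 0)" for q :: "('a \<Rightarrow> 'b) \<Rightarrow> real" and f
  have cut: "sublinear_on V (cut q)" if "sublinear_on V q" for q
    using sublinear_onD[OF that] add_mem scale_mem by (simp add: sublinear_on_def cut_def)
  have "\<exists>q\<in>?A. \<forall>r\<in>?A. ?P q r \<longrightarrow> r = q"
  proof (rule predicate_Zorn)
    show "partial_order_on ?A (relation_of ?P ?A)"
    proof (rule partial_order_on_relation_ofI)
      fix q r assume "q \<in> ?A" "r \<in> ?A" "?P q r" "?P r q"
      then have "q f = r f" for f
        by (cases "f \<in> V") (auto intro: antisym)
      then show "q = r" by (rule ext)
    qed (auto intro: order_trans)
    fix C assume C: "C \<in> Chains (relation_of ?P ?A)"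
    have CA: "q \<in> ?A" if "q \<in> C" for q
      using C that unfolding Chains_def relation_of_def by blast
    have CA1: "\<And>q. q \<in> C \<Longrightarrow> sublinear_on V q" and CA2: "\<And>q f. q \<in> C \<Longrightarrow> f \<in> V \<Longrightarrow> q f \<le> p f"
      using CA by simp_all
    have ch: "(\<forall>f\<in>V. q f \<le> r f) \<or> (\<forall>f\<in>V. r f \<le> q f)" if "q \<in> C" "r \<in> C" for q r
      using C that unfolding Chains_def relation_of_def by blast
    show "\<exists>u\<in>?A. \<forall>q\<in>C. ?P q u"
    proof (cases "C = {}")
      case True
      have "cut p \<in> ?A" using cut[OF p] by (simp add: cut_def)
      with True show ?thesis by blast
    next
      case False
      obtain u where u: "sublinear_on V u" "\<And>q f. q \<in> C \<Longrightarrow> f \<in> V \<Longrightarrow> u f \<le> q f"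
      proof (rule sublinear_on_chain_Inf[OF p False])
        show "sublinear_on V q" if "q \<in> C" for q using CA1[OF that] .
        show "q f \<le> p f" if "q \<in> C" "f \<in> V" for q f using CA2[OF that] .
        show "(\<forall>f\<in>V. q f \<le> r f) \<or> (\<forall>f\<in>V. r f \<le> q f)" if "q \<in> C" "r \<in> C" for q r
          using ch[OF that] .
      qed blast
      obtain q0 where "q0 \<in> C" using False by blast
      then have "u f \<le> p f" if "f \<in> V" for f
        using u(2)[OF \<open>q0 \<in> C\<close> that] CA2[OF \<open>q0 \<in> C\<close> that] by simp
      then have "cut u \<in> ?A" using cut[OF u(1)] by (simp add: cut_def)
      moreover have "\<forall>q\<in>C. ?P q (cut u)" using u(2) by (simp add: cut_def)
      ultimately show ?thesis by blast
    qed
  qed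
  then obtain q where q: "q \<in> ?A" "\<And>r. r \<in> ?A \<Longrightarrow> ?P q r \<Longrightarrow> r = q" by blast
  show thesis
  proof
    show "sublinear_on V q" "\<And>f. f \<in> V \<Longrightarrow> q f \<le> p f" using q(1) by auto
    fix r f assume r: "sublinear_on V r" "\<And>f. f \<in> V \<Longrightarrow> r f \<le> q f" and f: "f \<in> V"
    have "r f \<le> p f" if "f \<in> V" for f using r(2)[OF that] q(1) that by force
    then have "cut r \<in> ?A" using cut[OF r(1)] by (simp add: cut_def)
    moreover have "?P q (cut r)" using r(2) by (simp add: cut_def)
    ultimately have "cut r = q" by (rule q(2))
    then show "r f = q f" using f by (auto simp: cut_def)
  qed
qed

text \<open>A minimal sublinear functional is odd, since otherwise it could be lowered, and hence additive.\<close>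

lemma Hahn_Banach_function_space:
  assumes p: "sublinear_on V p" and x: "x \<in> V"
  obtains \<Lambda> where "\<And>f. f \<in> V \<Longrightarrow> \<Lambda> f \<le> p f" "p x \<le> \<Lambda> x"
    "\<And>f g. f \<in> V \<Longrightarrow> g \<in> V \<Longrightarrow> \<Lambda> (\<lambda>x. f x + g x) = \<Lambda> f + \<Lambda> g"
    "\<And>f c. f \<in> V \<Longrightarrow> 0 < c \<Longrightarrow> \<Lambda> (\<lambda>x. c *\<^sub>R f x) = c * \<Lambda> f"
proof -
  \<comment> \<open>With -p(x) imposed at -x beforehand, every odd functional below p' has at least
    the value p(x) at x.\<close>
  obtain p' where p': "sublinear_on V p'" "\<And>f. f \<in> V \<Longrightarrow> p' f \<le> p f" "p' (\<lambda>z. - x z) \<le> - p x"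
    by (rule sublinear_on_lower[OF p x order_refl]) blast
  obtain q where q: "sublinear_on V q" "\<And>f. f \<in> V \<Longrightarrow> q f \<le> p' f"
    and min: "\<And>r f. sublinear_on V r \<Longrightarrow> (\<And>f. f \<in> V \<Longrightarrow> r f \<le> q f) \<Longrightarrow> f \<in> V \<Longrightarrow> r f = q f"
    by (rule minimal_sublinear_on[OF p'(1)]) blast
  have odd: "q (\<lambda>z. - f z) = - q f" if f: "f \<in> V" for f
  proof (rule antisym)
    obtain r where r: "sublinear_on V r" "\<And>g. g \<in> V \<Longrightarrow> r g \<le> q g" "r (\<lambda>z. - f z) \<le> - q f"
      by (rule sublinear_on_lower[OF q(1) f order_refl]) blast
    show "q (\<lambda>z. - f z) \<le> - q f" using min[OF r(1,2) minus_mem[OF f]] r(3) by simp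
    show "- q f \<le> q (\<lambda>z. - f z)" using sublinear_on_minus[OF q(1) f] by simp
  qed
  show thesis
  proof
    show "q f \<le> p f" if "f \<in> V" for f
      using q(2)[OF that] p'(2)[OF that] by simp
    show "p x \<le> q x"
      using odd[OF x] q(2)[OF minus_mem[OF x]] p'(3) by simp
    fix f g assume f: "f \<in> V" and g: "g \<in> V"
    have "q (\<lambda>x. - f x + - g x) \<le> - q f - q g"
      using sublinear_onD(1)[OF q(1) minus_mem[OF f] minus_mem[OF g]] odd[OF f] odd[OF g] by simp
    moreover have "q (\<lambda>x. - f x + - g x) = - q (\<lambda>x. f x + g x)"
      using odd[OF add_mem[OF f g]] by simp
    ultimately show "q (\<lambda>x. f x + g x) = q f + q g"
      using sublinear_onD(1)[OF q(1) f g] by simp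
  next
    fix f and c :: real assume "f \<in> V" "0 < c"
    then show "q (\<lambda>x. c *\<^sub>R f x) = c * q f" by (rule sublinear_on_scale[OF q(1)])
  qed
qed

end

section \<open>The variation of a functional as a regular Borel measure\<close>

definition tests :: "'a topology \<Rightarrow> 'a set \<Rightarrow> ('a \<Rightarrow> complex) set" where
  "tests X W = {g. continuous_map X euclidean g \<and> (\<forall>x\<in>topspace X. cmod (g x) \<le> 1) \<and>
     (\<exists>C. closedin X C \<and> C \<subseteq> W \<and> (\<forall>x\<in>topspace X - C. g x = 0))}"

text \<open>For the real part of a complex linear functional this is the variation of the
  representing measure on W: a unimodular factor makes the value at a test real and nonnegative.
  \<open>ennreal\<close> turns negative values into 0, the value at the zero test.\<close>

definition open_content :: "'a topology \<Rightarrow> (('a \<Rightarrow> complex) \<Rightarrow> real) \<Rightarrow> 'a set \<Rightarrow> ennreal" where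
  "open_content X \<Lambda> W = (SUP g\<in>tests X W. ennreal (\<Lambda> g))"

definition outer_content :: "'a topology \<Rightarrow> (('a \<Rightarrow> complex) \<Rightarrow> real) \<Rightarrow> 'a set \<Rightarrow> ennreal" where
  "outer_content X \<Lambda> E = (INF W\<in>{W. openin X W \<and> E \<subseteq> W}. open_content X \<Lambda> W)"

lemma testsI:
  assumes "continuous_map X euclidean g" "\<And>x. x \<in> topspace X \<Longrightarrow> cmod (g x) \<le> 1"
    "closedin X C" "C \<subseteq> W" "\<And>x. x \<in> topspace X \<Longrightarrow> x \<notin> C \<Longrightarrow> g x = 0"
  shows "g \<in> tests X W"
  using assms by (auto simp: tests_def)

lemma testsE:
  assumes "g \<in> tests X W"
  obtains C where "continuous_map X euclidean g" "\<forall>x\<in>topspace X. cmod (g x) \<le> 1"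
    "closedin X C" "C \<subseteq> W" "\<forall>x\<in>topspace X - C. g x = 0"
  using assms by (auto simp: tests_def)

lemma zero_tests: "(\<lambda>x. 0) \<in> tests X W"
  by (rule testsI[of _ _ "{}"]) auto

lemma tests_mono: "W \<subseteq> W' \<Longrightarrow> tests X W \<subseteq> tests X W'"
  by (force simp: tests_def)

lemma content_mono: "W \<subseteq> W' \<Longrightarrow> open_content X \<Lambda> W \<le> open_content X \<Lambda> W'"
  unfolding open_content_def by (intro SUP_subset_mono tests_mono order_refl)

lemma content_upper: "g \<in> tests X W \<Longrightarrow> ennreal (\<Lambda> g) \<le> open_content X \<Lambda> W"
  unfolding open_content_def by (rule SUP_upper)

lemma outer_content_mono: "E \<subseteq> E' \<Longrightarrow> outer_content X \<Lambda> E \<le> outer_content X \<Lambda> E'"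
  unfolding outer_content_def by (intro INF_superset_mono) auto

lemma outer_content_le: "openin X W \<Longrightarrow> E \<subseteq> W \<Longrightarrow> outer_content X \<Lambda> E \<le> open_content X \<Lambda> W"
  unfolding outer_content_def by (intro INF_lower) auto

lemma outer_content_open: "openin X W \<Longrightarrow> outer_content X \<Lambda> W = open_content X \<Lambda> W"
  unfolding outer_content_def by (intro antisym INF_lower INF_greatest content_mono) auto

lemma outer_content_close:
  assumes "outer_content X \<Lambda> E < c"
  obtains W where "openin X W" "E \<subseteq> W" "open_content X \<Lambda> W < c"
  using assms unfolding outer_content_def by (auto simp: INF_less_iff)

locale bounded_functional =
  fixes X :: "'a topology" and \<Lambda> :: "('a \<Rightarrow> complex) \<Rightarrow> real" and M :: real
  assumes X: "compact_space X" "Hausdorff_space X"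
    and additive: "continuous_map X euclidean f \<Longrightarrow> continuous_map X euclidean g \<Longrightarrow>
       \<Lambda> (\<lambda>x. f x + g x) = \<Lambda> f + \<Lambda> g"
    and bounded: "continuous_map X euclidean g \<Longrightarrow> (\<And>x. x \<in> topspace X \<Longrightarrow> cmod (g x) \<le> 1) \<Longrightarrow> \<Lambda> g \<le> M"
begin

lemma normal: "normal_space X"
  using X compact_Hausdorff_or_regular_imp_normal_space by blast

lemma functional_zero: "\<Lambda> (\<lambda>x. 0) = 0"
  using additive[of "\<lambda>x. 0" "\<lambda>x. 0"] by simp

text \<open>A test for the empty set vanishes on \<open>topspace X\<close> but may be arbitrary
  elsewhere, and \<Lambda> takes total functions. All its integer multiples stay in the unit ball,
  and n \<Lambda>(g) \<le> M for every n forces \<Lambda>(g) \<le> 0.\<close>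

lemma content_empty: "open_content X \<Lambda> {} = 0"
proof -
  have "\<Lambda> g \<le> 0" if g: "g \<in> tests X {}" for g
  proof -
    obtain C where gC: "continuous_map X euclidean g" "C \<subseteq> {}" "\<forall>x\<in>topspace X - C. g x = 0"
      using g by (rule testsE)
    have z: "\<And>x. x \<in> topspace X \<Longrightarrow> g x = 0" using gC by auto
    have mult: "\<Lambda> (\<lambda>x. of_nat n * g x) = real n * \<Lambda> g" for n
    proof (induction n)
      case 0
      then show ?case using functional_zero by simp
    next
      case (Suc n)
      have "\<Lambda> (\<lambda>x. of_nat n * g x + g x) = \<Lambda> (\<lambda>x. of_nat n * g x) + \<Lambda> g"
        using gC(1) by (intro additive continuous_map_mult) auto
      with Suc show ?case by (simp add: algebra_simps)
    qed
    have le: "real n * \<Lambda> g \<le> M" for n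
    proof -
      have "\<Lambda> (\<lambda>x. of_nat n * g x) \<le> M"
        using gC(1) z by (intro bounded continuous_map_mult) (auto simp: norm_mult)
      then show ?thesis using mult by simp
    qed
    show ?thesis
    proof (rule ccontr)
      assume "\<not> \<Lambda> g \<le> 0"
      then obtain n where "M < real n * \<Lambda> g" using reals_Archimedean3[of "\<Lambda> g"] by auto
      with le[of n] show False by simp
    qed
  qed
  then show ?thesis
    unfolding open_content_def using zero_tests
    by (intro antisym SUP_least) (auto simp: ennreal_neg)
qed

lemma content_finite: "open_content X \<Lambda> W \<le> ennreal M"
  unfolding open_content_def
proof (rule SUP_least)
  fix g assume "g \<in> tests X W"
  then have "\<Lambda> g \<le> M" by (auto elim!: testsE intro!: bounded)
  then show "ennreal (\<Lambda> g) \<le> ennreal M" by (rule ennreal_leI)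
qed

lemma content_Un:
  assumes W: "openin X W" "openin X W'"
  shows "open_content X \<Lambda> (W \<union> W') \<le> open_content X \<Lambda> W + open_content X \<Lambda> W'"
  unfolding open_content_def[of X \<Lambda> "W \<union> W'"]
proof (rule SUP_least)
  fix g assume "g \<in> tests X (W \<union> W')"
  then obtain C where g: "continuous_map X euclidean g" "\<forall>x\<in>topspace X. cmod (g x) \<le> 1"
    and C: "closedin X C" "C \<subseteq> W \<union> W'" "\<forall>x\<in>topspace X - C. g x = 0"
    by (rule testsE)
  have "closedin X (topspace X - W)" "closedin X (C - W')" "disjnt (topspace X - W) (C - W')"
    using W C by (auto simp: disjnt_iff intro: closedin_diff)
  then obtain \<psi> where \<psi>: "continuous_map X euclideanreal \<psi>" "\<psi> ` (topspace X - W) \<subseteq> {0}" "\<psi> ` (C - W') \<subseteq> {1}"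
    by (rule Urysohn_lemma_alt[OF normal]) blast
  \<comment> \<open>Tests must vanish off a closed subset of the open set, so \<psi> is flattened:
    \<rho> is 0 where \<psi> is at most 1/3 and 1 where it is at least 2/3. Thus \<rho> g and (1 -
    \<rho>) g are tests for W and W'.\<close>
  define \<rho> where "\<rho> x = min 1 (max 0 (3 * \<psi> x - 1))" for x
  have \<rho>c: "continuous_map X euclidean (\<lambda>x. complex_of_real (\<rho> x))"
  proof -
    have "continuous_map euclideanreal euclidean (\<lambda>t. complex_of_real (min 1 (max 0 (3 * t - 1))))"
      by (auto intro!: continuous_intros)
    from continuous_map_compose[OF \<psi>(1) this] show ?thesis by (simp add: \<rho>_def comp_def)
  qed
  have \<rho>01: "0 \<le> \<rho> x" "\<rho> x \<le> 1" for x by (auto simp: \<rho>_def)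
  define g1 g2 where "g1 x = of_real (\<rho> x) * g x" and "g2 x = (1 - of_real (\<rho> x)) * g x" for x
  have g1c: "continuous_map X euclidean g1" and g2c: "continuous_map X euclidean g2"
    unfolding g1_def g2_def using \<rho>c g(1) by (intro continuous_map_mult continuous_map_diff; simp)+
  have le1: "cmod (of_real t * g x) \<le> 1" if "x \<in> topspace X" "0 \<le> t" "t \<le> 1" for t x
    using mult_mono[of t 1 "cmod (g x)" 1] g(2) that by (simp add: norm_mult)
  have "g1 \<in> tests X W"
  proof (rule testsI[OF g1c])
    let ?C = "C \<inter> {x \<in> topspace X. \<psi> x \<in> {1/3..}}"
    show "closedin X ?C"
      using C(1) closedin_continuous_map_preimage[OF \<psi>(1), of "{1/3..}"] by (intro closedin_Int) auto
    show "?C \<subseteq> W" using \<psi>(2) by force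
    show "g1 x = 0" if "x \<in> topspace X" "x \<notin> ?C" for x
      using that C(3) by (auto simp: g1_def \<rho>_def)
    show "cmod (g1 x) \<le> 1" if "x \<in> topspace X" for x
      unfolding g1_def using le1[OF that \<rho>01] .
  qed
  moreover have "g2 \<in> tests X W'"
  proof (rule testsI[OF g2c])
    let ?C = "C \<inter> {x \<in> topspace X. \<psi> x \<in> {..2/3}}"
    show "closedin X ?C"
      using C(1) closedin_continuous_map_preimage[OF \<psi>(1), of "{..2/3}"] by (intro closedin_Int) auto
    show "?C \<subseteq> W'" using \<psi>(3) by force
    show "g2 x = 0" if "x \<in> topspace X" "x \<notin> ?C" for x
      using that C(3) by (auto simp: g2_def \<rho>_def)
    show "cmod (g2 x) \<le> 1" if "x \<in> topspace X" for x
      unfolding g2_def using le1[OF that, of "1 - \<rho> x"] \<rho>01 by simp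
  qed
  moreover have "\<Lambda> g = \<Lambda> g1 + \<Lambda> g2"
    using additive[OF g1c g2c] by (simp add: g1_def g2_def algebra_simps)
  ultimately have "ennreal (\<Lambda> g1) \<le> open_content X \<Lambda> W" "ennreal (\<Lambda> g2) \<le> open_content X \<Lambda> W'"
    "ennreal (\<Lambda> g) \<le> ennreal (\<Lambda> g1) + ennreal (\<Lambda> g2)"
    using content_upper by (auto simp: ennreal_plus_if ennreal_leI)
  then show "ennreal (\<Lambda> g) \<le> open_content X \<Lambda> W + open_content X \<Lambda> W'"
    by (meson add_mono order_trans)
qed

text \<open>A test vanishes off a compact subset of the union, so it is already a test for a finite
  union.\<close>

lemma content_UN:
  fixes W :: "nat \<Rightarrow> 'a set"
  assumes W: "\<And>i. openin X (W i)"
  shows "open_content X \<Lambda> (\<Union>i. W i) \<le> (\<Sum>i. open_content X \<Lambda> (W i))"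
  unfolding open_content_def[of X \<Lambda> "\<Union>i. W i"]
proof (rule SUP_least)
  have fin: "open_content X \<Lambda> (\<Union>i<n. W i) \<le> (\<Sum>i<n. open_content X \<Lambda> (W i))" for n
  proof (induction n)
    case 0
    then show ?case by (simp add: content_empty)
  next
    case (Suc n)
    have "open_content X \<Lambda> (\<Union>i<Suc n. W i) \<le> open_content X \<Lambda> (\<Union>i<n. W i) + open_content X \<Lambda> (W n)"
      using content_Un[of "\<Union>i<n. W i" "W n"] W by (auto simp: lessThan_Suc Un_commute)
    also have "\<dots> \<le> (\<Sum>i<Suc n. open_content X \<Lambda> (W i))"
      using Suc by (simp add: add_mono)
    finally show ?case .
  qed
  fix g assume "g \<in> tests X (\<Union>i. W i)"
  then obtain C where g: "continuous_map X euclidean g" "\<forall>x\<in>topspace X. cmod (g x) \<le> 1"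
    and C: "closedin X C" "C \<subseteq> (\<Union>i. W i)" "\<forall>x\<in>topspace X - C. g x = 0"
    by (rule testsE)
  have "compactin X C" using X(1) C(1) closedin_compact_space by blast
  then obtain \<F> where \<F>: "finite \<F>" "\<F> \<subseteq> range W" "C \<subseteq> \<Union>\<F>"
    using compactinD[of X C "range W"] W C(2) by blast
  then obtain I where I: "finite I" "\<F> = W ` I" by (meson finite_subset_image)
  obtain n where n: "\<forall>i\<in>I. i < n" 
    using I(1) unfolding finite_nat_set_iff_bounded ..
  have "C \<subseteq> (\<Union>i<n. W i)" using \<F>(3) I(2) n by blast
  then have "g \<in> tests X (\<Union>i<n. W i)"
    using g C by (intro testsI) auto
  then have "ennreal (\<Lambda> g) \<le> open_content X \<Lambda> (\<Union>i<n. W i)" by (rule content_upper)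
  also have "\<dots> \<le> (\<Sum>i<n. open_content X \<Lambda> (W i))" by (rule fin)
  also have "\<dots> \<le> (\<Sum>i. open_content X \<Lambda> (W i))" by (rule sum_le_suminf) auto
  finally show "ennreal (\<Lambda> g) \<le> (\<Sum>i. open_content X \<Lambda> (W i))" .
qed

lemma outer_content_UN:
  fixes A :: "nat \<Rightarrow> 'a set"
  shows "outer_content X \<Lambda> (\<Union>i. A i) \<le> (\<Sum>i. outer_content X \<Lambda> (A i))"
proof (rule ennreal_le_epsilon)
  fix e :: real assume "0 < e" and "(\<Sum>n. outer_content X \<Lambda> (A n)) < top"
  then have less: "\<And>n. outer_content X \<Lambda> (A n) < outer_content X \<Lambda> (A n) + e * (1/2)^Suc n"
    by (auto simp add: less_top dest!: ennreal_suminf_lessD)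
  have "\<exists>W. openin X W \<and> A n \<subseteq> W \<and> open_content X \<Lambda> W \<le> outer_content X \<Lambda> (A n) + e * (1/2)^Suc n" for n
  proof -
    obtain W where "openin X W" "A n \<subseteq> W" "open_content X \<Lambda> W < outer_content X \<Lambda> (A n) + e * (1/2)^Suc n"
      by (rule outer_content_close[OF less])
    then show ?thesis by (intro exI[of _ W]) (simp add: less_imp_le)
  qed
  then obtain W where W: "\<And>n. openin X (W n)" "\<And>n. A n \<subseteq> W n"
    "\<And>n. open_content X \<Lambda> (W n) \<le> outer_content X \<Lambda> (A n) + e * (1/2)^Suc n"
    by metis
  have "outer_content X \<Lambda> (\<Union>i. A i) \<le> open_content X \<Lambda> (\<Union>i. W i)"
    using W(1,2) by (intro outer_content_le openin_Union) auto
  also have "\<dots> \<le> (\<Sum>n. open_content X \<Lambda> (W n))"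
    using W(1) by (rule content_UN)
  also have "\<dots> \<le> (\<Sum>n. outer_content X \<Lambda> (A n) + e * (1/2)^Suc n)"
    by (intro suminf_le W(3)) auto
  also have "\<dots> = (\<Sum>n. outer_content X \<Lambda> (A n)) + (\<Sum>n. ennreal e * ennreal ((1/2) ^ Suc n))"
    using \<open>0 < e\<close> by (subst suminf_add[symmetric])
                     (auto simp del: ennreal_suminf_cmult simp add: ennreal_mult[symmetric])
  also have "\<dots> = (\<Sum>n. outer_content X \<Lambda> (A n)) + e"
    unfolding ennreal_suminf_cmult
    by (subst suminf_ennreal_eq[OF zero_le_power power_half_series]) auto
  finally show "outer_content X \<Lambda> (\<Union>i. A i) \<le> (\<Sum>i. outer_content X \<Lambda> (A i)) + e" .
qed

text \<open>\<open>ennreal\<close> respects sums only of nonnegative reals. A test with a negative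
  value is exchanged for the zero test, whose value in \<open>ennreal\<close> is the same.\<close>

lemma tests_nonneg:
  assumes "g \<in> tests X W"
  obtains h where "h \<in> tests X W" "0 \<le> \<Lambda> h" "ennreal (\<Lambda> h) = ennreal (\<Lambda> g)"
proof (cases "0 \<le> \<Lambda> g")
  case False
  then show thesis
    using that[of "\<lambda>x. 0"] functional_zero zero_tests[of X W] by (simp add: ennreal_neg)
qed (use assms that in blast)

text \<open>At each point of X at most one of the two functions is nonzero, so their sum stays in
  the unit ball and is a test for Z. This superadditivity drives Caratheodory's criterion.\<close>

lemma tests_disjoint_add:
  assumes g: "g \<in> tests X W" and "W \<subseteq> Z" and C: "closedin X C" "C \<subseteq> Z" "W \<inter> C = {}"
    and h: "continuous_map X euclidean h" "\<forall>x\<in>topspace X. cmod (h x) \<le> 1" "\<forall>x\<in>topspace X - C. h x = 0"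
  shows "ennreal (\<Lambda> h) + ennreal (\<Lambda> g) \<le> open_content X \<Lambda> Z"
proof -
  obtain g' where g': "g' \<in> tests X W" "0 \<le> \<Lambda> g'" "ennreal (\<Lambda> g') = ennreal (\<Lambda> g)"
    using tests_nonneg[OF g] by blast
  have ht: "h \<in> tests X C" using C h by (auto intro: testsI)
  obtain h' where h': "h' \<in> tests X C" "0 \<le> \<Lambda> h'" "ennreal (\<Lambda> h') = ennreal (\<Lambda> h)"
    using tests_nonneg[OF ht] by blast
  obtain D where D: "continuous_map X euclidean g'" "\<forall>x\<in>topspace X. cmod (g' x) \<le> 1"
    "closedin X D" "D \<subseteq> W" "\<forall>x\<in>topspace X - D. g' x = 0"
    using g'(1) by (rule testsE)
  obtain C' where C': "continuous_map X euclidean h'" "\<forall>x\<in>topspace X. cmod (h' x) \<le> 1"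
    "closedin X C'" "C' \<subseteq> C" "\<forall>x\<in>topspace X - C'. h' x = 0"
    using h'(1) by (rule testsE)
  have "(\<lambda>x. h' x + g' x) \<in> tests X Z"
  proof (rule testsI)
    show "continuous_map X euclidean (\<lambda>x. h' x + g' x)" using C'(1) D(1) by (rule continuous_map_add)
    show "closedin X (C' \<union> D)" using C'(3) D(3) by (rule closedin_Un)
    show "C' \<union> D \<subseteq> Z" using C'(4) C(2) D(4) assms(2) by blast
    fix x assume x: "x \<in> topspace X"
    show "x \<notin> C' \<union> D \<Longrightarrow> h' x + g' x = 0" using C'(5) D(5) x by simp
    show "cmod (h' x + g' x) \<le> 1"
    proof (cases "x \<in> D")
      case True
      then have "x \<notin> C'" using C'(4) C(3) D(4) by blast
      then show ?thesis using C'(5) D(2) x by simp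
    next
      case False
      then show ?thesis using C'(2) D(5) x by simp
    qed
  qed
  then have "ennreal (\<Lambda> (\<lambda>x. h' x + g' x)) \<le> open_content X \<Lambda> Z" by (rule content_upper)
  then have "ennreal (\<Lambda> h' + \<Lambda> g') \<le> open_content X \<Lambda> Z" using additive[OF C'(1) D(1)] by simp
  then have "ennreal (\<Lambda> h') + ennreal (\<Lambda> g') \<le> open_content X \<Lambda> Z" using g'(2) h'(2) by simp
  then show ?thesis using g'(3) h'(3) by simp
qed

text \<open>One half of Caratheodory's criterion is subadditivity. For the other, let Z be an open
  superset of T. A test h for W \<inter> Z vanishes off a closed C, and the part of T outside W lies
  in the open set Z - C, whose tests can be added to h.\<close>

lemma openin_lambda_system:
  assumes W: "openin X W"
  shows "W \<in> lambda_system (topspace X) (Pow (topspace X)) (outer_content X \<Lambda>)"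
proof -
  let ?o = "outer_content X \<Lambda>"
  have Wsub: "W \<subseteq> topspace X" using openin_subset[OF W] .
  have "?o (W \<inter> T) + ?o ((topspace X - W) \<inter> T) = ?o T" if T: "T \<subseteq> topspace X" for T
  proof (rule antisym)
    have "?o T = ?o (\<Union>i. binaryset (W \<inter> T) ((topspace X - W) \<inter> T) i)"
      using T unfolding UN_binaryset_eq by (intro arg_cong[of _ _ ?o]) auto
    also have "\<dots> \<le> (\<Sum>i. ?o (binaryset (W \<inter> T) ((topspace X - W) \<inter> T) i))"
      by (rule outer_content_UN)
    also have "\<dots> = ?o (W \<inter> T) + ?o ((topspace X - W) \<inter> T)"
      using outer_content_open[of X "{}" \<Lambda>] content_empty by (intro suminf_binaryset_eq) simp
    finally show "?o T \<le> ?o (W \<inter> T) + ?o ((topspace X - W) \<inter> T)" .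
  next
    show "?o (W \<inter> T) + ?o ((topspace X - W) \<inter> T) \<le> ?o T"
      unfolding outer_content_def[of X \<Lambda> T]
    proof (rule INF_greatest)
      fix Z assume "Z \<in> {W. openin X W \<and> T \<subseteq> W}"
      then have Z: "openin X Z" "T \<subseteq> Z" by auto
      have *: "ennreal (\<Lambda> h) + ?o ((topspace X - W) \<inter> T) \<le> open_content X \<Lambda> Z" if h: "h \<in> tests X (W \<inter> Z)" for h
      proof -
        obtain C where C: "continuous_map X euclidean h" "\<forall>x\<in>topspace X. cmod (h x) \<le> 1"
          "closedin X C" "C \<subseteq> W \<inter> Z" "\<forall>x\<in>topspace X - C. h x = 0"
          using h by (rule testsE)
        have op: "openin X (Z - C)" using Z(1) C(3) by (rule openin_diff)
        have "?o ((topspace X - W) \<inter> T) \<le> open_content X \<Lambda> (Z - C)"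
          using op by (rule outer_content_le) (use C Z in blast)
        then have "ennreal (\<Lambda> h) + ?o ((topspace X - W) \<inter> T) \<le> ennreal (\<Lambda> h) + open_content X \<Lambda> (Z - C)"
          by (rule add_left_mono)
        also have "\<dots> = (SUP g\<in>tests X (Z - C). ennreal (\<Lambda> h) + ennreal (\<Lambda> g))"
          unfolding open_content_def[of X \<Lambda> "Z - C"] using zero_tests[of X "Z - C"] by (subst ennreal_SUP_add_right) auto
        also have "\<dots> \<le> open_content X \<Lambda> Z"
          by (rule SUP_least, rule tests_disjoint_add[where W = "Z - C" and C = C]) (use C in blast)+
        finally show ?thesis .
      qed
      have "?o (W \<inter> T) \<le> open_content X \<Lambda> (W \<inter> Z)"
        using W Z by (intro outer_content_le) auto
      then have "?o (W \<inter> T) + ?o ((topspace X - W) \<inter> T) \<le> open_content X \<Lambda> (W \<inter> Z) + ?o ((topspace X - W) \<inter> T)"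
        by (rule add_right_mono)
      also have "\<dots> = (SUP h\<in>tests X (W \<inter> Z). ennreal (\<Lambda> h) + ?o ((topspace X - W) \<inter> T))"
        unfolding open_content_def[of X \<Lambda> "W \<inter> Z"] using zero_tests[of X "W \<inter> Z"] by (subst ennreal_SUP_add_left) auto
      also have "\<dots> \<le> open_content X \<Lambda> Z" by (rule SUP_least) (rule *)
      finally show "?o (W \<inter> T) + ?o ((topspace X - W) \<inter> T) \<le> open_content X \<Lambda> Z" .
    qed
  qed
  then show ?thesis using Wsub by (auto simp: lambda_system_def)
qed

lemma measure_space_outer_content:
  "measure_space (topspace X) (borel_sets X) (outer_content X \<Lambda>)"
proof -
  let ?L = "lambda_system (topspace X) (Pow (topspace X)) (outer_content X \<Lambda>)"
  have empty: "outer_content X \<Lambda> {} = 0"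
    using outer_content_open[of X "{}" \<Lambda>] content_empty by simp
  have "outer_measure_space (Pow (topspace X)) (outer_content X \<Lambda>)"
    unfolding outer_measure_space_def
    by (auto simp: positive_def increasing_def countably_subadditive_def empty
        intro: outer_content_mono outer_content_UN)
  then have ms: "measure_space (topspace X) ?L (outer_content X \<Lambda>)"
    by (rule sigma_algebra.caratheodory_lemma[OF sigma_algebra_Pow])
  then have "sigma_algebra (topspace X) ?L" by (simp add: measure_space_def)
  then have "borel_sets X \<subseteq> ?L"
    unfolding borel_sets_def using openin_lambda_system
    by (intro sigma_algebra.sigma_sets_subset) auto
  moreover have "sigma_algebra (topspace X) (borel_sets X)"
    unfolding borel_sets_def by (rule sigma_algebra_sigma_sets) (auto dest: openin_subset)
  ultimately show ?thesis using measure_down[OF ms] by blast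
qed

text \<open>The measure dominates \<Lambda> on the tests of each open set. Hence \<Lambda> is
  nonpositive on the tests of a null open set, which is what \<open>critical_measure\<close> uses.
  Inner regularity at E is outer regularity at the complement of E.\<close>

lemma representing_measure:
  obtains \<mu> where "space \<mu> = topspace X" "sets \<mu> = borel_sets X" "finite_measure \<mu>"
    "\<And>E e. E \<in> sets \<mu> \<Longrightarrow> 0 < e \<Longrightarrow> \<exists>C. closedin X C \<and> C \<subseteq> E \<and> measure \<mu> E - e < measure \<mu> C"
    "\<And>W g. openin X W \<Longrightarrow> g \<in> tests X W \<Longrightarrow> \<Lambda> g \<le> measure \<mu> W"
proof -
  define \<mu> where "\<mu> = measure_of (topspace X) (borel_sets X) (outer_content X \<Lambda>)"
  have sa: "sigma_algebra (topspace X) (borel_sets X)" 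
    using measure_space_outer_content by (simp add: measure_space_def)
  have pow: "borel_sets X \<subseteq> Pow (topspace X)" 
    using sa by (simp add: sigma_algebra_iff2)
  have space: "space \<mu> = topspace X" by (simp add: \<mu>_def space_measure_of[OF pow])
  have sets: "sets \<mu> = borel_sets X" 
    unfolding \<mu>_def using sigma_algebra.sets_measure_of_eq[OF sa] .
  have em: "emeasure \<mu> E = outer_content X \<Lambda> E" if "E \<in> borel_sets X" for E
    unfolding \<mu>_def using measure_space_outer_content that
    by (intro emeasure_measure_of_sigma sa) (auto simp: measure_space_def)
  have op: "W \<in> sets \<mu>" if "openin X W" for W
    unfolding sets borel_sets_def using that by (intro sigma_sets.Basic) simp
  have cl: "C \<in> sets \<mu>" if "closedin X C" for C
  proof -
    have "topspace X - (topspace X - C) \<in> sets \<mu>"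
      using op[of "topspace X - C"] that sets.compl_sets[of "topspace X - C" \<mu>] space by auto
    then show ?thesis using closedin_subset[OF that] by (simp add: double_diff)
  qed
  have emop: "emeasure \<mu> W = open_content X \<Lambda> W" if "openin X W" for W
    using em op[OF that] sets outer_content_open[OF that] by simp
  have "emeasure \<mu> (space \<mu>) \<le> ennreal M"
    using emop[of "topspace X"] content_finite space by simp
  then have fin: "finite_measure \<mu>"
    by (intro finite_measureI) (auto simp: top_unique)
  interpret finite_measure \<mu> by (rule fin)
  show thesis
  proof
    show "space \<mu> = topspace X" "sets \<mu> = borel_sets X" "finite_measure \<mu>" by fact+
    show "\<Lambda> g \<le> measure \<mu> W" if "openin X W" "g \<in> tests X W" for W g
    proof -
      have "ennreal (\<Lambda> g) \<le> ennreal (measure \<mu> W)"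
        using content_upper[OF that(2), of \<Lambda>] emop[OF that(1)] by (simp add: emeasure_eq_measure)
      then show ?thesis by (simp add: ennreal_le_iff)
    qed
    fix E and e :: real assume E: "E \<in> sets \<mu>" and e: "0 < e"
    let ?F = "topspace X - E"
    have F: "?F \<in> sets \<mu>" using E sets.compl_sets space by metis
    have "outer_content X \<Lambda> ?F < outer_content X \<Lambda> ?F + ennreal e"
      using em[of ?F] F sets e emeasure_finite[of ?F] by (simp add: less_top)
    then obtain W where W: "openin X W" "?F \<subseteq> W" "open_content X \<Lambda> W < outer_content X \<Lambda> ?F + ennreal e"
      by (rule outer_content_close)
    then have "ennreal (measure \<mu> W) < ennreal (measure \<mu> ?F + e)"
      using emop[OF W(1)] em[of ?F] F sets e by (simp add: emeasure_eq_measure)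
    then have lt: "measure \<mu> W < measure \<mu> ?F + e" by (simp add: ennreal_less_iff)
    let ?C = "topspace X - W"
    have "measure \<mu> ?C = measure \<mu> (topspace X) - measure \<mu> W"
      using finite_measure_compl[OF op[OF W(1)]] space by simp
    moreover have "measure \<mu> ?F = measure \<mu> (topspace X) - measure \<mu> E"
      using finite_measure_compl[OF E] space by simp
    ultimately have "measure \<mu> E - e < measure \<mu> ?C" using lt by simp
    moreover have "closedin X ?C" "?C \<subseteq> E" using W by auto
    ultimately show "\<exists>C. closedin X C \<and> C \<subseteq> E \<and> measure \<mu> E - e < measure \<mu> C" by blast
  qed
qed

end

text \<open>Let p be the distance from A in the supremum norm over S. A functional below p that
  attains p(\<phi>) is nonpositive on A, at most 1 on the unit ball and at least d at \<phi>. If a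
  nonempty open W were null, minimality would give a in A with |\<phi> - a| < d on S - W; the excess
  of \<phi> - a inside W contributes nothing positive, so the value at \<phi> would be below
  d.\<close>

lemma critical_measure:
  assumes X: "compact_space X" "Hausdorff_space X" and A: "function_algebra X A"
    and \<phi>: "continuous_map X euclidean \<phi>" and d: "0 < d" and S: "critical X A \<phi> d S"
  obtains \<mu> where "space \<mu> = S" "sets \<mu> = borel_sets (subtopology X S)" "finite_measure \<mu>"
    "\<And>E e. E \<in> sets \<mu> \<Longrightarrow> 0 < e \<Longrightarrow>
       \<exists>C. closedin (subtopology X S) C \<and> C \<subseteq> E \<and> measure \<mu> E - e < measure \<mu> C"
    "\<And>W. openin (subtopology X S) W \<Longrightarrow> W \<noteq> {} \<Longrightarrow> 0 < measure \<mu> W"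
proof -
  let ?T = "subtopology X S"
  have Sc: "closedin X S" using criticalD(1)[OF S] .
  have Ssub: "S \<subseteq> topspace X" using closedin_subset[OF Sc] .
  have top: "topspace ?T = S" using Ssub by auto
  have T: "compact_space ?T" using X Sc by (simp add: closedin_compact_space compact_space_subtopology)
  have T2: "Hausdorff_space ?T" using X by (simp add: Hausdorff_space_subtopology)
  obtain x0 where x0: "x0 \<in> S" using criticalD(2)[OF S function_algebraD(5)[OF A]] by blast
  define V where "V = {f :: 'a \<Rightarrow> complex. continuous_map ?T euclidean f}"
  have Vbd: "\<exists>B. \<forall>x\<in>S. cmod (f x) \<le> B" if "f \<in> V" for f
  proof -
    have "continuous_map ?T euclidean f" using that by (simp add: V_def)
    then obtain B where "\<And>x. x \<in> topspace ?T \<Longrightarrow> cmod (f x) < B"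
      by (rule continuous_map_complex_bounded[OF T]) blast
    then show ?thesis unfolding top by (intro exI[of _ B] ballI less_imp_le)
  qed
  interpret V: function_space V
  proof
    fix f g :: "'a \<Rightarrow> complex" assume f: "f \<in> V" 
    show "(\<lambda>x. c *\<^sub>R f x) \<in> V" for c
      using f unfolding V_def scaleR_conv_of_real by (auto intro!: continuous_map_mult)
    assume "g \<in> V"
    with f show "(\<lambda>x. f x + g x) \<in> V" unfolding V_def by (auto intro!: continuous_map_add)
  qed (simp add: V_def)
  have AV: "a \<in> V" if "a \<in> A" for a
    using function_algebra_continuous(1)[OF X(1) A that] by (simp add: V_def continuous_map_from_subtopology)
  have \<phi>V: "\<phi> \<in> V" using \<phi> by (simp add: V_def continuous_map_from_subtopology)
  define P where "P f = {c. \<exists>a\<in>A. \<forall>x\<in>S. cmod (f x - a x) \<le> c}" for f :: "'a \<Rightarrow> complex"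
  define p where "p f = Inf (P f)" for f
  have P0: "0 \<le> c" if "c \<in> P f" for c f
    using that x0 norm_ge_zero order_trans unfolding P_def by blast
  have pP: "p f \<le> c" if "c \<in> P f" for c f
    unfolding p_def by (rule cInf_lower[OF that bdd_belowI[of _ 0]]) (rule P0)
  have Pbd: "c \<in> P f" if "\<And>x. x \<in> S \<Longrightarrow> cmod (f x) \<le> c" for c f
    unfolding P_def using that Ssub function_algebraD(5)[OF A, of 0]
    by (intro CollectI bexI[of _ "\<lambda>x\<in>topspace X. 0"]) auto
  have Pne: "P f \<noteq> {}" if "f \<in> V" for f
    using Vbd[OF that] Pbd by blast
  have pI: "c \<le> p f" if "f \<in> V" "\<And>r. r \<in> P f \<Longrightarrow> c \<le> r" for c f
    unfolding p_def using Pne[OF that(1)] that(2) by (rule cInf_greatest)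
  have p: "sublinear_on V p"
    unfolding sublinear_on_def
  proof (intro conjI ballI allI impI)
    fix f g assume f: "f \<in> V" and g: "g \<in> V"
    have *: "p (\<lambda>x. f x + g x) \<le> r + s" if rs: "r \<in> P f" "s \<in> P g" for r s
    proof (rule pP)
      obtain a b where a: "a \<in> A" "\<forall>x\<in>S. cmod (f x - a x) \<le> r" and b: "b \<in> A" "\<forall>x\<in>S. cmod (g x - b x) \<le> s"
        using rs unfolding P_def by blast
      have "cmod (f x + g x - (a x + b x)) \<le> r + s" if x: "x \<in> S" for x
        using bspec[OF a(2) x] bspec[OF b(2) x] norm_triangle_ineq[of "f x - a x" "g x - b x"]
        by (simp add: algebra_simps)
      then show "r + s \<in> P (\<lambda>x. f x + g x)"
        unfolding P_def using Ssub function_algebraD(2)[OF A a(1) b(1)]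
        by (intro CollectI bexI[of _ "\<lambda>x\<in>topspace X. a x + b x"]) auto
    qed
    have "p (\<lambda>x. f x + g x) - r \<le> p g" if "r \<in> P f" for r
      using *[OF that] by (intro pI[OF g]) (simp add: algebra_simps)
    then have "p (\<lambda>x. f x + g x) - p g \<le> p f"
      by (intro pI[OF f]) (simp add: algebra_simps)
    then show "p (\<lambda>x. f x + g x) \<le> p f + p g" by simp
  next
    fix f and c :: real assume f: "f \<in> V" and c: "0 < c"
    have "p (\<lambda>x. c *\<^sub>R f x) / c \<le> p f"
    proof (rule pI[OF f])
      fix r assume "r \<in> P f"
      then obtain a where a: "a \<in> A" "\<forall>x\<in>S. cmod (f x - a x) \<le> r"
        unfolding P_def by blast
      have "cmod (c *\<^sub>R f x - of_real c * a x) \<le> c * r" if x: "x \<in> S" for x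
      proof -
        have "c *\<^sub>R f x - of_real c * a x = of_real c * (f x - a x)"
          by (simp add: scaleR_conv_of_real algebra_simps)
        then show ?thesis using bspec[OF a(2) x] c by (simp add: norm_mult)
      qed
      then have "c * r \<in> P (\<lambda>x. c *\<^sub>R f x)"
        unfolding P_def using Ssub function_algebraD(4)[OF A a(1), of "of_real c"]
        by (intro CollectI bexI[of _ "\<lambda>x\<in>topspace X. of_real c * a x"]) auto
      from pP[OF this] show "p (\<lambda>x. c *\<^sub>R f x) / c \<le> r" using c by (simp add: field_simps)
    qed
    then show "p (\<lambda>x. c *\<^sub>R f x) \<le> c * p f" using c by (simp add: field_simps)
  qed
  obtain \<Lambda> where \<Lambda>p: "\<And>f. f \<in> V \<Longrightarrow> \<Lambda> f \<le> p f" and \<Lambda>\<phi>: "p \<phi> \<le> \<Lambda> \<phi>"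
    and add: "\<And>f g. f \<in> V \<Longrightarrow> g \<in> V \<Longrightarrow> \<Lambda> (\<lambda>x. f x + g x) = \<Lambda> f + \<Lambda> g"
    and scale: "\<And>f c. f \<in> V \<Longrightarrow> 0 < c \<Longrightarrow> \<Lambda> (\<lambda>x. c *\<^sub>R f x) = c * \<Lambda> f"
    by (rule V.Hahn_Banach_function_space[OF p \<phi>V]) blast
  have "d \<le> r" if r: "r \<in> P \<phi>" for r
  proof -
    obtain a where a: "a \<in> A" "\<forall>x\<in>S. cmod (\<phi> x - a x) \<le> r" using r unfolding P_def by blast
    obtain x where "x \<in> S" "d \<le> cmod (\<phi> x - a x)" using criticalD(2)[OF S a(1)] by blast
    with a(2) show ?thesis by (meson order_trans)
  qed
  then have "d \<le> \<Lambda> \<phi>" using order_trans[OF pI[OF \<phi>V] \<Lambda>\<phi>] by simp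
  have \<Lambda>A: "\<Lambda> a \<le> 0" if a: "a \<in> A" for a
  proof -
    have "0 \<in> P a" unfolding P_def using a by (intro CollectI bexI[of _ a]) auto
    from pP[OF this] \<Lambda>p[OF AV[OF a]] show ?thesis by simp
  qed
  have \<Lambda>bd: "\<Lambda> g \<le> c" if "g \<in> V" "\<And>x. x \<in> S \<Longrightarrow> cmod (g x) \<le> c" for g c
    using \<Lambda>p[OF that(1)] pP[OF Pbd, of g c] that(2) by simp
  interpret L: bounded_functional ?T \<Lambda> 1
  proof
    show "compact_space ?T" "Hausdorff_space ?T" by (rule T, rule T2)
    show "\<Lambda> (\<lambda>x. f x + g x) = \<Lambda> f + \<Lambda> g" 
      if "continuous_map ?T euclidean f" "continuous_map ?T euclidean g" for f g
      using that by (intro add) (simp_all add: V_def)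
    show "\<Lambda> g \<le> 1" if "continuous_map ?T euclidean g" "\<And>x. x \<in> topspace ?T \<Longrightarrow> cmod (g x) \<le> 1" for g
      using that unfolding top by (intro \<Lambda>bd) (simp_all add: V_def)
  qed
  obtain \<mu> where \<mu>: "space \<mu> = topspace ?T" "sets \<mu> = borel_sets ?T" "finite_measure \<mu>"
    and inner: "\<And>E e. E \<in> sets \<mu> \<Longrightarrow> 0 < e \<Longrightarrow> \<exists>C. closedin ?T C \<and> C \<subseteq> E \<and> measure \<mu> E - e < measure \<mu> C"
    and ge: "\<And>W g. openin ?T W \<Longrightarrow> g \<in> tests ?T W \<Longrightarrow> \<Lambda> g \<le> measure \<mu> W"
    by (rule L.representing_measure) blast
  show thesis
  proof (rule that[of \<mu>])
    show "space \<mu> = S" using \<mu>(1) top by simp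
    show "sets \<mu> = borel_sets ?T" "finite_measure \<mu>" by (rule \<mu>)+
    show "\<exists>C. closedin ?T C \<and> C \<subseteq> E \<and> measure \<mu> E - e < measure \<mu> C" if "E \<in> sets \<mu>" "0 < e" for E e
      using inner[OF that] .
    fix W assume W: "openin ?T W" "W \<noteq> {}"
    show "0 < measure \<mu> W"
    proof (rule ccontr)
      assume "\<not> 0 < measure \<mu> W"
      then have tests0: "\<Lambda> g \<le> 0" if "g \<in> tests ?T W" for g
        using ge[OF W(1) that] by simp
      have Wsub: "W \<subseteq> S" using openin_subset[OF W(1)] top by simp
      have Rc: "closedin ?T (S - W)" using closedin_diff[OF closedin_topspace W(1)] top by simp
      have "closedin X (S - W)" using Rc Sc closedin_trans_full by blast
      moreover have "S - W \<subset> S" using W(2) Wsub by blast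
      ultimately obtain a where a: "a \<in> A" "\<forall>x\<in>S - W. cmod (\<phi> x - a x) < d"
        using criticalD(3)[OF S] by blast
      define u where "u x = \<phi> x - a x" for x
      have uc: "continuous_map ?T euclidean u"
        using \<phi>V AV[OF a(1)] unfolding V_def u_def by (auto intro!: continuous_map_diff)
      have "cmod (u x) < d" if "x \<in> S - W" for x using a(2) that by (simp add: u_def)
      then obtain c where c: "0 < c" "c < d" "\<forall>x\<in>S - W. cmod (u x) \<le> c"
        by (rule closed_subset_strict_bound[OF T Rc uc d]) blast
      \<comment> \<open>c < c' puts the closed set where |u| \<ge> c' inside W; c' < d yields the
        contradiction at the end.\<close>
      obtain c' where c': "c < c'" "c' < d" using c(2) dense by blast
      \<comment> \<open>The radial retraction onto the closed disc of radius c'. It splits u into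
        g2, bounded by c', and g1, which vanishes unless |u| > c' and so becomes a test for W after
        scaling.\<close>
      define \<tau> where "\<tau> z = of_real (c' / max c' (cmod z)) * z" for z
      have mpos: "0 < max c' (cmod z)" for z :: complex using c c' by (simp add: less_max_iff_disj)
      have \<tau>c: "continuous_map euclidean euclidean \<tau>"
      proof -
        have "\<forall>z. max c' (cmod z) \<noteq> 0" using mpos by (metis less_irrefl)
        then show ?thesis unfolding \<tau>_def by (auto intro!: continuous_intros)
      qed
      have \<tau>bd: "cmod (\<tau> z) \<le> c'" for z
      proof -
        have "c' * cmod z \<le> c' * max c' (cmod z)" using c c' by (intro mult_left_mono) auto
        then show ?thesis using mpos[of z] c c'
          by (simp add: \<tau>_def norm_mult norm_divide field_simps del: max_mult_distrib_left max_mult_distrib_right)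
      qed
      have \<tau>id: "\<tau> z = z" if "cmod z \<le> c'" for z
        using that c c' by (simp add: \<tau>_def max_absorb1)
      define g2 where "g2 x = \<tau> (u x)" for x
      define g1 where "g1 x = u x - g2 x" for x
      have g2c: "continuous_map ?T euclidean g2"
        using continuous_map_compose[OF uc \<tau>c] by (simp add: g2_def[abs_def] comp_def)
      have g1c: "continuous_map ?T euclidean g1"
        unfolding g1_def by (rule continuous_map_diff[OF uc g2c])
      have V12: "u \<in> V" "g1 \<in> V" "g2 \<in> V" using uc g1c g2c by (simp_all add: V_def)
      obtain R where R: "0 < R" "\<And>x. x \<in> topspace ?T \<Longrightarrow> cmod (g1 x) < R"
        by (rule continuous_map_complex_bounded[OF T g1c]) blast
      have "(\<lambda>x. (1/R) *\<^sub>R g1 x) \<in> tests ?T W"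
      proof (rule testsI)
        let ?C = "{x \<in> topspace ?T. u x \<in> - ball 0 c'}"
        show "continuous_map ?T euclidean (\<lambda>x. (1/R) *\<^sub>R g1 x)"
          using V.scale_mem[OF V12(2)] unfolding V_def by blast
        show "closedin ?T ?C" using uc by (intro closedin_continuous_map_preimage) (auto simp: closed_Compl)
        show "?C \<subseteq> W"
        proof
          fix x assume x: "x \<in> ?C"
          then have "x \<in> S" "c' \<le> cmod (u x)" using top by simp_all
          then show "x \<in> W" using c(3) c'(1) by force
        qed
        show "cmod ((1/R) *\<^sub>R g1 x) \<le> 1" if "x \<in> topspace ?T" for x
          using R(1) R(2)[OF that] by simp
        show "(1/R) *\<^sub>R g1 x = 0" if "x \<in> topspace ?T" "x \<notin> ?C" for x
        proof -
          have "cmod (u x) \<le> c'" using that by simp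
          then show ?thesis using \<tau>id by (simp add: g1_def g2_def)
        qed
      qed
      from tests0[OF this] have "\<Lambda> g1 \<le> 0"
        using scale[OF V12(2), of "1/R"] R(1) by (simp add: field_simps)
      moreover have "\<Lambda> g2 \<le> c'"
        using \<tau>bd by (intro \<Lambda>bd V12) (simp add: g2_def)
      moreover have "\<Lambda> u = \<Lambda> g1 + \<Lambda> g2"
        using add[OF V12(2,3)] by (simp add: g1_def)
      moreover have "\<Lambda> \<phi> = \<Lambda> u + \<Lambda> a"
        using add[OF V12(1) AV[OF a(1)]] by (simp add: u_def)
      ultimately show False using \<open>d \<le> \<Lambda> \<phi>\<close> \<Lambda>A[OF a(1)] c' by simp
    qed
  qed
qed

section \<open>Borel sets of subspaces, and regularity of positive measures\<close>

lemma borel_sets_sigma_algebra: "sigma_algebra (topspace X) (borel_sets X)"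
  unfolding borel_sets_def by (rule sigma_algebra_sigma_sets) (auto dest: openin_subset)

lemma borel_sets_open: "openin X U \<Longrightarrow> U \<in> borel_sets X"
  unfolding borel_sets_def by (intro sigma_sets.Basic) simp

lemma borel_sets_closed:
  assumes "closedin X C"
  shows "C \<in> borel_sets X"
proof -
  have "topspace X - (topspace X - C) \<in> borel_sets X"
    using assms unfolding borel_sets_def by (intro sigma_sets.Compl sigma_sets.Basic) auto
  then show ?thesis using closedin_subset[OF assms] by (simp add: double_diff)
qed

lemma borel_sets_trace:
  assumes E: "closedin X E" and S: "closedin X S" and B: "B \<in> borel_sets (subtopology X E)"
  shows "B \<inter> S \<in> borel_sets (subtopology X S)"
proof -
  interpret sigma_algebra "topspace (subtopology X S)" "borel_sets (subtopology X S)"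
    by (rule borel_sets_sigma_algebra)
  \<comment> \<open>Complements are taken in E, so their traces on S are differences from E \<inter>
    S, which has to be Borel in S itself.\<close>
  have ES: "E \<inter> S \<in> borel_sets (subtopology X S)"
    using E by (intro borel_sets_closed) (auto simp: closedin_subtopology)
  have Esub: "topspace X \<inter> E = E" using closedin_subset[OF E] by blast
  show ?thesis
    using B unfolding borel_sets_def[of "subtopology X E"]
  proof (induction rule: sigma_sets.induct)
    case (Basic a)
    then obtain U where U: "openin X U" "a = U \<inter> E" by (auto simp: openin_subtopology)
    have "U \<inter> S \<in> borel_sets (subtopology X S)"
      using U(1) by (intro borel_sets_open) (auto simp: openin_subtopology)
    from Int[OF this ES] have "(U \<inter> S) \<inter> (E \<inter> S) \<in> borel_sets (subtopology X S)" .
    moreover have "(U \<inter> S) \<inter> (E \<inter> S) = a \<inter> S" using U(2) by blast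
    ultimately show ?case by simp
  next
    case Empty
    then show ?case by simp
  next
    case (Compl a)
    have "(E \<inter> S) - (a \<inter> S) \<in> borel_sets (subtopology X S)" using ES Compl.IH by (rule Diff)
    moreover have "(topspace (subtopology X E) - a) \<inter> S = (E \<inter> S) - (a \<inter> S)" using Esub by auto
    ultimately show ?case by simp
  next
    case (Union a)
    have "(\<Union>i. a i \<inter> S) \<in> borel_sets (subtopology X S)" using Union.IH by (intro countable_UN) auto
    then show ?case by (simp add: Int_UN_distrib2)
  qed
qed

text \<open>For a positive measure every countable Borel partition of E gives the same sum, by
  countable additivity.\<close>

lemma total_variation_measure:
  assumes \<mu>: "finite_measure \<mu>" "sets \<mu> = borel_sets X" and E: "E \<in> borel_sets X"
  shows "total_variation X (\<lambda>B. of_real (measure \<mu> B)) E = ennreal (measure \<mu> E)"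
proof -
  interpret finite_measure \<mu> by (rule \<mu>(1))
  let ?P = "{B :: nat \<Rightarrow> 'a set. range B \<subseteq> borel_sets X \<and> disjoint_family B \<and> (\<Union>n. B n) = E}"
  have const: "(\<Sum>n. ennreal (cmod (complex_of_real (measure \<mu> (B n))))) = ennreal (measure \<mu> E)"
    if "B \<in> ?P" for B
  proof -
    have "(\<lambda>n. measure \<mu> (B n)) sums measure \<mu> (\<Union>n. B n)"
      using that \<mu>(2) by (intro finite_measure_UNION) auto
    then have "(\<Sum>n. ennreal (measure \<mu> (B n))) = ennreal (measure \<mu> (\<Union>n. B n))"
      by (intro suminf_ennreal_eq) auto
    then show ?thesis using that by simp
  qed
  \<comment> \<open>The supremum of a constant is that constant only over a nonempty index set; E
    followed by empty sets is a partition.\<close>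
  have "?P \<noteq> {}"
  proof -
    have "{} \<in> borel_sets X" using borel_sets_open[of X "{}"] by simp
    then have "range (\<lambda>n::nat. if n = 0 then E else {}) \<subseteq> borel_sets X" using E by auto
    moreover have "(\<Union>n::nat. if n = 0 then E else {}) = E" by (auto split: if_splits)
    moreover have "disjoint_family (\<lambda>n::nat. if n = 0 then E else {})" by (auto simp: disjoint_family_on_def)
    ultimately have "(\<lambda>n. if n = 0 then E else {}) \<in> ?P" by blast
    then show ?thesis by blast
  qed
  have "total_variation X (\<lambda>B. of_real (measure \<mu> B)) E = (SUP B\<in>?P. ennreal (measure \<mu> E))"
    unfolding total_variation_def by (rule SUP_cong[OF refl const])
  also have "\<dots> = ennreal (measure \<mu> E)"
    using \<open>?P \<noteq> {}\<close> by (rule SUP_const)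
  finally show ?thesis .
qed

text \<open>In a compact Hausdorff space compact and closed sets coincide, so \<open>inner\<close>
  is inner regularity; outer regularity is \<open>inner\<close> for the complement.\<close>

lemma regular_borel_measure_measure:
  assumes X: "Hausdorff_space X" and \<mu>: "finite_measure \<mu>" "space \<mu> = topspace X" "sets \<mu> = borel_sets X"
    and C: "compact_space X"
    and inner: "\<And>E e. E \<in> sets \<mu> \<Longrightarrow> 0 < e \<Longrightarrow> \<exists>C. closedin X C \<and> C \<subseteq> E \<and> measure \<mu> E - e < measure \<mu> C"
  shows "regular_borel_measure X (\<lambda>B. of_real (measure \<mu> B))"
proof -
  interpret finite_measure \<mu> by (rule \<mu>(1))
  let ?m = "\<lambda>B. complex_of_real (measure \<mu> B)"
  have tv: "total_variation X ?m E = ennreal (measure \<mu> E)" if "E \<in> borel_sets X" for E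
    by (rule total_variation_measure[OF \<mu>(1,3) that])
  have comp: "compactin X K \<longleftrightarrow> closedin X K" for K
    using X C compactin_imp_closedin closedin_compact_space by blast
  show ?thesis
    unfolding regular_borel_measure_def
  proof (intro conjI ballI)
    show "complex_borel_measure X ?m"
      unfolding complex_borel_measure_def using \<mu>(3) by (auto intro!: sums_of_real finite_measure_UNION)
    fix E assume E: "E \<in> borel_sets X"
    have Es: "E \<in> sets \<mu>" using E \<mu>(3) by simp
    show "total_variation X ?m E = (INF V \<in> {V. openin X V \<and> E \<subseteq> V}. total_variation X ?m V)"
    proof (rule antisym)
      show "total_variation X ?m E \<le> (INF V \<in> {V. openin X V \<and> E \<subseteq> V}. total_variation X ?m V)"
      proof (rule INF_greatest)
        fix V assume "V \<in> {V. openin X V \<and> E \<subseteq> V}"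
        then have V: "V \<in> borel_sets X" "E \<subseteq> V" by (auto intro: borel_sets_open)
        then show "total_variation X ?m E \<le> total_variation X ?m V"
          using \<mu>(3) by (auto simp: tv[OF E] tv[OF V(1)] intro!: ennreal_leI finite_measure_mono)
      qed
      show "(INF V \<in> {V. openin X V \<and> E \<subseteq> V}. total_variation X ?m V) \<le> total_variation X ?m E"
      proof (rule ennreal_le_epsilon)
        fix e :: real assume e: "0 < e"
        have Fs: "space \<mu> - E \<in> sets \<mu>" using Es by (rule sets.compl_sets)
        obtain C where C: "closedin X C" "C \<subseteq> space \<mu> - E" "measure \<mu> (space \<mu> - E) - e < measure \<mu> C"
          using inner[OF Fs e] by blast
        let ?V = "topspace X - C"
        have V: "openin X ?V" "E \<subseteq> ?V"
          using C sets.sets_into_space[OF Es] \<mu>(2) by auto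
        have Cs: "C \<in> sets \<mu>" using C(1) \<mu>(3) borel_sets_closed by simp
        have "measure \<mu> ?V \<le> measure \<mu> E + e"
          using finite_measure_compl[OF Cs] finite_measure_compl[OF Es] C(3) \<mu>(2) by simp
        then have "total_variation X ?m ?V \<le> total_variation X ?m E + ennreal e"
          using e by (simp add: tv[OF E] tv[OF borel_sets_open[OF V(1)]] flip: ennreal_plus)
        then show "(INF V \<in> {V. openin X V \<and> E \<subseteq> V}. total_variation X ?m V) \<le> total_variation X ?m E + ennreal e"
          using V by (intro INF_lower2[of ?V]) auto
      qed
    qed
    show "total_variation X ?m E = (SUP K \<in> {K. compactin X K \<and> K \<subseteq> E}. total_variation X ?m K)"
    proof (rule antisym)
      show "(SUP K \<in> {K. compactin X K \<and> K \<subseteq> E}. total_variation X ?m K) \<le> total_variation X ?m E"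
      proof (rule SUP_least)
        fix K assume "K \<in> {K. compactin X K \<and> K \<subseteq> E}"
        then have K: "K \<in> borel_sets X" "K \<subseteq> E" using comp by (auto intro: borel_sets_closed)
        then show "total_variation X ?m K \<le> total_variation X ?m E"
          using Es by (auto simp: tv[OF E] tv[OF K(1)] intro!: ennreal_leI finite_measure_mono)
      qed
      show "total_variation X ?m E \<le> (SUP K \<in> {K. compactin X K \<and> K \<subseteq> E}. total_variation X ?m K)"
      proof (rule ennreal_le_epsilon)
        fix e :: real assume e: "0 < e"
        obtain C where C: "closedin X C" "C \<subseteq> E" "measure \<mu> E - e < measure \<mu> C"
          using inner[OF Es e] by blast
        have "total_variation X ?m E \<le> total_variation X ?m C + ennreal e"
          using e C(3) by (simp add: tv[OF E] tv[OF borel_sets_closed[OF C(1)]] flip: ennreal_plus)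
        also have "\<dots> \<le> (SUP K \<in> {K. compactin X K \<and> K \<subseteq> E}. total_variation X ?m K) + ennreal e"
          using C comp by (intro add_right_mono SUP_upper) auto
        finally show "total_variation X ?m E \<le> (SUP K \<in> {K. compactin X K \<and> K \<subseteq> E}. total_variation X ?m K) + ennreal e" .
      qed
    qed
  qed
qed

text \<open>H is the support of the trace on E of a measure that has full support on S.\<close>

lemma pseudo_removable_support:
  assumes X: "compact_space X" "Hausdorff_space X" and E: "closedin X E" and S: "closedin X S"
    and PR: "pseudo_removable (subtopology X E)"
    and U: "openin X U" "U \<subseteq> E"
    and \<mu>: "space \<mu> = S" "sets \<mu> = borel_sets (subtopology X S)" "finite_measure \<mu>"
    and inner: "\<And>B e. B \<in> sets \<mu> \<Longrightarrow> 0 < e \<Longrightarrow>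
       \<exists>C. closedin (subtopology X S) C \<and> C \<subseteq> B \<and> measure \<mu> B - e < measure \<mu> C"
    and full: "\<And>W. openin (subtopology X S) W \<Longrightarrow> W \<noteq> {} \<Longrightarrow> 0 < measure \<mu> W"
  obtains H where "closedin X H" "removable (subtopology X H)" "S \<inter> U \<subseteq> H"
proof -
  let ?Y = "subtopology X E"
  have topY: "topspace ?Y = E" using closedin_subset[OF E] by auto
  interpret finite_measure \<mu> by (rule \<mu>(3))
  interpret Y: sigma_algebra "topspace ?Y" "borel_sets ?Y" by (rule borel_sets_sigma_algebra)
  \<comment> \<open>This is B \<mapsto> \<mu>(B \<inter> S) on the Borel sets of E. As the image of
    a restricted measure under the identity it is a measure by construction.\<close>
  define \<nu> where "\<nu> = distr (restrict_space \<mu> (E \<inter> S)) (sigma E (borel_sets ?Y)) (\<lambda>x. x)"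
  have pow: "borel_sets ?Y \<subseteq> Pow E" using Y.space_closed topY by simp
  have sets\<nu>: "sets \<nu> = borel_sets ?Y" and space\<nu>: "space \<nu> = E"
    using Y.sets_measure_of_eq topY by (simp_all add: \<nu>_def space_measure_of[OF pow])
  have ES: "E \<inter> S \<in> sets \<mu>"
    unfolding \<mu>(2) using E by (intro borel_sets_closed) (auto simp: closedin_subtopology)
  have meas: "(\<lambda>x. x) \<in> restrict_space \<mu> (E \<inter> S) \<rightarrow>\<^sub>M sigma E (borel_sets ?Y)"
  proof (rule measurable_measure_of[OF pow])
    show "(\<lambda>x. x) \<in> space (restrict_space \<mu> (E \<inter> S)) \<rightarrow> E"
      by (auto simp: space_restrict_space)
    fix B assume B: "B \<in> borel_sets ?Y"
    have "B \<inter> S \<in> sets \<mu>" unfolding \<mu>(2) by (rule borel_sets_trace[OF E S B])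
    moreover have "(\<lambda>x. x) -` B \<inter> space (restrict_space \<mu> (E \<inter> S)) = (E \<inter> S) \<inter> (B \<inter> S)"
      using \<mu>(1) by (auto simp: space_restrict_space)
    ultimately show "(\<lambda>x. x) -` B \<inter> space (restrict_space \<mu> (E \<inter> S)) \<in> sets (restrict_space \<mu> (E \<inter> S))"
      by (auto simp: sets_restrict_space)
  qed
  have em: "emeasure \<nu> B = emeasure \<mu> (B \<inter> S)" if B: "B \<in> borel_sets ?Y" for B
  proof -
    have BE: "B \<subseteq> E" using pow B by auto
    have "emeasure \<nu> B = emeasure (restrict_space \<mu> (E \<inter> S)) ((\<lambda>x. x) -` B \<inter> space (restrict_space \<mu> (E \<inter> S)))"
      unfolding \<nu>_def using B Y.sets_measure_of_eq topY by (intro emeasure_distr meas) simp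
    also have "(\<lambda>x. x) -` B \<inter> space (restrict_space \<mu> (E \<inter> S)) = B \<inter> S"
      using BE \<mu>(1) by (auto simp: space_restrict_space)
    also have "emeasure (restrict_space \<mu> (E \<inter> S)) (B \<inter> S) = emeasure \<mu> (B \<inter> S)"
      using ES BE \<mu>(1) by (intro emeasure_restrict_space) (auto simp: Int_absorb2)
    finally show ?thesis .
  qed
  have me: "measure \<nu> B = measure \<mu> (B \<inter> S)" if "B \<in> borel_sets ?Y" for B
    using em[OF that] by (simp add: measure_def)
  have "E \<in> borel_sets ?Y" using borel_sets_open[OF openin_topspace[of ?Y]] topY by simp
  then have fin: "finite_measure \<nu>"
    using em[of E] emeasure_finite space\<nu> by (intro finite_measureI) simp
  let ?m = "\<lambda>B. complex_of_real (measure \<nu> B)"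
  have Y: "compact_space ?Y" "Hausdorff_space ?Y"
    using X E by (simp_all add: closedin_compact_space compact_space_subtopology Hausdorff_space_subtopology)
  have "regular_borel_measure ?Y ?m"
  proof (rule regular_borel_measure_measure[OF Y(2) fin _ sets\<nu> Y(1)])
    show "space \<nu> = topspace ?Y" using space\<nu> topY by simp
    fix B and e :: real assume B: "B \<in> sets \<nu>" and e: "0 < e"
    have B': "B \<in> borel_sets ?Y" using B sets\<nu> by simp
    have "B \<inter> S \<in> sets \<mu>" unfolding \<mu>(2) by (rule borel_sets_trace[OF E S B'])
    from inner[OF this e] obtain C where C: "closedin (subtopology X S) C" "C \<subseteq> B \<inter> S"
      "measure \<mu> (B \<inter> S) - e < measure \<mu> C" by blast
    have "closedin X C" using C(1) S closedin_trans_full by blast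
    moreover have "C \<subseteq> E" using C(2) pow B' by auto
    ultimately have CY: "closedin ?Y C" by (metis closedin_subset_topspace)
    have "C \<inter> S = C" using C(2) by blast
    then have "measure \<nu> C = measure \<mu> C" using me[OF borel_sets_closed[OF CY]] by simp
    then show "\<exists>C. closedin ?Y C \<and> C \<subseteq> B \<and> measure \<nu> B - e < measure \<nu> C"
      using C me[OF B'] CY by (intro exI[of _ C]) auto
  qed
  then have rem: "removable (subtopology ?Y (supt ?Y ?m))"
    using PR unfolding pseudo_removable_def by blast
  let ?H = "supt ?Y ?m"
  have "closedin ?Y ?H"
    unfolding supt_def by (intro closedin_diff closedin_topspace openin_Union) auto
  then have HX: "closedin X ?H" using E closedin_trans_full by blast
  have HE: "?H \<subseteq> E" using topY by (auto simp: supt_def)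
  have "S \<inter> U \<subseteq> ?H"
  proof
    fix x assume x: "x \<in> S \<inter> U"
    have "x \<notin> W" if W: "openin ?Y W" "total_variation ?Y ?m W = 0" for W
    proof
      assume xW: "x \<in> W"
      obtain Z where Z: "openin X Z" "W = Z \<inter> E" using W(1) by (auto simp: openin_subtopology)
      have WB: "W \<in> borel_sets ?Y" using W(1) by (rule borel_sets_open)
      \<comment> \<open>U is open in X and lies in E, so this is a nonempty open subset of S inside
        W; the full support of \<mu> makes it non-null.\<close>
      have "openin (subtopology X S) ((Z \<inter> U) \<inter> S)"
        using Z(1) U(1) unfolding openin_subtopology by blast
      then have "0 < measure \<mu> ((Z \<inter> U) \<inter> S)"
        by (rule full) (use x xW Z in blast)
      also have "\<dots> \<le> measure \<mu> (W \<inter> S)"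
        using borel_sets_trace[OF E S WB] Z(2) U(2) unfolding \<mu>(2)[symmetric]
        by (intro finite_measure_mono) auto
      finally have "0 < measure \<nu> W" using me[OF WB] by simp
      then show False using W(2) total_variation_measure[OF fin sets\<nu> WB] by simp
    qed
    then show "x \<in> ?H" using x U(2) topY by (auto simp: supt_def)
  qed
  moreover have "removable (subtopology X ?H)"
    using rem HE by (simp add: subtopology_subtopology Int_absorb1)
  ultimately show thesis using HX that by blast
qed


section \<open>Stone--Weierstrass for PR-scattered spaces\<close>

text \<open>On a critical set S for \<psi> removability makes S - U norming, hence |f| \<le> c on S,
  so \<psi> vanishes there and 0 approximates it. Removability requires a proper open subset, so the
  case where S lies in U is separate.\<close>

lemma approximation_on_pseudo_removable:
  assumes X: "compact_space X" "Hausdorff_space X" and A: "function_algebra X A" and f: "f \<in> A"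
    and U: "openin X U" "pseudo_removable (subtopology X (X closure_of U))"
    and c: "\<And>x. x \<in> topspace X \<Longrightarrow> x \<notin> U \<Longrightarrow> cmod (f x) \<le> c"
    and \<psi>: "\<psi> \<in> mspace (cfun X)" "\<And>x. x \<in> topspace X \<Longrightarrow> cmod (f x) \<le> c \<Longrightarrow> \<psi> x = 0"
  shows "\<psi> \<in> uclosure X A"
proof (rule ccontr)
  assume no: "\<psi> \<notin> uclosure X A"
  obtain d S where d: "0 < d" and S: "critical X A \<psi> d S"
    by (rule critical_exists[OF X(1) A \<psi>(1) no])
  have \<psi>c: "continuous_map X euclidean \<psi>" using \<psi>(1) mspace_cfun[OF X(1)] by simp
  have Sc: "closedin X S" using criticalD(1)[OF S] .
  have Ssub: "S \<subseteq> topspace X" using closedin_subset[OF Sc] .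
  let ?T = "subtopology X S"
  let ?B = "uclosure ?T ((\<lambda>f. restrict f S) ` A)"
  have top: "topspace ?T = S" using Ssub by auto
  have T: "compact_space ?T" "Hausdorff_space ?T"
    using X Sc by (simp_all add: closedin_compact_space compact_space_subtopology Hausdorff_space_subtopology)
  have fT: "function_algebra ?T ((\<lambda>f. restrict f S) ` A)" by (rule function_algebra_restrict[OF X(1) Sc A])
  have cB: "closed_function_algebra ?T ?B" by (rule closed_function_algebra_uclosure[OF T(1) fT])
  have fB: "function_algebra ?T ?B" by (rule function_algebra_uclosure[OF T(1) fT])
  have triv: "trivial_idempotents ?T ?B"
    unfolding trivial_idempotents_def
  proof (intro ballI impI)
    fix h assume h: "h \<in> ?B" "idempotent ?T h"
    have h01: "h x = 0 \<or> h x = 1" if "x \<in> S" for x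
    proof -
      have "(h x)\<^sup>2 = h x" using h(2) that top by (simp add: idempotent_def)
      then have "h x * (h x - 1) = 0" by (simp add: power2_eq_square algebra_simps)
      then show ?thesis by simp
    qed
    have ext: "h \<in> extensional S" using function_algebra_continuous(2)[OF T(1) fB h(1)] top by simp
    obtain x0 where x0: "x0 \<in> S" using critical_two_points[OF A d S] by blast
    have "Im (h x) = 0" if "x \<in> S" for x using h01[OF that] by auto
    then have const: "h x = h x0" if "x \<in> S" for x
      using critical_antisymmetric[OF X(1) A \<psi>c d S h(1) _ that x0] by blast
    show "h = (\<lambda>x\<in>topspace ?T. 0) \<or> h = (\<lambda>x\<in>topspace ?T. 1)"
      unfolding top
    proof (cases "h x0 = 0")
      case True
      then have "h = (\<lambda>x\<in>S. 0)" using const by (intro extensionalityI[OF ext]) auto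
      then show "h = (\<lambda>x\<in>S. 0) \<or> h = (\<lambda>x\<in>S. 1)" ..
    next
      case False
      then have "h = (\<lambda>x\<in>S. 1)" using const h01[OF x0] by (intro extensionalityI[OF ext]) auto
      then show "h = (\<lambda>x\<in>S. 0) \<or> h = (\<lambda>x\<in>S. 1)" ..
    qed
  qed
  obtain \<mu> where \<mu>: "space \<mu> = S" "sets \<mu> = borel_sets ?T" "finite_measure \<mu>"
    "\<And>E e. E \<in> sets \<mu> \<Longrightarrow> 0 < e \<Longrightarrow> \<exists>C. closedin ?T C \<and> C \<subseteq> E \<and> measure \<mu> E - e < measure \<mu> C"
    "\<And>W. openin ?T W \<Longrightarrow> W \<noteq> {} \<Longrightarrow> 0 < measure \<mu> W"
    by (rule critical_measure[OF X A \<psi>c d S]) blast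
  have Usub: "U \<subseteq> X closure_of U" using openin_subset[OF U(1)] by (rule closure_of_subset)
  obtain H where H: "closedin X H" "removable (subtopology X H)" "S \<inter> U \<subseteq> H"
    by (rule pseudo_removable_support[OF X closedin_closure_of Sc U(2) U(1) Usub \<mu>])
  have Htop: "topspace (subtopology X H) = H" using closedin_subset[OF H(1)] by auto
  \<comment> \<open>The closure of W in S lies in H, and it carries the same topology as a subspace
    of S and of H.\<close>
  have rem: "norming ?T ?B (S - W)" if W: "openin ?T W" "W \<subseteq> U" "W \<noteq> S" for W
  proof -
    let ?C = "?T closure_of W"
    have WS: "W \<subseteq> S" using openin_subset[OF W(1)] top by simp
    have "closedin ?T (H \<inter> S)" using H(1) by (auto simp: closedin_subtopology)
    then have CH: "?C \<subseteq> H \<inter> S" using WS W(2) H(3) by (intro closure_of_minimal) auto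
    have "subtopology ?T ?C = subtopology X ?C"
      using CH by (simp add: subtopology_subtopology Int_absorb1)
    moreover have "subtopology (subtopology X H) ?C = subtopology X ?C"
      using CH by (simp add: subtopology_subtopology Int_absorb1)
    ultimately have hs: "subtopology ?T ?C homeomorphic_space subtopology (subtopology X H) ?C"
      by simp
    have "norming ?T ?B (topspace ?T - W)"
      by (rule removable_norming[OF H(2) T W(1) _ _ hs cB triv]) (use WS W(3) CH top Htop in auto)
    then show ?thesis unfolding top .
  qed
  show False
  proof (cases "S \<subseteq> U")
    case True
    \<comment> \<open>All of S but one point can be removed. The remaining point would be norming,
      but a function that is 0 there and 1 at another point contradicts this.\<close>
    obtain x y where xy: "x \<in> S" "y \<in> S" "x \<noteq> y" by (rule critical_two_points[OF A d S])
    have "closedin ?T {x}" using T(2) xy(1) top by (intro closedin_Hausdorff_singleton) auto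
    then have op: "openin ?T (S - {x})" using openin_diff[OF openin_topspace[of ?T]] top by simp
    have "norming ?T ?B (S - (S - {x}))"
      by (rule rem[OF op]) (use True xy in auto)
    then have n: "norming ?T ?B {x}" using xy by (simp add: double_diff)
    obtain g where g: "g \<in> ?B" "g x = 0" "g y = 1"
      by (rule function_algebra_separating_function[OF fB _ _ xy(3)]) (use top xy in auto)
    have "\<exists>z\<in>{x}. cmod (g y) \<le> cmod (g z)"
      using n g(1) xy(2) top unfolding norming_def by blast
    then show False using g by simp
  next
    case False
    have "openin ?T (S \<inter> U)" using U(1) by (auto simp: openin_subtopology)
    then have n: "norming ?T ?B (S - S \<inter> U)"
      by (rule rem) (use False in auto)
    \<comment> \<open>Comparing \<psi> with the constant 0 yields a point of S where \<psi> is
      nonzero, hence where |f| > c.\<close>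
    obtain x where x: "x \<in> S" "d \<le> cmod (\<psi> x - (\<lambda>x\<in>topspace X. 0) x)"
      using criticalD(2)[OF S function_algebraD(5)[OF A, of 0]] by blast
    then have "\<psi> x \<noteq> 0" using d Ssub by auto
    then have xc: "c < cmod (f x)" using \<psi>(2)[of x] x(1) Ssub by (meson not_le subsetD)
    have "restrict f S \<in> ?B" 
      using f subset_uclosure[OF function_algebraD(1)[OF fT]] by blast
    then obtain y where y: "y \<in> S - S \<inter> U" "cmod (restrict f S x) \<le> cmod (restrict f S y)"
      using n x(1) top unfolding norming_def by blast
    then have "cmod (f x) \<le> cmod (f y)" using x(1) by simp
    also have "\<dots> \<le> c" using y(1) Ssub by (intro c) auto
    finally show False using xc by simp
  qed
qed

text \<open>Adding i t for a large real t turns an imaginary part into a gain in modulus: with b =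
  Im (h x), the squared modulus at x is at least (b + t)^2, but on K it is at most M^2 +
  t^2.\<close>

lemma norming_real:
  assumes X: "compact_space X" and A: "function_algebra X A" and K: "norming X A K"
    and h: "h \<in> A" "\<And>x. x \<in> K \<Longrightarrow> Im (h x) = 0" and x: "x \<in> topspace X"
  shows "Im (h x) = 0"
proof (rule ccontr)
  assume b: "Im (h x) \<noteq> 0"
  define b where "b = Im (h x)"
  obtain M where M: "0 < M" "\<And>x. x \<in> topspace X \<Longrightarrow> cmod (h x) < M"
    by (rule continuous_map_complex_bounded[OF X function_algebra_continuous(1)[OF X A h(1)]]) blast
  \<comment> \<open>With this t, which has the sign of b, the cross term 2 b t equals 2 M^2 and
    exceeds M^2.\<close>
  define t where "t = M\<^sup>2 / b"
  let ?g = "\<lambda>z\<in>topspace X. h z + (\<lambda>z\<in>topspace X. Complex 0 t) z"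
  have "?g \<in> A" by (intro function_algebraD(2)[OF A h(1)] function_algebraD(5)[OF A])
  then obtain y where y: "y \<in> K" "cmod (?g x) \<le> cmod (?g y)"
    using K x unfolding norming_def by blast
  have yX: "y \<in> topspace X" using K y(1) closedin_subset unfolding norming_def by blast
  have "\<bar>Re (h y)\<bar> \<le> M" using abs_Re_le_cmod[of "h y"] M(2)[OF yX] by simp
  then have Mr: "(Re (h y))\<^sup>2 \<le> M\<^sup>2" by (rule abs_le_square_iff[THEN iffD1, OF order_trans]) simp
  have "(cmod (?g x))\<^sup>2 \<le> (cmod (?g y))\<^sup>2" using y(2) by (intro power_mono) auto
  then have "(Re (h x))\<^sup>2 + (b + t)\<^sup>2 \<le> (Re (h y))\<^sup>2 + t\<^sup>2"
    using x yX h(2)[OF y(1)] by (simp add: cmod_power2 b_def)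
  then have "(b + t)\<^sup>2 \<le> M\<^sup>2 + t\<^sup>2" using Mr zero_le_power2[of "Re (h x)"] by linarith
  then have "b\<^sup>2 + 2 * (b * t) \<le> M\<^sup>2" by (simp add: power2_sum algebra_simps)
  moreover have "b * t = M\<^sup>2" using b by (simp add: t_def b_def)
  moreover have "0 < M\<^sup>2" using M(1) by simp
  ultimately show False using zero_le_power2[of b] by linarith
qed

text \<open>Restriction to a norming set is isometric on A, so approximants that converge uniformly
  on K are uniformly Cauchy on X. Their limit lies in A because A is closed.\<close>

lemma norming_restrict_closed:
  assumes X: "compact_space X" and A: "closed_function_algebra X A" and K: "norming X A K"
    and \<psi>: "\<psi> \<in> uclosure (subtopology X K) ((\<lambda>f. restrict f K) ` A)"
  obtains b where "b \<in> A" "\<forall>x\<in>K. b x = \<psi> x"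
proof -
  have fA: "function_algebra X A" and cA: "uclosure X A \<subseteq> A"
    using A closed_function_algebra_iff[OF X] by auto
  have Kc: "closedin X K" using K by (simp add: norming_def)
  have Ksub: "K \<subseteq> topspace X" using closedin_subset[OF Kc] .
  have top: "topspace (subtopology X K) = K" using Ksub by auto
  have "\<exists>a\<in>A. \<forall>x\<in>K. cmod (\<psi> x - a x) < 1 / real (Suc n)" for n
  proof -
    have "0 < 1 / real (Suc n)" by simp
    then obtain r where r: "r \<in> (\<lambda>f. restrict f K) ` A" "\<forall>x\<in>topspace (subtopology X K). cmod (\<psi> x - r x) < 1 / real (Suc n)"
      by (rule uclosureE[OF \<psi>])
    then obtain a where a: "a \<in> A" "r = restrict a K" by blast
    have "\<forall>x\<in>K. cmod (\<psi> x - a x) < 1 / real (Suc n)" using r(2) unfolding top a(2) by simp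
    with a(1) show ?thesis by (intro bexI[of _ a])
  qed
  then obtain a where a: "\<And>n. a n \<in> A" "\<And>n. \<forall>x\<in>K. cmod (\<psi> x - a n x) < 1 / real (Suc n)"
    by metis
  have close: "cmod (a m x - a n x) \<le> 1 / real (Suc m) + 1 / real (Suc n)" if x: "x \<in> topspace X" for m n x
  proof -
    have "(\<lambda>x\<in>topspace X. a m x - a n x) \<in> A" by (rule function_algebra_diff[OF fA a(1) a(1)])
    then obtain y where y: "y \<in> K" 
      "cmod ((\<lambda>x\<in>topspace X. a m x - a n x) x) \<le> cmod ((\<lambda>x\<in>topspace X. a m x - a n x) y)"
      using K x unfolding norming_def by blast
    have "y \<in> topspace X" using y(1) Ksub by blast
    then have "cmod (a m x - a n x) \<le> cmod (a m y - a n y)" using y(2) x by simp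
    also have "\<dots> \<le> cmod (\<psi> y - a m y) + cmod (\<psi> y - a n y)"
      using norm_triangle_ineq4[of "\<psi> y - a n y" "\<psi> y - a m y"] by simp
    also have "\<dots> \<le> 1 / real (Suc m) + 1 / real (Suc n)"
      using bspec[OF a(2)[of m] y(1)] bspec[OF a(2)[of n] y(1)] by linarith
    finally show ?thesis .
  qed
  have small: "\<exists>N. \<forall>n\<ge>N. 1 / real (Suc n) < e" if "0 < e" for e
  proof -
    obtain N where N: "inverse (real (Suc N)) < e" using reals_Archimedean[OF \<open>0 < e\<close>] by blast
    have "1 / real (Suc n) < e" if "N \<le> n" for n
    proof -
      have "1 / real (Suc n) \<le> 1 / real (Suc N)" using that by (simp add: frac_le)
      then show ?thesis using N by (simp add: inverse_eq_divide)
    qed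
    then show ?thesis by blast
  qed
  obtain b where b: "continuous_map X euclidean b"
    "\<And>e. 0 < e \<Longrightarrow> \<forall>\<^sub>F n in sequentially. \<forall>x\<in>topspace X. dist (a n x) (b x) < e"
  proof (rule Met_TC.continuous_map_uniformly_Cauchy_limit[where X = X and f = a])
    show "Met_TC.mcomplete TYPE(complex)" by (simp add: mcomplete_iff_complete complete_UNIV)
    show "\<forall>\<^sub>F n in sequentially. continuous_map X Met_TC.mtopology (a n)"
      using function_algebra_continuous(1)[OF X fA a(1)] by simp
    fix e :: real assume "0 < e"
    then obtain N where N: "\<forall>n\<ge>N. 1 / real (Suc n) < e / 2" using small[of "e/2"] by auto
    have "dist (a m x) (a n x) < e" if "N \<le> m" "N \<le> n" "x \<in> topspace X" for m n x
    proof -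
      have "1 / real (Suc m) < e / 2" "1 / real (Suc n) < e / 2" using N that by blast+
      with close[OF that(3), of m n] show ?thesis unfolding dist_norm by linarith
    qed
    then show "\<exists>N. \<forall>m n x. N \<le> m \<longrightarrow> N \<le> n \<longrightarrow> x \<in> topspace X \<longrightarrow> dist (a m x) (a n x) < e" by blast
  qed auto
  define r where "r = restrict b (topspace X)"
  have "r \<in> uclosure X A"
    unfolding uclosure_def
  proof (intro CollectI conjI allI impI)
    show "r \<in> mspace (cfun X)"
      unfolding r_def mspace_cfun[OF X] using continuous_map_eq[OF b(1)] by auto
    fix e :: real assume "0 < e"
    from b(2)[OF this] obtain n where "\<forall>x\<in>topspace X. dist (a n x) (b x) < e"
      unfolding eventually_sequentially by blast
    then have "\<forall>x\<in>topspace X. cmod (r x - a n x) < e"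
      by (simp add: r_def dist_norm norm_minus_commute)
    then show "\<exists>a\<in>A. \<forall>x\<in>topspace X. cmod (r x - a x) < e" by (intro bexI[OF _ a(1)])
  qed
  then have "r \<in> A" using cA by (rule subsetD[rotated])
  moreover have "r x = \<psi> x" if x: "x \<in> K" for x
  proof -
    have xX: "x \<in> topspace X" using x Ksub by blast
    have "cmod (b x - \<psi> x) < e" if e: "0 < e" for e
    proof -
      have "\<forall>\<^sub>F n in sequentially. 1 / real (Suc n) < e / 2"
        using small[of "e/2"] e by (simp add: eventually_sequentially)
      moreover have "\<forall>\<^sub>F n in sequentially. \<forall>x\<in>topspace X. dist (a n x) (b x) < e/2"
        using e by (intro b(2)) simp
      ultimately have "\<forall>\<^sub>F n in sequentially. 1 / real (Suc n) < e / 2 \<and> (\<forall>x\<in>topspace X. dist (a n x) (b x) < e/2)"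
        by (rule eventually_conj)
      then obtain n where n: "1 / real (Suc n) < e / 2" "\<forall>x\<in>topspace X. dist (a n x) (b x) < e/2"
        unfolding eventually_sequentially by blast
      have "cmod (a n x - b x) < e/2" using bspec[OF n(2) xX] by (simp add: dist_norm)
      moreover have "cmod (\<psi> x - a n x) < e/2" using bspec[OF a(2)[of n] x] n(1) by linarith
      ultimately show ?thesis
        using norm_triangle_ineq[of "\<psi> x - a n x" "a n x - b x"] by (simp add: norm_minus_commute)
    qed
    from this[of "cmod (b x - \<psi> x)"] have "\<not> 0 < cmod (b x - \<psi> x)" by blast
    then show ?thesis using xX by (simp add: r_def)
  qed
  ultimately show thesis by (intro that[of r]) auto
qed

theorem theorem2p20:
  fixes X :: "'a topology"
  assumes "compact_space X" and "Hausdorff_space X" and "PR_scattered X"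
  shows "CSWP X"
  unfolding CSWP_def
proof (intro allI impI)
  note X = assms(1,2)
  fix A assume A: "function_algebra X A"
  have "\<phi> \<in> uclosure X A" if \<phi>: "\<phi> \<in> mspace (cfun X)" for \<phi>
  proof (rule ccontr)
    assume no: "\<phi> \<notin> uclosure X A"
    obtain d S where d: "0 < d" and S: "critical X A \<phi> d S"
      by (rule critical_exists[OF X(1) A \<phi> no])
    have \<phi>c: "continuous_map X euclidean \<phi>" using \<phi> mspace_cfun[OF X(1)] by simp
    have Sc: "closedin X S" using criticalD(1)[OF S] .
    have Ssub: "S \<subseteq> topspace X" using closedin_subset[OF Sc] .
    let ?T = "subtopology X S"
    let ?B = "uclosure ?T ((\<lambda>f. restrict f S) ` A)"
    have top: "topspace ?T = S" using Ssub by auto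
    have T: "compact_space ?T"
      using X Sc by (simp add: closedin_compact_space compact_space_subtopology)
    have fT: "function_algebra ?T ((\<lambda>f. restrict f S) ` A)" by (rule function_algebra_restrict[OF X(1) Sc A])
    have cB: "closed_function_algebra ?T ?B" by (rule closed_function_algebra_uclosure[OF T fT])
    have fB: "function_algebra ?T ?B" by (rule function_algebra_uclosure[OF T fT])
    obtain K where K: "norming ?T ?B K" and Kmin: "\<And>N. N \<subset> K \<Longrightarrow> \<not> norming ?T ?B N"
      by (rule minimal_norming[OF T fB]) blast
    have KT: "closedin ?T K" using K by (simp add: norming_def)
    have KS: "K \<subseteq> S" using closedin_subset[OF KT] top by simp
    have Kc: "closedin X K" using KT Sc closedin_trans_full by blast
    have KX: "K \<subseteq> topspace X" using KS Ssub by blast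
    let ?Y = "subtopology X K"
    have YT: "?Y = subtopology ?T K" using KS by (simp add: subtopology_subtopology Int_absorb1)
    have topY: "topspace ?Y = K" using KX by auto
    have Y: "compact_space ?Y" "Hausdorff_space ?Y"
      using X Kc by (simp_all add: closedin_compact_space compact_space_subtopology Hausdorff_space_subtopology)
    have fY: "function_algebra ?Y ((\<lambda>f. restrict f K) ` ?B)"
      unfolding YT by (rule function_algebra_restrict[OF T KT fB])
    obtain s1 s2 where s: "s1 \<in> S" "s2 \<in> S" "s1 \<noteq> s2" by (rule critical_two_points[OF A d S])
    \<comment> \<open>A single point cannot be norming for an algebra that separates s1 and s2. The
      second point of K is needed to make \<psi> nonconstant.\<close>
    have two: "\<exists>k'\<in>K. k' \<noteq> k" if k: "k \<in> K" for k
    proof (rule ccontr)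
      assume "\<not> ?thesis"
      then have Kk: "K = {k}" using k by blast
      obtain z where z: "z \<in> S" "k \<noteq> z" using s by metis
      obtain g where g: "g \<in> ?B" "g k = 0" "g z = 1"
        by (rule function_algebra_separating_function[OF fB _ _ z(2)]) (use top KS k z in auto)
      have "\<exists>y\<in>K. cmod (g z) \<le> cmod (g y)" using K g(1) z(1) top unfolding norming_def by blast
      then show False using Kk g by simp
    qed
    have "K \<noteq> {}" using K function_algebraD(5)[OF fB] s(1) top unfolding norming_def by blast
    then obtain U where U: "U \<noteq> {}" "openin ?Y U" "pseudo_removable (subtopology X (X closure_of U))"
      using assms(3) Kc unfolding PR_scattered_def by meson
    have UK: "U \<subseteq> K" using openin_subset[OF U(2)] topY by simp
    have UC: "X closure_of U \<subseteq> K" using UK Kc by (rule closure_of_minimal)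
    have "?Y closure_of U = X closure_of U"
      using UK UC by (simp add: closure_of_subtopology Int_absorb1)
    then have PR: "pseudo_removable (subtopology ?Y (?Y closure_of U))"
      using U(3) UC by (simp add: subtopology_subtopology Int_absorb1)
    have KUc: "closedin ?T (K - U)"
    proof -
      have "closedin ?Y (K - U)" using closedin_diff[OF closedin_topspace U(2)] topY by simp
      then show ?thesis using KT unfolding YT by (rule closedin_trans_full)
    qed
    have "K - U \<subset> K" using U(1) UK by blast
    from Kmin[OF this] obtain f0 z0 where f0: "f0 \<in> ?B" and z0: "z0 \<in> S" 
      and lt0: "\<And>y. y \<in> K - U \<Longrightarrow> cmod (f0 y) < cmod (f0 z0)"
      using KUc unfolding norming_def top by (meson not_le)
    obtain k0 where k0: "k0 \<in> K" "cmod (f0 z0) \<le> cmod (f0 k0)"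
      using K f0 z0 unfolding norming_def top by blast
    \<comment> \<open>A uniform bound c below |f0 z0| requires |f0 z0| > 0. If it is 0, the strict
      inequality leaves K - U empty, and the constant 1 with c = 0 serves.\<close>
    obtain f c k where f: "f \<in> ?B" and k: "k \<in> K" "c < cmod (f k)" 
      and c: "\<forall>y\<in>K - U. cmod (f y) \<le> c"
    proof (cases "f0 z0 = 0")
      case True
      have "K - U = {}"
      proof (rule ccontr)
        assume "K - U \<noteq> {}"
        then obtain y where "y \<in> K - U" by blast
        from lt0[OF this] True show False by simp
      qed
      show thesis
      proof (rule that[OF function_algebraD(5)[OF fB, of 1] k0(1), of 0])
        show "0 < cmod ((\<lambda>x\<in>topspace ?T. 1) k0)" using k0(1) KS top by auto
        show "\<forall>y\<in>K - U. cmod ((\<lambda>x\<in>topspace ?T. 1) y) \<le> 0"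
          unfolding \<open>K - U = {}\<close> by simp
      qed
    next
      case False
      have fc: "continuous_map ?T euclidean f0" by (rule function_algebra_continuous(1)[OF T fB f0])
      have "0 < cmod (f0 z0)" using False by simp
      then obtain c where c: "c < cmod (f0 z0)" "\<forall>y\<in>K - U. cmod (f0 y) \<le> c"
        by (rule closed_subset_strict_bound[OF T KUc fc _ lt0]) blast
      show thesis by (rule that[OF f0 k0(1) less_le_trans[OF c(1) k0(2)] c(2)])
    qed
    obtain k' where k': "k' \<in> K" "k' \<noteq> k" using two[OF k(1)] by blast
    let ?f = "restrict f K"
    have fm: "?f \<in> (\<lambda>f. restrict f K) ` ?B" using f by (rule imageI)
    have fc: "continuous_map ?Y euclidean ?f" by (rule function_algebra_continuous(1)[OF Y(1) fY fm])
    \<comment> \<open>Including k' makes \<psi> vanish there although it is 1 at k, so \<psi> is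
      nonconstant even if |f| > c on all of K.\<close>
    let ?Z = "{x \<in> K. cmod (f x) \<le> c} \<union> {k'}"
    have "closedin ?Y {x \<in> topspace ?Y. ?f x \<in> cball 0 c}"
      by (rule closedin_continuous_map_preimage[OF fc]) simp
    moreover have "{x \<in> topspace ?Y. ?f x \<in> cball 0 c} = {x \<in> K. cmod (f x) \<le> c}"
      unfolding topY by auto
    moreover have "closedin ?Y {k'}" using Y(2) k'(1) topY by (intro closedin_Hausdorff_singleton) auto
    ultimately have Zc: "closedin ?Y ?Z" by (metis closedin_Un)
    have kc: "closedin ?Y {k}" using Y(2) k(1) topY by (intro closedin_Hausdorff_singleton) auto
    have dis: "disjnt ?Z {k}" using k k' by (auto simp: disjnt_iff)
    have "normal_space ?Y" using Y compact_Hausdorff_or_regular_imp_normal_space by blast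
    then obtain r where r: "continuous_map ?Y euclideanreal r" "r ` ?Z \<subseteq> {0}" "r ` {k} \<subseteq> {1}"
      by (rule Urysohn_lemma_alt[OF _ Zc kc dis]) blast
    define \<psi> where "\<psi> = (\<lambda>x\<in>K. complex_of_real (r x))"
    have "continuous_map ?Y euclidean (\<lambda>x. complex_of_real (r x))"
    proof -
      have "continuous_map euclideanreal euclidean complex_of_real" by (auto intro!: continuous_intros)
      from continuous_map_compose[OF r(1) this] show ?thesis by (simp add: comp_def)
    qed
    then have "continuous_map ?Y euclidean \<psi>"
      by (rule continuous_map_eq) (simp add: \<psi>_def)
    then have \<psi>m: "\<psi> \<in> mspace (cfun ?Y)" unfolding mspace_cfun[OF Y(1)] topY by (simp add: \<psi>_def)
    have \<psi>0: "\<psi> x = 0" if "x \<in> ?Z" for x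
    proof -
      have "r x = 0" using r(2) that by blast
      moreover have "x \<in> K" using that k'(1) by blast
      ultimately show ?thesis by (simp add: \<psi>_def)
    qed
    have "\<psi> \<in> uclosure ?Y ((\<lambda>f. restrict f K) ` ?B)"
    proof (rule approximation_on_pseudo_removable[OF Y fY fm U(2) PR _ \<psi>m])
      show "cmod (?f x) \<le> c" if "x \<in> topspace ?Y" "x \<notin> U" for x
        using that c unfolding topY by simp
      show "\<psi> x = 0" if "x \<in> topspace ?Y" "cmod (?f x) \<le> c" for x
        using that unfolding topY by (intro \<psi>0) simp
    qed
    then obtain b where b: "b \<in> ?B" "\<forall>x\<in>K. b x = \<psi> x"
      unfolding YT by (rule norming_restrict_closed[OF T cB K]) blast
    have "Im (b x) = 0" if "x \<in> K" for x
      using bspec[OF b(2) that] that by (simp add: \<psi>_def)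
    then have real: "Im (b x) = 0" if "x \<in> S" for x
      using norming_real[OF T fB K b(1)] that top by blast
    have "b k = b k'"
      using critical_antisymmetric[OF X(1) A \<phi>c d S b(1) real] k(1) k'(1) KS by blast
    moreover have "b k' = 0" using b(2) k'(1) \<psi>0[of k'] by simp
    moreover have "b k = 1" using b(2) k(1) r(3) by (simp add: \<psi>_def)
    ultimately show False by simp
  qed
  moreover have "uclosure X A \<subseteq> mspace (cfun X)" by (auto simp: uclosure_def)
  ultimately show "mtopology_of (cfun X) closure_of A = mspace (cfun X)"
    using closure_of_cfun[OF X(1) function_algebraD(1)[OF A]] by blast
qed

end
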